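(* Let $M$ be a von Neumann algebra and $(N_t)_{t\in[0,T]}$ an increasing family of abelian von Neumann subalgebras of $M$. Let $\psi$ be a faithful normal state on $M$ such that $(N_t)$ is modularly compatible with $\psi$, i.e. for every $t\in[0,T]$, $\sigma_s^\psi(N_t)=N_t$ for all $s\in\mathbb R$ (or, if the normal state $\psi$ is not faithful on $M$, work on the faithful reduction: replace $(M,N_t,\psi)$ throughout by $(M^\psi,N_t^\psi,\psi|_{M^\psi})$ as defined in the context). Then for each $t\in[0,T]$ there exists a unique normal $\psi$-preserving conditional expectation $$E_t^\psi:M\to N_t .$$ Moreover, $E_t^\psi$ is unital, completely positive, idempotent, and satisfies the $N_t$-bimodule property $E_t^\psi(aXb)=aE_t^\psi(X)b$ for $a,b\in N_t$, $X\in M$.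
   Context: $(\sigma_s^\psi)_{s\in\mathbb R}$ is the modular automorphism group of a faithful normal state $\psi$ (Tomita–Takesaki theory). A conditional expectation of $M$ onto a von Neumann subalgebra $N$ is a norm-one linear projection of $M$ onto $N$; it is $\psi$-preserving if $\psi\circ E=\psi$. Faithful reduction: if a normal state $\psi$ is not faithful on $M$, let $s(\psi)\in M$ be its support projection; then $\psi$ is faithful on the reduced algebra $M^\psi:=s(\psi)Ms(\psi)$, and all modular and conditional-expectation constructions are carried out on $M^\psi$ with the reduced subalgebras $N_t^\psi:=s(\psi)N_ts(\psi)$. In that case the notation $(M,N_t,\psi)$ is understood to refer to this faithful reduction. *)

theory Defs
  imports "HOL-Analysis.Analysis"
begin

section \<open>Complex Hilbert spaces and bounded operators\<close>

text \<open>The inner product is linear in its second argument. Its real part is the real inner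
  product of the parent class, so norm and topology are inherited from there.\<close>

class complex_hilbert_space = real_inner + complete_space +
  fixes scaleC :: "complex \<Rightarrow> 'a \<Rightarrow> 'a"  (infixr "*\<^sub>C" 75)
    and cinner :: "'a \<Rightarrow> 'a \<Rightarrow> complex"
  assumes scaleC_add_right: "c *\<^sub>C (x + y) = c *\<^sub>C x + c *\<^sub>C y"
    and scaleC_add_left: "(c + d) *\<^sub>C x = c *\<^sub>C x + d *\<^sub>C x"
    and scaleC_scaleC: "c *\<^sub>C d *\<^sub>C x = (c * d) *\<^sub>C x"
    and scaleC_of_real: "complex_of_real r *\<^sub>C x = r *\<^sub>R x"
    and cinner_commute: "cinner x y = cnj (cinner y x)"
    and cinner_add_right: "cinner x (y + z) = cinner x y + cinner x z"
    and cinner_scaleC_right: "cinner x (c *\<^sub>C y) = c * cinner x y"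
    and Re_cinner: "Re (cinner x y) = inner x y"

instantiation complex :: complex_hilbert_space
begin

definition scaleC_complex :: "complex \<Rightarrow> complex \<Rightarrow> complex"
  where "scaleC_complex c x = c * x"

definition cinner_complex :: "complex \<Rightarrow> complex \<Rightarrow> complex"
  where "cinner_complex x y = cnj x * y"

instance
  by standard
    (auto simp: scaleC_complex_def cinner_complex_def inner_complex_def algebra_simps
      scaleR_conv_of_real)

end

definition bounded_clinear :: "('a::complex_hilbert_space \<Rightarrow> 'a) \<Rightarrow> bool"
  where "bounded_clinear x \<longleftrightarrow> bounded_linear x \<and> (\<forall>c \<xi>. x (c *\<^sub>C \<xi>) = c *\<^sub>C x \<xi>)"

definition adj :: "('a::complex_hilbert_space \<Rightarrow> 'a) \<Rightarrow> 'a \<Rightarrow> 'a"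
  where "adj x = (THE y. bounded_clinear y \<and> (\<forall>\<xi> \<eta>. cinner (y \<xi>) \<eta> = cinner \<xi> (x \<eta>)))"

text \<open>On a complex Hilbert space an operator with nonnegative quadratic form is self-adjoint.\<close>

definition positive_op :: "('a::complex_hilbert_space \<Rightarrow> 'a) \<Rightarrow> bool"
  where "positive_op x \<longleftrightarrow> bounded_clinear x \<and> (\<forall>\<xi>. cinner \<xi> (x \<xi>) \<in> \<real>\<^sub>\<ge>\<^sub>0)"

definition op_le :: "('a::complex_hilbert_space \<Rightarrow> 'a) \<Rightarrow> ('a \<Rightarrow> 'a) \<Rightarrow> bool"
  where "op_le x y \<longleftrightarrow> positive_op (\<lambda>\<xi>. y \<xi> - x \<xi>)"

definition is_projection :: "('a::complex_hilbert_space \<Rightarrow> 'a) \<Rightarrow> bool"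
  where "is_projection p \<longleftrightarrow> bounded_clinear p \<and> adj p = p \<and> p \<circ> p = p"

definition weak_operator_topology :: "('a::complex_hilbert_space \<Rightarrow> 'a) topology"
  where "weak_operator_topology =
    pullback_topology (Collect bounded_clinear) (\<lambda>x (\<xi>, \<eta>). cinner \<xi> (x \<eta>)) euclidean"


section \<open>Von Neumann algebras\<close>

definition star_subalgebra :: "('a::complex_hilbert_space \<Rightarrow> 'a) set \<Rightarrow> bool"
  where "star_subalgebra M \<longleftrightarrow>
    M \<subseteq> Collect bounded_clinear \<and> (\<lambda>\<xi>. 0) \<in> M \<and>
    (\<forall>x\<in>M. \<forall>y\<in>M. (\<lambda>\<xi>. x \<xi> + y \<xi>) \<in> M) \<and>
    (\<forall>c. \<forall>x\<in>M. (\<lambda>\<xi>. c *\<^sub>C x \<xi>) \<in> M) \<and>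
    (\<forall>x\<in>M. \<forall>y\<in>M. x \<circ> y \<in> M) \<and>
    (\<forall>x\<in>M. adj x \<in> M)"

definition is_unit_of :: "('a \<Rightarrow> 'a) set \<Rightarrow> ('a \<Rightarrow> 'a) \<Rightarrow> bool"
  where "is_unit_of M e \<longleftrightarrow> e \<in> M \<and> (\<forall>x\<in>M. e \<circ> x = x \<and> x \<circ> e = x)"

definition op_unit :: "('a \<Rightarrow> 'a) set \<Rightarrow> 'a \<Rightarrow> 'a"
  where "op_unit M = (THE e. is_unit_of M e)"

text \<open>The unit \<open>e\<close> of a von Neumann algebra need not be the identity of the ambient space:
  the algebra acts nondegenerately on the range of \<open>e\<close>. Thus a corner \<open>p M p\<close> is again a von
  Neumann algebra, with unit \<open>p\<close>.\<close>

definition von_neumann_algebra :: "('a::complex_hilbert_space \<Rightarrow> 'a) set \<Rightarrow> bool"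
  where "von_neumann_algebra M \<longleftrightarrow>
    star_subalgebra M \<and> (\<exists>e. is_unit_of M e) \<and> closedin weak_operator_topology M"

text \<open>Von Neumann subalgebras contain the unit of the larger algebra.\<close>

definition von_neumann_subalgebra ::
    "('a::complex_hilbert_space \<Rightarrow> 'a) set \<Rightarrow> ('a \<Rightarrow> 'a) set \<Rightarrow> bool"
  where "von_neumann_subalgebra N M \<longleftrightarrow>
    von_neumann_algebra N \<and> N \<subseteq> M \<and> op_unit M \<in> N"

definition abelian :: "('a \<Rightarrow> 'a) set \<Rightarrow> bool"
  where "abelian N \<longleftrightarrow> (\<forall>x\<in>N. \<forall>y\<in>N. x \<circ> y = y \<circ> x)"

definition corner :: "('a \<Rightarrow> 'a) \<Rightarrow> ('a \<Rightarrow> 'a) set \<Rightarrow> ('a \<Rightarrow> 'a) set"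
  where "corner p M = (\<lambda>x. p \<circ> x \<circ> p) ` M"


section \<open>Normal states\<close>

definition sa_part :: "('a::complex_hilbert_space \<Rightarrow> 'a) set \<Rightarrow> ('a \<Rightarrow> 'a) set"
  where "sa_part M = {x \<in> M. adj x = x}"

definition op_directed :: "('a::complex_hilbert_space \<Rightarrow> 'a) set \<Rightarrow> bool"
  where "op_directed D \<longleftrightarrow> D \<noteq> {} \<and> (\<forall>x\<in>D. \<forall>y\<in>D. \<exists>z\<in>D. op_le x z \<and> op_le y z)"

definition is_op_lub ::
    "('a::complex_hilbert_space \<Rightarrow> 'a) set \<Rightarrow> ('a \<Rightarrow> 'a) set \<Rightarrow> ('a \<Rightarrow> 'a) \<Rightarrow> bool"
  where "is_op_lub M D x \<longleftrightarrow>
    x \<in> sa_part M \<and> (\<forall>d\<in>D. op_le d x) \<and>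
    (\<forall>y\<in>sa_part M. (\<forall>d\<in>D. op_le d y) \<longrightarrow> op_le x y)"

definition state :: "('a::complex_hilbert_space \<Rightarrow> 'a) set \<Rightarrow> (('a \<Rightarrow> 'a) \<Rightarrow> complex) \<Rightarrow> bool"
  where "state M \<psi> \<longleftrightarrow>
    (\<forall>x\<in>M. \<forall>y\<in>M. \<psi> (\<lambda>\<xi>. x \<xi> + y \<xi>) = \<psi> x + \<psi> y) \<and>
    (\<forall>c. \<forall>x\<in>M. \<psi> (\<lambda>\<xi>. c *\<^sub>C x \<xi>) = c * \<psi> x) \<and>
    (\<forall>x\<in>M. positive_op x \<longrightarrow> \<psi> x \<in> \<real>\<^sub>\<ge>\<^sub>0) \<and>
    \<psi> (op_unit M) = 1"

text \<open>A positive functional is normal if it preserves suprema of bounded increasing nets of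
  self-adjoint elements; nets are represented by their (upward directed) ranges.\<close>

definition normal_functional ::
    "('a::complex_hilbert_space \<Rightarrow> 'a) set \<Rightarrow> (('a \<Rightarrow> 'a) \<Rightarrow> complex) \<Rightarrow> bool"
  where "normal_functional M \<psi> \<longleftrightarrow>
    (\<forall>D x. D \<subseteq> sa_part M \<and> op_directed D \<and> is_op_lub M D x \<longrightarrow>
       Re (\<psi> x) = (SUP d\<in>D. Re (\<psi> d)))"

definition normal_state ::
    "('a::complex_hilbert_space \<Rightarrow> 'a) set \<Rightarrow> (('a \<Rightarrow> 'a) \<Rightarrow> complex) \<Rightarrow> bool"
  where "normal_state M \<psi> \<longleftrightarrow> state M \<psi> \<and> normal_functional M \<psi>"

definition faithful_on ::
    "('a::complex_hilbert_space \<Rightarrow> 'a) set \<Rightarrow> (('a \<Rightarrow> 'a) \<Rightarrow> complex) \<Rightarrow> bool"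
  where "faithful_on M \<psi> \<longleftrightarrow> (\<forall>x\<in>M. positive_op x \<and> \<psi> x = 0 \<longrightarrow> x = (\<lambda>\<xi>. 0))"

definition is_support_projection ::
    "('a::complex_hilbert_space \<Rightarrow> 'a) set \<Rightarrow> (('a \<Rightarrow> 'a) \<Rightarrow> complex) \<Rightarrow> ('a \<Rightarrow> 'a) \<Rightarrow> bool"
  where "is_support_projection M \<psi> p \<longleftrightarrow>
    p \<in> M \<and> is_projection p \<and> \<psi> p = 1 \<and>
    (\<forall>q\<in>M. is_projection q \<and> \<psi> q = 1 \<longrightarrow> op_le p q)"


section \<open>The modular automorphism group\<close>

text \<open>The GNS representation of \<open>\<psi>\<close> is unique up to unitary equivalence. It lives on a Hilbert
  space type of its own, which is not determined by the type \<open>M\<close> acts on.\<close>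

definition gns_representation ::
    "('a::complex_hilbert_space \<Rightarrow> 'a) set \<Rightarrow> (('a \<Rightarrow> 'a) \<Rightarrow> complex) \<Rightarrow>
     (('a \<Rightarrow> 'a) \<Rightarrow> 'b::complex_hilbert_space \<Rightarrow> 'b) \<Rightarrow> 'b \<Rightarrow> bool"
  where "gns_representation M \<psi> \<pi> \<Omega> \<longleftrightarrow>
    (\<forall>x\<in>M. bounded_clinear (\<pi> x)) \<and>
    (\<forall>x\<in>M. \<forall>y\<in>M. \<pi> (\<lambda>\<xi>. x \<xi> + y \<xi>) = (\<lambda>\<xi>. \<pi> x \<xi> + \<pi> y \<xi>)) \<and>
    (\<forall>c. \<forall>x\<in>M. \<pi> (\<lambda>\<xi>. c *\<^sub>C x \<xi>) = (\<lambda>\<xi>. c *\<^sub>C \<pi> x \<xi>)) \<and>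
    (\<forall>x\<in>M. \<forall>y\<in>M. \<pi> (x \<circ> y) = \<pi> x \<circ> \<pi> y) \<and>
    (\<forall>x\<in>M. \<pi> (adj x) = adj (\<pi> x)) \<and>
    (\<forall>x\<in>M. \<psi> x = cinner \<Omega> (\<pi> x \<Omega>)) \<and>
    closure ((\<lambda>x. \<pi> x \<Omega>) ` M) = UNIV"

text \<open>Unbounded operators are represented by their graphs. The Tomita operator \<open>S\<close> is the closure
  of the antilinear map \<open>x \<Omega> \<mapsto> x\<^sup>* \<Omega>\<close>; the adjoint of an antilinear operator is characterised by
  \<open>\<langle>S \<xi>, \<eta>\<rangle> = \<langle>S\<^sup>* \<eta>, \<xi>\<rangle>\<close>; the modular operator is \<open>\<Delta> = S\<^sup>* S\<close>.\<close>

definition tomita_graph ::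
    "('a::complex_hilbert_space \<Rightarrow> 'a) set \<Rightarrow>
     (('a \<Rightarrow> 'a) \<Rightarrow> 'b::complex_hilbert_space \<Rightarrow> 'b) \<Rightarrow> 'b \<Rightarrow> ('b \<times> 'b) set"
  where "tomita_graph M \<pi> \<Omega> = closure ((\<lambda>x. (\<pi> x \<Omega>, \<pi> (adj x) \<Omega>)) ` M)"

definition antilinear_adjoint_graph :: "('b::complex_hilbert_space \<times> 'b) set \<Rightarrow> ('b \<times> 'b) set"
  where "antilinear_adjoint_graph S = {(\<eta>, \<zeta>). \<forall>(\<xi>, \<xi>')\<in>S. cinner \<xi>' \<eta> = cinner \<zeta> \<xi>}"

definition modular_operator_graph ::
    "('a::complex_hilbert_space \<Rightarrow> 'a) set \<Rightarrow>
     (('a \<Rightarrow> 'a) \<Rightarrow> 'b::complex_hilbert_space \<Rightarrow> 'b) \<Rightarrow> 'b \<Rightarrow> ('b \<times> 'b) set"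
  where "modular_operator_graph M \<pi> \<Omega> =
    tomita_graph M \<pi> \<Omega> O antilinear_adjoint_graph (tomita_graph M \<pi> \<Omega>)"

definition projection_valued_measure ::
    "(real set \<Rightarrow> 'b::complex_hilbert_space \<Rightarrow> 'b) \<Rightarrow> bool"
  where "projection_valued_measure P \<longleftrightarrow>
    (\<forall>B\<in>sets borel. is_projection (P B)) \<and> P UNIV = id \<and>
    (\<forall>A::nat \<Rightarrow> real set. range A \<subseteq> sets borel \<and> disjoint_family A \<longrightarrow>
       (\<forall>\<xi>. (\<lambda>n. P (A n) \<xi>) sums P (\<Union>n. A n) \<xi>))"

definition spectral_distribution ::
    "(real set \<Rightarrow> 'b::complex_hilbert_space \<Rightarrow> 'b) \<Rightarrow> 'b \<Rightarrow> real measure"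
  where "spectral_distribution P \<xi> =
    measure_of UNIV (sets borel) (\<lambda>B. ennreal (Re (cinner \<xi> (P B \<xi>))))"

text \<open>\<open>P\<close> is the spectral measure of the (linear) operator with graph \<open>A\<close>, i.e. \<open>A\<close> is the
  integral of \<open>l\<close> against \<open>P\<close>. Complex integrals against \<open>P\<close> are described by their
  quadratic forms, which determine them by polarization.\<close>

definition is_spectral_measure ::
    "('b::complex_hilbert_space \<times> 'b) set \<Rightarrow> (real set \<Rightarrow> 'b \<Rightarrow> 'b) \<Rightarrow> bool"
  where "is_spectral_measure A P \<longleftrightarrow>
    projection_valued_measure P \<and>
    Domain A = {\<xi>. integrable (spectral_distribution P \<xi>) (\<lambda>l. l\<^sup>2)} \<and>
    (\<forall>(\<xi>, \<eta>)\<in>A. cinner \<xi> \<eta> = complex_of_real (\<integral>l. l \<partial>spectral_distribution P \<xi>))"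

definition is_spectral_integral ::
    "(real set \<Rightarrow> 'b::complex_hilbert_space \<Rightarrow> 'b) \<Rightarrow> (real \<Rightarrow> complex) \<Rightarrow> ('b \<Rightarrow> 'b) \<Rightarrow> bool"
  where "is_spectral_integral P f u \<longleftrightarrow>
    bounded_clinear u \<and> (\<forall>\<xi>. cinner \<xi> (u \<xi>) = (\<integral>l. f l \<partial>spectral_distribution P \<xi>))"

text \<open>\<open>u s = \<Delta>\<^sup>i\<^sup>s\<close> by Borel functional calculus. As \<open>\<Delta>\<close> is positive and injective, its
  spectral measure is carried by the positive reals, where \<open>l powr (\<i> s) = exp (\<i> s ln l)\<close>.\<close>

definition is_imaginary_powers ::
    "('b::complex_hilbert_space \<times> 'b) set \<Rightarrow> (real \<Rightarrow> 'b \<Rightarrow> 'b) \<Rightarrow> bool"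
  where "is_imaginary_powers A u \<longleftrightarrow>
    (\<exists>P. is_spectral_measure A P \<and>
      (\<forall>s. is_spectral_integral P (\<lambda>l. complex_of_real l powr (\<i> * complex_of_real s)) (u s)))"

text \<open>The modular automorphism group of a faithful normal state: \<open>\<sigma> s x = \<Delta>\<^sup>i\<^sup>s x \<Delta>\<^sup>-\<^sup>i\<^sup>s\<close>, with
  \<open>M\<close> identified with its image under the (injective) GNS representation.\<close>

definition is_modular_group ::
    "('a::complex_hilbert_space \<Rightarrow> 'a) set \<Rightarrow>
     (('a \<Rightarrow> 'a) \<Rightarrow> complex) \<Rightarrow> (('a \<Rightarrow> 'a) \<Rightarrow> 'b::complex_hilbert_space \<Rightarrow> 'b) \<Rightarrow> 'b \<Rightarrow>
     (real \<Rightarrow> ('a \<Rightarrow> 'a) \<Rightarrow> ('a \<Rightarrow> 'a)) \<Rightarrow> bool"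
  where "is_modular_group M \<psi> \<pi> \<Omega> \<sigma> \<longleftrightarrow>
    gns_representation M \<psi> \<pi> \<Omega> \<and>
    (\<exists>u. is_imaginary_powers (modular_operator_graph M \<pi> \<Omega>) u \<and>
      (\<forall>s. \<forall>x\<in>M. \<sigma> s x \<in> M \<and> \<pi> (\<sigma> s x) = u s \<circ> \<pi> x \<circ> u (- s)))"

definition modularly_compatible ::
    "real \<Rightarrow> (real \<Rightarrow> ('a \<Rightarrow> 'a) set) \<Rightarrow> (real \<Rightarrow> ('a \<Rightarrow> 'a) \<Rightarrow> ('a \<Rightarrow> 'a)) \<Rightarrow> bool"
  where "modularly_compatible T N \<sigma> \<longleftrightarrow> (\<forall>t\<in>{0..T}. \<forall>s. \<sigma> s ` N t = N t)"


section \<open>Conditional expectations\<close>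

definition linear_map_on ::
    "('a::complex_hilbert_space \<Rightarrow> 'a) set \<Rightarrow> (('a \<Rightarrow> 'a) \<Rightarrow> ('a \<Rightarrow> 'a)) \<Rightarrow> bool"
  where "linear_map_on M E \<longleftrightarrow>
    (\<forall>x\<in>M. \<forall>y\<in>M. E (\<lambda>\<xi>. x \<xi> + y \<xi>) = (\<lambda>\<xi>. E x \<xi> + E y \<xi>)) \<and>
    (\<forall>c. \<forall>x\<in>M. E (\<lambda>\<xi>. c *\<^sub>C x \<xi>) = (\<lambda>\<xi>. c *\<^sub>C E x \<xi>))"

definition has_map_norm ::
    "('a::complex_hilbert_space \<Rightarrow> 'a) set \<Rightarrow> (('a \<Rightarrow> 'a) \<Rightarrow> ('a \<Rightarrow> 'a)) \<Rightarrow> real \<Rightarrow> bool"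
  where "has_map_norm M E K \<longleftrightarrow>
    0 \<le> K \<and> (\<forall>x\<in>M. onorm (E x) \<le> K * onorm x) \<and>
    (\<forall>L\<ge>0. (\<forall>x\<in>M. onorm (E x) \<le> L * onorm x) \<longrightarrow> K \<le> L)"

definition conditional_expectation ::
    "('a::complex_hilbert_space \<Rightarrow> 'a) set \<Rightarrow> ('a \<Rightarrow> 'a) set \<Rightarrow>
     (('a \<Rightarrow> 'a) \<Rightarrow> ('a \<Rightarrow> 'a)) \<Rightarrow> bool"
  where "conditional_expectation M N E \<longleftrightarrow>
    linear_map_on M E \<and> (\<forall>x\<in>M. E x \<in> N) \<and> (\<forall>a\<in>N. E a = a) \<and> has_map_norm M E 1"

definition normal_map ::
    "('a::complex_hilbert_space \<Rightarrow> 'a) set \<Rightarrow> ('a \<Rightarrow> 'a) set \<Rightarrow>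
     (('a \<Rightarrow> 'a) \<Rightarrow> ('a \<Rightarrow> 'a)) \<Rightarrow> bool"
  where "normal_map M N E \<longleftrightarrow>
    (\<forall>D x. D \<subseteq> sa_part M \<and> op_directed D \<and> is_op_lub M D x \<longrightarrow> is_op_lub N (E ` D) (E x))"

definition normal_preserving_expectation ::
    "('a::complex_hilbert_space \<Rightarrow> 'a) set \<Rightarrow> ('a \<Rightarrow> 'a) set \<Rightarrow> (('a \<Rightarrow> 'a) \<Rightarrow> complex) \<Rightarrow>
     (('a \<Rightarrow> 'a) \<Rightarrow> ('a \<Rightarrow> 'a)) \<Rightarrow> bool"
  where "normal_preserving_expectation M N \<psi> E \<longleftrightarrow>
    conditional_expectation M N E \<and> normal_map M N E \<and> (\<forall>x\<in>M. \<psi> (E x) = \<psi> x)"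

text \<open>Positivity of the \<open>n \<times> n\<close> operator matrix \<open>X\<close> acting on the \<open>n\<close>-fold direct sum.\<close>

definition positive_op_matrix :: "nat \<Rightarrow> (nat \<Rightarrow> nat \<Rightarrow> 'a::complex_hilbert_space \<Rightarrow> 'a) \<Rightarrow> bool"
  where "positive_op_matrix n X \<longleftrightarrow>
    (\<forall>\<xi>. (\<Sum>i<n. \<Sum>j<n. cinner (\<xi> i) (X i j (\<xi> j))) \<in> \<real>\<^sub>\<ge>\<^sub>0)"

definition completely_positive_on ::
    "('a::complex_hilbert_space \<Rightarrow> 'a) set \<Rightarrow> (('a \<Rightarrow> 'a) \<Rightarrow> ('a \<Rightarrow> 'a)) \<Rightarrow> bool"
  where "completely_positive_on M E \<longleftrightarrow>
    (\<forall>n X. (\<forall>i<n. \<forall>j<n. X i j \<in> M) \<and> positive_op_matrix n X \<longrightarrow>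
       positive_op_matrix n (\<lambda>i j. E (X i j)))"

end

theory Submission
  imports Defs "HOL-Probability.Probability"
begin

text \<open>
  Write \<open>a\<^sub>s = \<sigma> s a\<close> and \<open>\<Delta>\<close> for the modular operator. For \<open>a \<in> N\<close> all \<open>a\<^sub>s\<close> lie in the abelian algebra
  \<open>N\<close>, so \<open>\<langle>a\<^sup>*\<Omega>, \<Delta>\<^sup>i\<^sup>s a\<^sup>*\<Omega>\<rangle> = \<psi> (a a\<^sub>s\<^sup>*) = \<psi> (a\<^sub>s\<^sup>* a)\<close> is the conjugate of \<open>\<langle>a\<Omega>, \<Delta>\<^sup>i\<^sup>s a\<Omega>\<rangle>\<close>. By
  uniqueness of characteristic functions the spectral distributions of \<open>\<Delta>\<close> at \<open>a\<Omega>\<close> and \<open>a\<^sup>*\<Omega>\<close> are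
  related by \<open>l \<mapsto> 1 / l\<close>. Together with \<open>\<integral> l \<le> \<parallel>S a\<Omega>\<parallel>\<^sup>2 = \<parallel>a\<Omega>\<parallel>\<^sup>2\<close>, for \<open>a\<close> and \<open>a\<^sup>*\<close>, this gives
  \<open>\<integral> (l + 1 / l) \<le> 2 \<parallel>a\<Omega>\<parallel>\<^sup>2\<close>, whence \<open>\<Delta> a\<Omega> = a\<Omega>\<close>: an abelian \<open>\<sigma>\<close>-invariant \<open>N\<close> lies in the centralizer of
  \<open>\<psi>\<close>, that is \<open>\<psi> (a x) = \<psi> (x a)\<close> for all \<open>x\<close>.

  The functionals \<open>a \<mapsto> \<psi> (x a)\<close>, \<open>0 \<le> x \<le> 1\<close>, on \<open>N\<close> are then positive and dominated by \<open>\<psi>\<close>. Their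
  densities \<open>E x\<close> are found by minimising \<open>\<psi> ((x - h)\<^sup>2)\<close> over \<open>0 \<le> h \<le> 1\<close> in \<open>N\<close>, which is complete for
  this distance. Conversely a norm-one projection \<open>F\<close> preserving \<open>\<psi>\<close> is positive, and cutting \<open>\<psi> \<circ> F\<close>
  with Bernstein weights of \<open>a\<close> shows \<open>\<psi> (a F x) = \<psi> (a x)\<close>, so that \<open>F = E\<close>.
\<close>

section \<open>Complex inner products and adjoints\<close>

text \<open>The usual construction compresses by a projection of the GNS space and needs the
  commutation theorem to return to \<open>N\<close>. Here the modular operator is known only through
  its spectral measure and the quadratic forms of its powers. Commutativity opens a shorter way: l +
  1/l exceeds 2 except at l = 1, so the integral bound puts all spectral mass of a\<Omega> at 1. A
  vector \<xi> fixed by \<Delta> satisfies <S\<kappa>, S\<xi>> = <\<xi>, \<kappa>>; for \<kappa> =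
  x\<Omega> and \<xi> the adjoint of a applied to \<Omega>, this is the trace identity \<psi>(xa) =
  \<psi>(ax). With that the modular group has done its work and a Radon-Nikodym argument is left.
  Its obstacle is that neither square roots nor spectral projections are at hand in
  \<open>N\<close>, and that normality moves \<psi> through monotone limits only. Polynomials in
  elements of the unit interval, with explicit errors of order 1/n, stand in for roots and indicator
  functions; this accounts for most of the operator estimates.\<close>

lemma cinner_add_left: "cinner (x + y) z = cinner x z + cinner y z"
  by (metis cinner_add_right cinner_commute complex_cnj_add)

lemma cinner_scaleC_left: "cinner (c *\<^sub>C x) y = cnj c * cinner x y"
  by (metis cinner_scaleC_right cinner_commute complex_cnj_mult)

lemma cinner_scaleR_right: "cinner x (r *\<^sub>R y) = of_real r * cinner x y"
  by (metis cinner_scaleC_right scaleC_of_real)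

lemma cinner_scaleR_left: "cinner (r *\<^sub>R x) y = of_real r * cinner x y"
  by (metis cinner_scaleC_left scaleC_of_real complex_cnj_complex_of_real)

lemma cinner_zero_right [simp]: "cinner x 0 = 0"
  using cinner_scaleR_right[of x 0 0] by simp

lemma cinner_zero_left [simp]: "cinner 0 x = 0"
  using cinner_scaleR_left[of 0 0 x] by simp

lemma cinner_minus_right: "cinner x (- y) = - cinner x y"
  using cinner_scaleR_right[of x "-1" y] by simp

lemma cinner_minus_left: "cinner (- x) y = - cinner x y"
  using cinner_scaleR_left[of "-1" x y] by simp

lemma cinner_diff_right: "cinner x (y - z) = cinner x y - cinner x z"
  using cinner_add_right[of x y "- z"] by (simp add: cinner_minus_right)

lemma cinner_diff_left: "cinner (x - y) z = cinner x z - cinner y z"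
  using cinner_add_left[of x "- y" z] by (simp add: cinner_minus_left)

lemmas cinner_algebra =
  cinner_add_left cinner_add_right cinner_diff_left cinner_diff_right
  cinner_scaleC_left cinner_scaleC_right cinner_minus_left cinner_minus_right
  cinner_scaleR_left cinner_scaleR_right

lemma Im_cinner: "Im (cinner x y) = - inner x (\<i> *\<^sub>C y)"
  by (simp flip: Re_cinner add: cinner_scaleC_right)

lemma cinner_self: "cinner x x = complex_of_real ((norm x)\<^sup>2)"
proof (rule complex_eqI)
  show "Re (cinner x x) = Re (complex_of_real ((norm x)\<^sup>2))"
    by (simp only: Re_cinner) (simp add: power2_norm_eq_inner)
  have "Im (cinner x x) = - Im (cinner x x)"
    by (metis cinner_commute cnj.simps(2))
  then show "Im (cinner x x) = Im (complex_of_real ((norm x)\<^sup>2))"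
    by simp
qed

lemma scaleC_zero_right [simp]: "c *\<^sub>C (0::'a::complex_hilbert_space) = 0"
  using scaleC_add_right[of c "0::'a" 0] by simp

lemma scaleC_one [simp]: "1 *\<^sub>C (x::'a::complex_hilbert_space) = x"
  using scaleC_of_real[of 1 x] by simp

lemma scaleC_minus_right: "c *\<^sub>C (- x) = - (c *\<^sub>C (x::'a::complex_hilbert_space))"
  using scaleC_add_right[of c x "- x"] by (simp add: eq_neg_iff_add_eq_0 add.commute)

lemma scaleC_diff_right: "c *\<^sub>C (x - y) = c *\<^sub>C x - c *\<^sub>C (y::'a::complex_hilbert_space)"
  using scaleC_add_right[of c x "- y"] by (simp add: scaleC_minus_right)

lemma scaleC_scaleR: "c *\<^sub>C (r *\<^sub>R x) = r *\<^sub>R (c *\<^sub>C (x::'a::complex_hilbert_space))"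
  by (simp add: scaleC_scaleC mult.commute flip: scaleC_of_real)

lemma norm_scaleC: "norm (c *\<^sub>C x) = cmod c * norm (x::'a::complex_hilbert_space)"
proof -
  have "complex_of_real ((norm (c *\<^sub>C x))\<^sup>2) = (c * cnj c) * cinner x x"
    by (simp only: cinner_scaleC_left cinner_scaleC_right cinner_self[symmetric] mult_ac)
  also have "\<dots> = complex_of_real ((cmod c * norm x)\<^sup>2)"
    by (simp only: cinner_self power_mult_distrib complex_norm_square[symmetric] of_real_mult
        of_real_power)
  finally have "(norm (c *\<^sub>C x))\<^sup>2 = (cmod c * norm x)\<^sup>2"
    by (simp only: of_real_eq_iff)
  then show ?thesis by (simp add: power2_eq_iff_nonneg)
qed

lemma cinner_eqI: "(\<And>z. cinner z x = cinner z y) \<Longrightarrow> x = y"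
  by (metis cinner_diff_right cinner_self eq_iff_diff_eq_0 norm_eq_zero of_real_eq_0_iff
      zero_eq_power2)

lemma cinner_cauchy_schwarz: "cmod (cinner x y) \<le> norm x * norm y"
proof (cases "cinner x y = 0")
  case False
  define c where "c = cnj (sgn (cinner x y))"
  have "cmod (cinner x y) = Re (c * cinner x y)"
  proof -
    define z where "z = cinner x y"
    have "c * z = (z * cnj z) / complex_of_real (cmod z)"
      by (simp add: c_def z_def sgn_div_norm scaleR_conv_of_real divide_inverse mult_ac)
    also have "\<dots> = complex_of_real (cmod z)"
      using False by (simp only: complex_norm_square[symmetric]) (simp add: z_def power2_eq_square)
    finally show ?thesis by (simp add: z_def)
  qed
  also have "\<dots> = inner x (c *\<^sub>C y)"
    by (simp flip: Re_cinner add: cinner_scaleC_right)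
  also have "\<dots> \<le> norm x * norm (c *\<^sub>C y)"
    by (rule norm_cauchy_schwarz)
  also have "\<dots> = norm x * norm y"
    using False by (simp add: norm_scaleC c_def norm_sgn)
  finally show ?thesis .
qed simp

lemma bounded_bilinear_cinner: "bounded_bilinear (cinner :: 'a::complex_hilbert_space \<Rightarrow> 'a \<Rightarrow> complex)"
  by standard
    (auto simp: cinner_algebra scaleR_conv_of_real intro!: exI[of _ 1] cinner_cauchy_schwarz)

lemmas tendsto_cinner [tendsto_intros] = bounded_bilinear.tendsto[OF bounded_bilinear_cinner]

lemma bounded_linear_scaleC: "bounded_linear (\<lambda>x::'a::complex_hilbert_space. c *\<^sub>C x)"
  by (rule bounded_linear_intro[where K = "cmod c"])
    (auto simp: scaleC_add_right scaleC_scaleR norm_scaleC mult.commute)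

lemma tendsto_scaleC [tendsto_intros]:
  "(f \<longlongrightarrow> (x::'a::complex_hilbert_space)) F \<Longrightarrow> ((\<lambda>n. c *\<^sub>C f n) \<longlongrightarrow> c *\<^sub>C x) F"
  by (rule bounded_linear.tendsto[OF bounded_linear_scaleC])

text \<open>The minimiser of |x|^2 - 2 f(x) over \<open>K\<close> represents \<open>f\<close>; the
  parallelogram law makes minimising sequences Cauchy. Working with real scalars on a closed
  subspace covers Riesz representation and orthogonal projection at once.\<close>

lemma riesz_on_subspace:
  fixes f :: "'a::{real_inner, complete_space} \<Rightarrow> real"
  assumes f: "bounded_linear f" and K: "subspace K" "closed K"
  obtains y where "y \<in> K" "\<And>x. x \<in> K \<Longrightarrow> f x = inner y x"
proof -
  interpret f: bounded_linear f by (fact f)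
  obtain B where B: "\<And>x. norm (f x) \<le> norm x * B"
    using f.bounded by blast
  define J where "J x = (norm x)\<^sup>2 - 2 * f x" for x
  have Jlow: "- B\<^sup>2 \<le> J x" for x
  proof -
    have "f x \<le> norm x * B" using B[of x] by simp
    moreover have "0 \<le> (norm x - B)\<^sup>2" by simp
    ultimately show ?thesis by (simp add: J_def power2_diff)
  qed
  define I where "I = Inf (J ` K)"
  have bdd: "bdd_below (J ` K)" by (rule bdd_belowI2) (rule Jlow)
  have K0: "0 \<in> K" using K(1) by (rule subspace_0)
  have I_le: "I \<le> J x" if "x \<in> K" for x
    unfolding I_def using bdd that by (auto intro: cInf_lower)
  have "\<exists>x\<in>K. J x < I + inverse (real (Suc n))" for n
  proof -
    have "Inf (J ` K) < I + inverse (real (Suc n))" by (simp add: I_def)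
    then show ?thesis using bdd K0 by (subst (asm) cInf_less_iff) auto
  qed
  then obtain x where xK: "\<And>n. x n \<in> K" and xJ: "\<And>n. J (x n) < I + inverse (real (Suc n))"
    by metis
  have par: "(norm (a - b))\<^sup>2 = 2 * J a + 2 * J b - 4 * J ((1/2) *\<^sub>R (a + b))" for a b
    unfolding J_def power2_norm_eq_inner
    by (simp add: f.scaleR f.add algebra_simps inner_add_left inner_add_right inner_diff_left
        inner_diff_right inner_commute)
  have dist: "(norm (x m - x n))\<^sup>2 \<le> 2 * inverse (real (Suc m)) + 2 * inverse (real (Suc n))" for m n
    using xJ[of m] xJ[of n] I_le[of "(1/2) *\<^sub>R (x m + x n)"] xK K(1)
    unfolding par[of "x m" "x n"] by (simp add: subspace_add subspace_scale)
  have "Cauchy x"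
  proof (rule CauchyI)
    fix e :: real assume e: "0 < e"
    obtain M where M: "inverse (real (Suc M)) < e\<^sup>2 / 4"
      using reals_Archimedean[of "e\<^sup>2 / 4"] e by auto
    have "norm (x m - x n) < e" if "M \<le> m" "M \<le> n" for m n
    proof -
      have "inverse (real (Suc m)) \<le> inverse (real (Suc M))"
        "inverse (real (Suc n)) \<le> inverse (real (Suc M))"
        using that by (auto intro!: le_imp_inverse_le)
      then have "(norm (x m - x n))\<^sup>2 < e\<^sup>2"
        using dist[of m n] M by linarith
      then show ?thesis using e by (auto intro: power_less_imp_less_base)
    qed
    then show "\<exists>M. \<forall>m\<ge>M. \<forall>n\<ge>M. norm (x m - x n) < e" by blast
  qed
  then obtain y where y: "x \<longlonglongrightarrow> y" using Cauchy_convergent_iff convergent_def by blast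
  have yK: "y \<in> K" using closed_sequentially[OF K(2)] xK y by blast
  have limJ: "(\<lambda>n. J (x n)) \<longlonglongrightarrow> J y"
    unfolding J_def by (intro tendsto_intros y f.tendsto)
  have "(\<lambda>n. I + inverse (real (Suc n))) \<longlonglongrightarrow> I + 0"
    by (intro tendsto_intros LIMSEQ_inverse_real_of_nat)
  from LIMSEQ_le[OF limJ this] have Jy: "J y \<le> I"
    using xJ less_imp_le by auto
  have "f z = inner y z" if "z \<in> K" for z
  proof -
    define d where "d = inner y z - f z"
    have quad: "0 \<le> 2 * t * d + t\<^sup>2 * (norm z)\<^sup>2" for t
    proof -
      have "J y \<le> J (y + t *\<^sub>R z)"
        using Jy I_le[of "y + t *\<^sub>R z"] yK that K(1) by (simp add: subspace_add subspace_scale)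
      then show ?thesis
        unfolding J_def d_def power2_norm_eq_inner
        by (simp add: f.scaleR f.add algebra_simps inner_add_left inner_add_right inner_commute
            power2_eq_square)
    qed
    \<comment> \<open>Nearly the minimum point of the parabola in \<open>t\<close>; the added 1
      covers \<open>z = 0\<close>.\<close>
    define s where "s = d / ((norm z)\<^sup>2 + 1)"
    have pos: "0 < (norm z)\<^sup>2 + 1" by (simp add: add_nonneg_pos)
    have "0 \<le> 2 * (- s) * d + (- s)\<^sup>2 * (norm z)\<^sup>2" by (rule quad)
    also have "\<dots> \<le> 2 * (- s) * d + s\<^sup>2 * ((norm z)\<^sup>2 + 1)" by (simp add: algebra_simps)
    also have "\<dots> = - (d\<^sup>2 / ((norm z)\<^sup>2 + 1))"
      using pos by (simp add: s_def power2_eq_square)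
    finally have "d\<^sup>2 / ((norm z)\<^sup>2 + 1) \<le> 0" by simp
    then have "d = 0" using pos by (simp add: divide_le_0_iff)
    then show ?thesis by (simp add: d_def)
  qed
  with yK show ?thesis by (rule that)
qed

lemma orthogonal_decomposition:
  fixes K :: "'a::{real_inner, complete_space} set"
  assumes "subspace K" "closed K"
  obtains y where "y \<in> K" "\<And>x. x \<in> K \<Longrightarrow> inner (z - y) x = 0"
proof -
  obtain y where "y \<in> K" "\<And>x. x \<in> K \<Longrightarrow> inner z x = inner y x"
    using riesz_on_subspace[OF bounded_linear_inner_right[of z] assms] by blast
  then show ?thesis by (intro that[of y]) (simp_all add: inner_diff_left)
qed

lemma cinner_eq_if_inner_eq:
  fixes x y u v :: "'a::complex_hilbert_space"
  assumes "inner x y = inner u v" "inner x (\<i> *\<^sub>C y) = inner u (\<i> *\<^sub>C v)"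
  shows "cinner x y = cinner u v"
  using assms by (intro complex_eqI) (simp_all add: Re_cinner Im_cinner)

text \<open>The real Riesz vector represents the complex form too: \<open>x\<close> is complex
  linear, so imaginary parts are real parts at \<open>\<i> *\<^sub>C \<eta>\<close>.\<close>

lemma bounded_clinear_adjoint_exists:
  assumes x: "bounded_clinear x"
  obtains y where "bounded_clinear y" "\<And>\<xi> \<eta>. cinner (y \<xi>) \<eta> = cinner \<xi> (x \<eta>)"
proof -
  from x interpret x: bounded_linear x by (simp add: bounded_clinear_def)
  have xC: "x (c *\<^sub>C \<xi>) = c *\<^sub>C x \<xi>" for c \<xi>
    using x by (simp add: bounded_clinear_def)
  have "\<exists>y. \<forall>\<eta>. inner \<xi> (x \<eta>) = inner y \<eta>" for \<xi>
  proof -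
    have "bounded_linear (\<lambda>\<eta>. inner \<xi> (x \<eta>))"
      by (intro bounded_linear_compose[OF bounded_linear_inner_right] x.bounded_linear_axioms)
    then obtain y where "\<And>\<eta>. \<eta> \<in> UNIV \<Longrightarrow> inner \<xi> (x \<eta>) = inner y \<eta>"
      by (rule riesz_on_subspace[OF _ subspace_UNIV closed_UNIV]) auto
    then show ?thesis by auto
  qed
  then obtain y where y: "\<And>\<xi> \<eta>. inner (y \<xi>) \<eta> = inner \<xi> (x \<eta>)" by metis
  have yc: "cinner (y \<xi>) \<eta> = cinner \<xi> (x \<eta>)" for \<xi> \<eta>
    by (rule cinner_eq_if_inner_eq) (simp_all add: y xC flip: xC)
  have yc': "cinner \<eta> (y \<xi>) = cinner (x \<eta>) \<xi>" for \<xi> \<eta>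
    by (metis yc cinner_commute)
  obtain B where B: "\<And>\<xi>. norm (x \<xi>) \<le> norm \<xi> * B" "0 \<le> B"
    using x.nonneg_bounded by blast
  have add: "y (\<xi> + \<eta>) = y \<xi> + y \<eta>" for \<xi> \<eta>
    by (rule cinner_eqI) (simp add: yc' cinner_add_right)
  have scl: "y (c *\<^sub>C \<xi>) = c *\<^sub>C y \<xi>" for \<xi> c
    by (rule cinner_eqI) (simp add: yc' cinner_scaleC_right)
  have bound: "norm (y \<xi>) \<le> norm \<xi> * B" for \<xi>
  proof -
    have "norm (y \<xi>) * norm (y \<xi>) = inner \<xi> (x (y \<xi>))"
      by (simp flip: y add: power2_norm_eq_inner[symmetric] power2_eq_square)
    also have "\<dots> \<le> norm \<xi> * (norm (y \<xi>) * B)"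
      using norm_cauchy_schwarz[of \<xi> "x (y \<xi>)"] B(1)[of "y \<xi>"]
      by (meson mult_left_mono norm_ge_zero order_trans)
    finally show ?thesis
      by (cases "norm (y \<xi>) = 0") (use B(2) in \<open>auto simp: mult.assoc mult.left_commute\<close>)
  qed
  have "bounded_clinear y"
    unfolding bounded_clinear_def
    by (auto simp: scl intro!: bounded_linear_intro[of _ B] add bound)
      (metis scl scaleC_of_real)
  with yc show ?thesis by (rule that[rotated])
qed

lemma
  assumes x: "bounded_clinear x"
  shows bounded_clinear_adj: "bounded_clinear (adj x)"
    and cinner_adj_left: "cinner (adj x \<xi>) \<eta> = cinner \<xi> (x \<eta>)"
proof -
  obtain y where y: "bounded_clinear y" "\<And>\<xi> \<eta>. cinner (y \<xi>) \<eta> = cinner \<xi> (x \<eta>)"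
    using bounded_clinear_adjoint_exists[OF x] by blast
  have "bounded_clinear (adj x) \<and> (\<forall>\<xi> \<eta>. cinner (adj x \<xi>) \<eta> = cinner \<xi> (x \<eta>))"
    unfolding adj_def
  proof (rule theI[of _ y])
    fix z assume z: "bounded_clinear z \<and> (\<forall>\<xi> \<eta>. cinner (z \<xi>) \<eta> = cinner \<xi> (x \<eta>))"
    show "z = y"
    proof
      fix \<xi>
      show "z \<xi> = y \<xi>"
        by (rule cinner_eqI) (metis z y(2) cinner_commute)
    qed
  qed (use y in auto)
  then show "bounded_clinear (adj x)" "cinner (adj x \<xi>) \<eta> = cinner \<xi> (x \<eta>)" by auto
qed

lemma adj_eqI:
  assumes "bounded_clinear x" "\<And>\<xi> \<eta>. cinner (y \<xi>) \<eta> = cinner \<xi> (x \<eta>)"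
  shows "adj x = y"
proof
  fix \<xi>
  show "adj x \<xi> = y \<xi>"
    by (rule cinner_eqI) (metis assms cinner_adj_left cinner_commute)
qed

text \<open>Polarization with \<xi> + \<eta> and i\<xi> + \<eta>. Spectral integrals are specified
  by their quadratic forms, so this is how operator identities about them are obtained.\<close>

lemma quadratic_form_determines:
  fixes x y :: "'a::complex_hilbert_space \<Rightarrow> 'a"
  assumes x: "bounded_clinear x" and y: "bounded_clinear y"
    and q: "\<And>\<xi>. cinner \<xi> (x \<xi>) = cinner \<xi> (y \<xi>)"
  shows "x = y"
proof
  fix \<eta>
  from x interpret x: bounded_linear x by (simp add: bounded_clinear_def)
  from y interpret y: bounded_linear y by (simp add: bounded_clinear_def)
  have C: "x (c *\<^sub>C \<xi>) = c *\<^sub>C x \<xi>" "y (c *\<^sub>C \<xi>) = c *\<^sub>C y \<xi>" for c \<xi>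
    using x y by (simp_all add: bounded_clinear_def)
  show "x \<eta> = y \<eta>"
  proof (rule cinner_eqI)
    fix \<xi>
    have *: "cinner \<xi> (x \<eta>) + cinner \<eta> (x \<xi>) = cinner \<xi> (y \<eta>) + cinner \<eta> (y \<xi>)" for \<xi>
      using q[of "\<xi> + \<eta>"] q[of \<xi>] q[of \<eta>] by (simp add: x.add y.add cinner_algebra add.commute)
    have **: "cinner \<xi> (x \<eta>) - cinner \<eta> (x \<xi>) = cinner \<xi> (y \<eta>) - cinner \<eta> (y \<xi>)"
    proof -
      have "- \<i> * (cinner \<xi> (x \<eta>) - cinner \<eta> (x \<xi>)) = - \<i> * (cinner \<xi> (y \<eta>) - cinner \<eta> (y \<xi>))"
        using *[of "\<i> *\<^sub>C \<xi>"] by (simp add: C cinner_algebra right_diff_distrib)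
      then show ?thesis by (simp only: mult_cancel_left) auto
    qed
    have half: "a = c" if "a + b = c + d" "a - b = c - d" for a b c d :: complex
    proof -
      have "2 * a = (a + b) + (a - b)" by simp
      also have "\<dots> = 2 * c" unfolding that by simp
      finally show ?thesis by simp
    qed
    show "cinner \<xi> (x \<eta>) = cinner \<xi> (y \<eta>)"
      by (rule half[OF *[of \<xi>] **])
  qed
qed

section \<open>The ordered algebra of bounded operators\<close>

lemma bounded_clinear_zero: "bounded_clinear (\<lambda>\<xi>. 0)"
  by (simp add: bounded_clinear_def bounded_linear_zero)

lemma bounded_clinear_id: "bounded_clinear (\<lambda>\<xi>. \<xi>)"
  by (simp add: bounded_clinear_def bounded_linear_ident)

lemma bounded_clinear_add:
  "bounded_clinear x \<Longrightarrow> bounded_clinear y \<Longrightarrow> bounded_clinear (\<lambda>\<xi>. x \<xi> + y \<xi>)"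
  by (simp add: bounded_clinear_def bounded_linear_add scaleC_add_right)

lemma bounded_clinear_diff:
  "bounded_clinear x \<Longrightarrow> bounded_clinear y \<Longrightarrow> bounded_clinear (\<lambda>\<xi>. x \<xi> - y \<xi>)"
  by (simp add: bounded_clinear_def bounded_linear_sub scaleC_diff_right)

lemma bounded_clinear_minus: "bounded_clinear x \<Longrightarrow> bounded_clinear (\<lambda>\<xi>. - x \<xi>)"
  by (simp add: bounded_clinear_def bounded_linear_minus scaleC_minus_right)

lemma bounded_clinear_scaleC:
  assumes "bounded_clinear x" shows "bounded_clinear (\<lambda>\<xi>. c *\<^sub>C x \<xi>)"
proof -
  have "bounded_linear (\<lambda>\<xi>. c *\<^sub>C x \<xi>)"
    using assms by (auto simp: bounded_clinear_def
        intro: bounded_linear_compose[OF bounded_linear_scaleC])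
  with assms show ?thesis by (simp add: bounded_clinear_def scaleC_scaleC mult.commute)
qed

lemma bounded_clinear_scaleR: "bounded_clinear x \<Longrightarrow> bounded_clinear (\<lambda>\<xi>. r *\<^sub>R x \<xi>)"
  using bounded_clinear_scaleC[of x "of_real r"] by (simp add: scaleC_of_real)

lemma bounded_clinear_comp:
  assumes "bounded_clinear x" "bounded_clinear y" shows "bounded_clinear (x \<circ> y)"
  using assms bounded_linear_compose[of x y] by (auto simp: bounded_clinear_def o_def)

text \<open>Bounded operators get a type of their own so that ring and order classes, and with them
  algebraic simplification, apply. The definitions speak of plain functions; the last section
  translates.\<close>

typedef (overloaded) 'a bop = "{x::'a::complex_hilbert_space \<Rightarrow> 'a. bounded_clinear x}"
  morphisms app Bop
  using bounded_clinear_zero by blast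

setup_lifting type_definition_bop

instantiation bop :: (complex_hilbert_space) "{real_algebra, monoid_mult}"
begin

lift_definition zero_bop :: "'a bop" is "\<lambda>\<xi>. 0" by (rule bounded_clinear_zero)
lift_definition one_bop :: "'a bop" is "\<lambda>\<xi>. \<xi>" by (rule bounded_clinear_id)
lift_definition plus_bop :: "'a bop \<Rightarrow> 'a bop \<Rightarrow> 'a bop" is "\<lambda>x y \<xi>. x \<xi> + y \<xi>"
  by (rule bounded_clinear_add)
lift_definition minus_bop :: "'a bop \<Rightarrow> 'a bop \<Rightarrow> 'a bop" is "\<lambda>x y \<xi>. x \<xi> - y \<xi>"
  by (rule bounded_clinear_diff)
lift_definition uminus_bop :: "'a bop \<Rightarrow> 'a bop" is "\<lambda>x \<xi>. - x \<xi>"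
  by (rule bounded_clinear_minus)
lift_definition times_bop :: "'a bop \<Rightarrow> 'a bop \<Rightarrow> 'a bop" is "\<lambda>x y. x \<circ> y"
  by (rule bounded_clinear_comp)
lift_definition scaleR_bop :: "real \<Rightarrow> 'a bop \<Rightarrow> 'a bop" is "\<lambda>r x \<xi>. r *\<^sub>R x \<xi>"
  by (rule bounded_clinear_scaleR)

instance
  by standard
    (transfer, force simp: bounded_clinear_def algebra_simps bounded_linear.linear linear_add
      linear_diff linear_scale o_def)+

end

lemma app_simps [simp]:
  "app 0 \<xi> = 0" "app 1 \<xi> = \<xi>" "app (x + y) \<xi> = app x \<xi> + app y \<xi>"
  "app (x - y) \<xi> = app x \<xi> - app y \<xi>" "app (- x) \<xi> = - app x \<xi>"
  "app (x * y) \<xi> = app x (app y \<xi>)" "app (r *\<^sub>R x) \<xi> = r *\<^sub>R app x \<xi>"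
  by (transfer, simp)+

lemma app_sum: "app (sum f A) \<xi> = (\<Sum>i\<in>A. app (f i) \<xi>)"
  by (induction A rule: infinite_finite_induct) auto

lemma bounded_clinear_app: "bounded_clinear (app x)"
  using app by auto

lemma bounded_linear_app: "bounded_linear (app x)"
  using bounded_clinear_app bounded_clinear_def by blast

lemma app_linear:
  "app x (\<xi> + \<eta>) = app x \<xi> + app x \<eta>" "app x (\<xi> - \<eta>) = app x \<xi> - app x \<eta>"
  "app x (r *\<^sub>R \<xi>) = r *\<^sub>R app x \<xi>" "app x (c *\<^sub>C \<xi>) = c *\<^sub>C app x \<xi>" "app x 0 = 0"
  "app x (- \<xi>) = - app x \<xi>"
  using bounded_clinear_app[of x] bounded_linear.linear[OF bounded_linear_app[of x]]
  by (auto simp: bounded_clinear_def linear_add linear_diff linear_scale linear_0 linear_neg)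

lemmas tendsto_app = bounded_linear.tendsto[OF bounded_linear_app]

lemma bop_eqI: "(\<And>\<xi>. app x \<xi> = app y \<xi>) \<Longrightarrow> x = y"
  by (transfer, auto)

lift_definition star :: "'a::complex_hilbert_space bop \<Rightarrow> 'a bop" is adj
  by (rule bounded_clinear_adj)

lift_definition csc :: "complex \<Rightarrow> 'a::complex_hilbert_space bop \<Rightarrow> 'a bop" is "\<lambda>c x \<xi>. c *\<^sub>C x \<xi>"
  by (rule bounded_clinear_scaleC)

lemma app_csc [simp]: "app (csc c x) \<xi> = c *\<^sub>C app x \<xi>"
  by transfer simp

lemma app_star: "app (star x) = adj (app x)"
  by transfer simp

lemma cinner_star_left: "cinner (app (star x) \<xi>) \<eta> = cinner \<xi> (app x \<eta>)"
  by transfer (rule cinner_adj_left)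

lemma cinner_star_right: "cinner \<xi> (app (star x) \<eta>) = cinner (app x \<xi>) \<eta>"
  by (metis cinner_star_left cinner_commute)

lemma inner_star_right: "inner \<xi> (app (star x) \<eta>) = inner (app x \<xi>) \<eta>"
  by (simp flip: Re_cinner add: cinner_star_right)

lemma star_eqI: "(\<And>\<xi> \<eta>. cinner (app y \<xi>) \<eta> = cinner \<xi> (app x \<eta>)) \<Longrightarrow> star x = y"
  using adj_eqI[OF bounded_clinear_app, of "app y" x] by (intro bop_eqI) (simp add: app_star)

lemma star_simps [simp]:
  "star (star x) = x" "star 0 = 0" "star 1 = 1" "star (x + y) = star x + star y"
  "star (x - y) = star x - star y" "star (- x) = - star x" "star (x * y) = star y * star x"
  "star (r *\<^sub>R x) = r *\<^sub>R star x" "star (csc c x) = csc (cnj c) (star x)"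
  by (rule star_eqI; simp add: cinner_algebra cinner_star_left cinner_star_right)+

lemma csc_simps:
  "csc c (x + y) = csc c x + csc c y" "csc (c + d) x = csc c x + csc d x"
  "csc c x * y = csc c (x * y)" "x * csc c y = csc c (x * y)"
  "csc c (csc d x) = csc (c * d) x" "csc 1 x = x" "csc (of_real r) x = r *\<^sub>R x"
  by (rule bop_eqI; simp add: scaleC_add_right scaleC_add_left scaleC_scaleC app_linear
      scaleC_of_real)+

lemma csc_diff: "csc c (x - y) = csc c x - csc c y"
  by (rule bop_eqI) (simp add: scaleC_diff_right)

lemma csc_minus_left: "csc (- c) x = - csc c x"
  by (rule bop_eqI, rule cinner_eqI) (simp add: cinner_algebra)

instantiation bop :: (complex_hilbert_space) ordered_real_vector
begin

lift_definition less_eq_bop :: "'a bop \<Rightarrow> 'a bop \<Rightarrow> bool" is op_le .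

definition less_bop :: "'a bop \<Rightarrow> 'a bop \<Rightarrow> bool"
  where "less_bop x y \<longleftrightarrow> x \<le> y \<and> \<not> y \<le> x"

lemma bop_le_iff: "x \<le> y \<longleftrightarrow> (\<forall>\<xi>. cinner \<xi> (app (y - x) \<xi>) \<in> \<real>\<^sub>\<ge>\<^sub>0)"
  by transfer (auto simp: op_le_def positive_op_def bounded_clinear_diff)

instance
proof
  fix x y z :: "'a bop" and a b :: real
  show "x < y \<longleftrightarrow> x \<le> y \<and> \<not> y \<le> x" by (rule less_bop_def)
  show "x \<le> x" by (simp add: bop_le_iff)
  show "x \<le> z" if "x \<le> y" "y \<le> z"
  proof -
    have "cinner \<xi> (app (z - x) \<xi>) = cinner \<xi> (app (z - y) \<xi>) + cinner \<xi> (app (y - x) \<xi>)" for \<xi>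
      by (simp add: cinner_algebra)
    with that show ?thesis by (auto simp only: bop_le_iff nonneg_Reals_add_I)
  qed
  show "x = y" if "x \<le> y" "y \<le> x"
  proof -
    have "cinner \<xi> (app x \<xi>) = cinner \<xi> (app y \<xi>)" for \<xi>
    proof -
      have "cinner \<xi> (app y \<xi>) - cinner \<xi> (app x \<xi>) \<in> \<real>\<^sub>\<ge>\<^sub>0"
        "cinner \<xi> (app x \<xi>) - cinner \<xi> (app y \<xi>) \<in> \<real>\<^sub>\<ge>\<^sub>0"
        using that by (simp_all add: bop_le_iff cinner_diff_right)
      then show ?thesis
        by (auto simp: complex_nonneg_Reals_iff complex_eq_iff)
    qed
    then show ?thesis
      by (metis app_inject quadratic_form_determines bounded_clinear_app)
  qed
  show "z + x \<le> z + y" if "x \<le> y" using that by (simp add: bop_le_iff)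
  show "a *\<^sub>R x \<le> a *\<^sub>R y" if "x \<le> y" "0 \<le> a"
  proof -
    have "cinner \<xi> (app (a *\<^sub>R y - a *\<^sub>R x) \<xi>) = of_real a * cinner \<xi> (app (y - x) \<xi>)" for \<xi>
      by (simp add: cinner_algebra algebra_simps)
    with that show ?thesis
      by (auto simp only: bop_le_iff nonneg_Reals_of_real_iff intro!: nonneg_Reals_mult_I)
  qed
  show "a *\<^sub>R x \<le> b *\<^sub>R x" if "a \<le> b" "0 \<le> x"
  proof -
    have "cinner \<xi> (app (b *\<^sub>R x - a *\<^sub>R x) \<xi>) = of_real (b - a) * cinner \<xi> (app (x - 0) \<xi>)" for \<xi>
      by (simp add: cinner_algebra algebra_simps)
    with that show ?thesis
      by (auto simp only: bop_le_iff nonneg_Reals_of_real_iff diff_ge_0_iff_ge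
          intro!: nonneg_Reals_mult_I)
  qed
qed

end

lemma bop_pos_star:
  assumes "0 \<le> (x::'a::complex_hilbert_space bop)" shows "star x = x"
proof -
  have "cinner \<xi> (app (star x) \<xi>) = cinner \<xi> (app x \<xi>)" for \<xi>
  proof -
    have "cinner \<xi> (app x \<xi>) \<in> \<real>\<^sub>\<ge>\<^sub>0" using assms by (simp add: bop_le_iff)
    then have "cnj (cinner \<xi> (app x \<xi>)) = cinner \<xi> (app x \<xi>)"
      by (auto simp: complex_nonneg_Reals_iff complex_eq_iff)
    then show ?thesis by (metis cinner_star_right cinner_commute)
  qed
  then show ?thesis by (metis app_inject quadratic_form_determines bounded_clinear_app)
qed

lemma bop_le_star:
  assumes "(x::'a::complex_hilbert_space bop) \<le> y" shows "star y = y \<longleftrightarrow> star x = x"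
  using bop_pos_star[of "y - x"] assms by auto

lemma cinner_selfadjoint:
  assumes "star x = x" shows "cinner \<xi> (app x \<xi>) = of_real (inner \<xi> (app x \<xi>))"
proof -
  have "cnj (cinner \<xi> (app x \<xi>)) = cinner \<xi> (app x \<xi>)"
    by (metis assms cinner_star_right cinner_commute)
  then show ?thesis by (simp add: complex_eq_iff Re_cinner)
qed

lemma bop_le_inner: "(x::'a::complex_hilbert_space bop) \<le> y \<Longrightarrow> inner \<xi> (app x \<xi>) \<le> inner \<xi> (app y \<xi>)"
  by (auto simp: bop_le_iff complex_nonneg_Reals_iff Re_cinner inner_diff_right)

lemma bop_leI:
  assumes "star x = x" "star y = y" "\<And>\<xi>. inner \<xi> (app x \<xi>) \<le> inner \<xi> (app y \<xi>)"
  shows "(x::'a::complex_hilbert_space bop) \<le> y"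
proof -
  have "cinner \<xi> (app (y - x) \<xi>) = of_real (inner \<xi> (app y \<xi>) - inner \<xi> (app x \<xi>))" for \<xi>
    using assms cinner_selfadjoint[of "y - x" \<xi>] by (simp add: inner_diff_right)
  then show ?thesis using assms(3) by (simp only: bop_le_iff) (simp del: of_real_diff)
qed

lemma bop_posI:
  "star x = x \<Longrightarrow> (\<And>\<xi>. 0 \<le> inner \<xi> (app x \<xi>)) \<Longrightarrow> 0 \<le> (x::'a::complex_hilbert_space bop)"
  by (rule bop_leI) auto

lemma bop_conj_pos:
  assumes "0 \<le> (x::'a::complex_hilbert_space bop)" shows "0 \<le> star y * x * y"
proof (rule bop_posI)
  show "star (star y * x * y) = star y * x * y"
    using bop_pos_star[OF assms] by (simp add: mult.assoc)
  show "0 \<le> inner \<xi> (app (star y * x * y) \<xi>)" for \<xi>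
    using bop_le_inner[OF assms, of "app y \<xi>"] by (simp add: inner_star_right)
qed

lemma bop_one_pos: "0 \<le> (1::'a::complex_hilbert_space bop)"
  by (rule bop_posI) auto

lemma bop_star_mult_pos: "0 \<le> star y * (y::'a::complex_hilbert_space bop)"
  using bop_conj_pos[OF bop_one_pos, of y] by simp

lemma bop_square_pos: "star y = y \<Longrightarrow> 0 \<le> y * (y::'a::complex_hilbert_space bop)"
  using bop_star_mult_pos[of y] by simp

lemma bop_conj_mono: "(x::'a::complex_hilbert_space bop) \<le> z \<Longrightarrow> star y * x * y \<le> star y * z * y"
  using bop_conj_pos[of "z - x" y] by (simp add: algebra_simps)

lemma norm_app_squared: "(norm (app x \<xi>))\<^sup>2 = inner \<xi> (app (star x * x) \<xi>)"
  by (simp add: inner_star_right power2_norm_eq_inner)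

lemma norm_app_le:
  assumes "star x * x \<le> c\<^sup>2 *\<^sub>R 1" "0 \<le> c" shows "norm (app x \<xi>) \<le> c * norm \<xi>"
proof -
  have "(norm (app x \<xi>))\<^sup>2 \<le> (c * norm \<xi>)\<^sup>2"
    using bop_le_inner[OF assms(1), of \<xi>]
    by (simp only: norm_app_squared) (simp add: power2_norm_eq_inner power_mult_distrib)
  then show ?thesis using assms(2) by (simp add: power2_le_iff_abs_le)
qed

lemma star_mult_eq_zero:
  assumes "star z * z = 0" shows "z = 0"
proof (rule bop_eqI)
  show "app z \<xi> = app 0 \<xi>" for \<xi> using norm_app_le[of z 0 \<xi>] assms by simp
qed

lemma star_mult_le_if_norm_app_le:
  assumes "\<And>\<xi>. norm (app x \<xi>) \<le> c * norm \<xi>" shows "star x * x \<le> c\<^sup>2 *\<^sub>R 1"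
proof (rule bop_leI)
  show "inner \<xi> (app (star x * x) \<xi>) \<le> inner \<xi> (app (c\<^sup>2 *\<^sub>R 1) \<xi>)" for \<xi>
  proof -
    have "(norm (app x \<xi>))\<^sup>2 \<le> (c * norm \<xi>)\<^sup>2"
      using assms by (intro power_mono) auto
    then show ?thesis
      by (simp only: norm_app_squared) (simp add: power2_norm_eq_inner power_mult_distrib)
  qed
qed auto

lemma bop_bounded:
  obtains c where "0 < c" "\<And>\<xi>. norm (app x \<xi>) \<le> c * norm \<xi>"
  using bounded_linear.pos_bounded[OF bounded_linear_app[of x]] by (auto simp: mult.commute)

lemma selfadjoint_bounded:
  assumes "star x = (x::'a::complex_hilbert_space bop)"
  obtains c where "0 < c" "- (c *\<^sub>R 1) \<le> x" "x \<le> c *\<^sub>R 1"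
proof -
  obtain c where c: "0 < c" "\<And>\<xi>. norm (app x \<xi>) \<le> c * norm \<xi>" by (rule bop_bounded[of x]) blast
  have "\<bar>inner \<xi> (app x \<xi>)\<bar> \<le> c * inner \<xi> \<xi>" for \<xi>
  proof -
    have "\<bar>inner \<xi> (app x \<xi>)\<bar> \<le> norm \<xi> * norm (app x \<xi>)" by (rule Cauchy_Schwarz_ineq2)
    also have "\<dots> \<le> norm \<xi> * (c * norm \<xi>)" by (intro mult_left_mono c) auto
    finally show ?thesis by (simp add: power2_norm_eq_inner[symmetric] power2_eq_square mult_ac)
  qed
  then have "- (c *\<^sub>R 1) \<le> x" "x \<le> c *\<^sub>R 1"
    by (auto intro!: bop_leI simp: assms abs_le_iff) (metis minus_le_iff)
  with c(1) show ?thesis by (rule that)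
qed

text \<open>The difference x - x^2 equals x(1-x)x + (1-x)x(1-x), a sum of conjugates of positive
  operators.\<close>

lemma bop_square_le_self:
  assumes "0 \<le> x" "x \<le> (1::'a::complex_hilbert_space bop)" shows "x * x \<le> x"
proof -
  have "star x = x" by (rule bop_pos_star[OF assms(1)])
  then have "0 \<le> x * (1 - x) * x + (1 - x) * x * (1 - x)"
    using bop_conj_pos[of "1 - x" x] bop_conj_pos[of x "1 - x"] assms by (simp add: add_nonneg_nonneg)
  then show ?thesis by (simp add: algebra_simps)
qed

lemma norm_app_le_one:
  assumes "0 \<le> x" "x \<le> (1::'a::complex_hilbert_space bop)" shows "norm (app x \<xi>) \<le> norm \<xi>"
  using norm_app_le[of x 1 \<xi>] bop_square_le_self[OF assms] bop_pos_star[OF assms(1)] assms(2)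
  by simp

text \<open>Peeling off squares, with an error of order \<open>1 / n\<close>, replaces square roots of positive operators.\<close>

primrec residual :: "'a::complex_hilbert_space bop \<Rightarrow> nat \<Rightarrow> 'a bop" where
  "residual a 0 = a"
| "residual a (Suc n) = residual a n - residual a n * residual a n"

lemma residual_sum: "a = (\<Sum>k<n. residual a k * residual a k) + residual a n"
  by (induction n) (simp_all add: algebra_simps)

text \<open>The scalar fact behind it: if 0 <= t <= 1/m, then t - t^2 <= 1/(m+1). It is transferred
  to operators by writing the difference as a square plus visibly positive terms.\<close>

lemma residual_bounds:
  assumes "0 \<le> a" "a \<le> 1"
  shows "0 \<le> residual a n \<and> residual a n \<le> (1 / (real n + 1)) *\<^sub>R 1"
proof (induction n)
  case (Suc n)
  define b where "b = residual a n"
  define m where "m = real n + 1"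
  have b: "0 \<le> b" "b \<le> (1/m) *\<^sub>R 1" and m: "m \<ge> 1" using Suc by (auto simp: b_def m_def)
  have "b \<le> 1"
    using b(2) scaleR_right_mono[of "1/m" 1 "1::'a bop"] m bop_one_pos by force
  have sb: "star b = b" by (rule bop_pos_star[OF b(1)])
  have lower: "b * b \<le> b" by (rule bop_square_le_self) fact+
  have "b - b * b \<le> (1/(m+1)) *\<^sub>R 1"
  proof (cases "n = 0")
    case True
    \<comment> \<open>Here 1/m = 1 lies beyond the maximum of t - t^2 at t = 1/2, so the square is
      completed at 1/2 instead of at 1/m.\<close>
    have "0 \<le> (b - (1/2) *\<^sub>R 1) * (b - (1/2) *\<^sub>R 1) + (1/4) *\<^sub>R 1"
      by (intro add_nonneg_nonneg bop_square_pos scaleR_nonneg_nonneg bop_one_pos) (auto simp: sb)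
    also have "\<dots> = (1/2) *\<^sub>R 1 - (b - b * b)"
      by (simp add: algebra_simps flip: scaleR_add_left)
    finally show ?thesis using True by (simp add: m_def)
  next
    case False
    then have m2: "m \<ge> 2" by (simp add: m_def)
    define k where "k = 1/m"
    have "1/(m+1) - k + k * k = 1 / (m * m * (m + 1))"
      using m2 by (simp add: k_def divide_simps)
    moreover define q where "q = 1/(m+1) - k + k * k"
    ultimately have k: "0 \<le> q" "k \<le> 1/2"
      using m2 by (simp_all add: k_def)
    have bk: "b \<le> k *\<^sub>R 1" using b(2) by (simp add: k_def)
    \<comment> \<open>Expansion of t - t^2 at k = 1/m. The linear coefficient 1 - 2k is nonnegative
      because k <= 1/2, and \<open>q\<close> is the slack in 1/m - 1/m^2 <= 1/(m+1).\<close>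
    have "0 \<le> (b - k *\<^sub>R 1) * (b - k *\<^sub>R 1) + (1 - 2 * k) *\<^sub>R (k *\<^sub>R 1 - b) + q *\<^sub>R 1"
      using k bk
      by (intro add_nonneg_nonneg bop_square_pos scaleR_nonneg_nonneg bop_one_pos) (auto simp: sb)
    also have "\<dots> = (1/(m+1)) *\<^sub>R 1 - (b - b * b)"
      by (simp add: q_def algebra_simps scaleR_2[symmetric])
    finally show ?thesis by simp
  qed
  then show ?case using lower by (simp add: b_def m_def algebra_simps)
qed (use assms in simp)

lemma residual_commutes: "a * b = b * a \<Longrightarrow> residual a n * b = b * residual a n"
proof (induction n)
  case (Suc n)
  then have c: "residual a n * b = b * residual a n" by simp
  have "residual a n * residual a n * b = b * (residual a n * residual a n)"
    by (simp add: mult.assoc c) (simp add: mult.assoc[symmetric] c)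
  then show ?case by (simp add: algebra_simps c)
qed simp

text \<open>Writing \<open>a\<close> as squares plus a residual turns the product into a sum of
  terms \<open>r * b * r\<close>, since each \<open>r\<close> commutes with \<open>b\<close>, plus
  an error. As r^2 <= r <= 1/(n+1) for the residual, Cauchy-Schwarz makes the error at most of order
  1/sqrt(n).\<close>

lemma bop_commuting_mult_pos_unit:
  assumes a: "0 \<le> a" "a \<le> (1::'a::complex_hilbert_space bop)" and b: "0 \<le> b" and ab: "a * b = b * a"
  shows "0 \<le> a * b"
proof (rule bop_posI)
  show "star (a * b) = a * b" using bop_pos_star[OF a(1)] bop_pos_star[OF b] ab by simp
  fix \<xi>
  let ?r = "residual a"
  have r: "0 \<le> ?r n" "?r n \<le> (1 / (real n + 1)) *\<^sub>R 1" for n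
    using residual_bounds[OF a] by auto
  have r1: "?r n \<le> 1" for n
    using r(2)[of n] scaleR_right_mono[of "1/(real n + 1)" 1 "1::'a bop"] bop_one_pos
    by (force simp: field_simps)
  have low: "- (norm \<xi> * norm (app b \<xi>) / sqrt (real n + 1)) \<le> inner \<xi> (app (a * b) \<xi>)" for n
  proof -
    have "(norm (app (?r n) \<xi>))\<^sup>2 \<le> inner \<xi> (app (?r n) \<xi>)"
      using bop_le_inner[OF bop_square_le_self[OF r(1) r1], of \<xi> n] bop_pos_star[OF r(1)]
      by (simp only: norm_app_squared)
    also have "\<dots> \<le> (norm \<xi> / sqrt (real n + 1))\<^sup>2"
      using bop_le_inner[OF r(2), of \<xi> n] by (simp add: power_divide power2_norm_eq_inner)
    finally have small: "norm (app (?r n) \<xi>) \<le> norm \<xi> / sqrt (real n + 1)"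
      by (rule power2_le_imp_le) simp
    have "\<bar>inner \<xi> (app (?r n * b) \<xi>)\<bar> = \<bar>inner (app (?r n) \<xi>) (app b \<xi>)\<bar>"
      using inner_star_right[of \<xi> "?r n" "app b \<xi>"] bop_pos_star[OF r(1)] by simp
    also have "\<dots> \<le> norm (app (?r n) \<xi>) * norm (app b \<xi>)" by (rule Cauchy_Schwarz_ineq2)
    also have "\<dots> \<le> norm \<xi> / sqrt (real n + 1) * norm (app b \<xi>)"
      by (intro mult_right_mono small) auto
    finally have 1: "\<bar>inner \<xi> (app (?r n * b) \<xi>)\<bar> \<le> norm \<xi> * norm (app b \<xi>) / sqrt (real n + 1)"
      by simp
    have "0 \<le> (\<Sum>k<n. ?r k * b * ?r k)"
      using bop_conj_pos[OF b] bop_pos_star[OF r(1)] by (intro sum_nonneg) metis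
    also have "\<dots> = (\<Sum>k<n. ?r k * ?r k * b)"
      by (intro sum.cong refl) (metis mult.assoc residual_commutes[OF ab])
    finally have 2: "0 \<le> inner \<xi> (app ((\<Sum>k<n. ?r k * ?r k) * b) \<xi>)"
      using bop_le_inner[of 0 "\<Sum>k<n. ?r k * ?r k * b" \<xi>] by (simp add: sum_distrib_right)
    have "a * b = (\<Sum>k<n. ?r k * ?r k) * b + ?r n * b"
      by (subst residual_sum[of a n]) (simp add: distrib_right)
    then have "inner \<xi> (app (a * b) \<xi>)
        = inner \<xi> (app ((\<Sum>k<n. ?r k * ?r k) * b) \<xi>) + inner \<xi> (app (?r n * b) \<xi>)"
      by (simp only: app_simps inner_add_right)
    with 1 2 show ?thesis by linarith
  qed
  have "(\<lambda>n. - (norm \<xi> * norm (app b \<xi>) / sqrt (real n + 1))) \<longlonglongrightarrow> 0" by real_asymp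
  then show "0 \<le> inner \<xi> (app (a * b) \<xi>)"
    by (rule LIMSEQ_le_const2) (use low in auto)
qed

lemma bop_commuting_mult_pos:
  assumes a: "0 \<le> (a::'a::complex_hilbert_space bop)" and b: "0 \<le> b" and ab: "a * b = b * a"
  shows "0 \<le> a * b"
proof -
  obtain c where c: "0 < c" "a \<le> c *\<^sub>R 1"
    using selfadjoint_bounded[OF bop_pos_star[OF a]] by blast
  have "0 \<le> (inverse c *\<^sub>R a) * b"
  proof (rule bop_commuting_mult_pos_unit)
    show "inverse c *\<^sub>R a \<le> 1"
      using scaleR_left_mono[OF c(2), of "inverse c"] c(1) by simp
  qed (use a b ab c in \<open>auto simp: scaleR_nonneg_nonneg\<close>)
  then have "0 \<le> c *\<^sub>R ((inverse c *\<^sub>R a) * b)" using c(1) by (intro scaleR_nonneg_nonneg) auto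
  then show ?thesis using c(1) by simp
qed

lemma bop_commuting_mult_mono:
  assumes "a \<le> b" "0 \<le> (c::'a::complex_hilbert_space bop)" "a * c = c * a" "b * c = c * b"
  shows "a * c \<le> b * c"
  using bop_commuting_mult_pos[of "b - a" c] assms by (simp add: algebra_simps)

lemma bop_unit_mult:
  assumes "0 \<le> a" "a \<le> 1" "0 \<le> b" "b \<le> (1::'a::complex_hilbert_space bop)" "a * b = b * a"
  shows "0 \<le> a * b" "a * b \<le> b" "a * b \<le> a" "a * b \<le> 1"
proof -
  show "0 \<le> a * b" using assms by (intro bop_commuting_mult_pos)
  show "a * b \<le> b" using bop_commuting_mult_mono[of a 1 b] assms by simp
  then show "a * b \<le> 1" using assms by simp
  show "a * b \<le> a" using bop_commuting_mult_mono[of b 1 a] assms by simp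
qed

lemma bop_unit_power:
  assumes "0 \<le> a" "a \<le> (1::'a::complex_hilbert_space bop)"
  shows "0 \<le> a ^ n \<and> a ^ n \<le> 1"
proof (induction n)
  case (Suc n)
  then show ?case using bop_unit_mult[of a "a ^ n"] assms by (simp add: power_commutes)
qed (simp add: bop_one_pos)

text \<open>The powers of \<open>a\<close> decrease, so n + 1 copies of the last term are at most
  the telescoping sum of all of them, which is 1 - a^(n+1).\<close>

lemma bop_power_decay:
  assumes a: "0 \<le> a" "a \<le> (1::'a::complex_hilbert_space bop)"
  shows "0 \<le> (1 - a) * a ^ n \<and> (1 - a) * a ^ n \<le> (1 / (real n + 1)) *\<^sub>R 1"
proof
  have comm: "(1 - a) * a ^ k = a ^ k * (1 - a)" for k
    by (simp add: algebra_simps power_commutes)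
  have an: "0 \<le> a ^ k" "a ^ k \<le> 1" for k using bop_unit_power[OF a] by auto
  show pos: "0 \<le> (1 - a) * a ^ n"
    using bop_commuting_mult_pos[of "1 - a" "a ^ n"] a an comm by simp
  have tele: "(\<Sum>k<m. (1 - a) * a ^ k) = 1 - a ^ m" for m
    by (induction m) (simp_all add: algebra_simps)
  have dec: "(1 - a) * a ^ n \<le> (1 - a) * a ^ k" if "k \<le> n" for k
  proof -
    have "a ^ n = a ^ k * a ^ (n - k)" using that by (simp flip: power_add)
    moreover have "a ^ k * a ^ (n - k) \<le> a ^ k"
      by (rule bop_unit_mult) (use an in \<open>auto simp flip: power_add simp: add.commute\<close>)
    ultimately have "a ^ n \<le> a ^ k" by simp
    then show ?thesis
      using bop_commuting_mult_mono[of "a ^ n" "a ^ k" "1 - a"] a by (simp add: comm)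
  qed
  have "(real n + 1) *\<^sub>R ((1 - a) * a ^ n) = (\<Sum>k<Suc n. (1 - a) * a ^ n)"
    by (simp add: sum_constant_scaleR scaleR_add_left del: sum_constant)
  also have "\<dots> \<le> (\<Sum>k<Suc n. (1 - a) * a ^ k)" by (intro sum_mono dec) auto
  also have "\<dots> \<le> 1" using an[of "Suc n"] by (simp only: tele) simp
  finally have "(1 / (real n + 1)) *\<^sub>R ((real n + 1) *\<^sub>R ((1 - a) * a ^ n)) \<le> (1 / (real n + 1)) *\<^sub>R 1"
    by (intro scaleR_left_mono) auto
  moreover have "(1 / (real n + 1)) *\<^sub>R ((real n + 1) *\<^sub>R ((1 - a) * a ^ n)) = (1 - a) * a ^ n"
    by (simp add: add_nonneg_eq_0_iff)
  ultimately show "(1 - a) * a ^ n \<le> (1 / (real n + 1)) *\<^sub>R 1" by simp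
qed

section \<open>Strong limits\<close>

text \<open>Strong operator convergence of sequences. It is the only operator limit in the arguments
  on order and density, and weak-operator closed sets turn out to be closed under it.\<close>

definition slim :: "(nat \<Rightarrow> 'a::complex_hilbert_space bop) \<Rightarrow> 'a bop \<Rightarrow> bool"
  where "slim x r \<longleftrightarrow> (\<forall>\<xi>. (\<lambda>n. app (x n) \<xi>) \<longlonglongrightarrow> app r \<xi>)"

lemma slim_const: "slim (\<lambda>n. r) r"
  by (simp add: slim_def)

lemma slim_diff: "slim x r \<Longrightarrow> slim y s \<Longrightarrow> slim (\<lambda>n. x n - y n) (r - s)"
  by (auto simp: slim_def intro: tendsto_intros)

lemma slim_scaleR: "slim x r \<Longrightarrow> slim (\<lambda>n. c *\<^sub>R x n) (c *\<^sub>R r)"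
  by (auto simp: slim_def intro: tendsto_intros)

lemma slim_mult_left: "slim x r \<Longrightarrow> slim (\<lambda>n. y * x n) (y * r)"
  by (auto simp: slim_def intro: tendsto_app)

lemma slim_mult_right: "slim x r \<Longrightarrow> slim (\<lambda>n. x n * y) (r * y)"
  by (auto simp: slim_def)

lemma slim_unique: "slim x r \<Longrightarrow> slim x s \<Longrightarrow> r = s"
  unfolding slim_def using LIMSEQ_unique by (metis bop_eqI)

lemma slim_shift: "slim x r \<Longrightarrow> slim (\<lambda>n. x (n + k)) r"
  unfolding slim_def by (auto intro: LIMSEQ_ignore_initial_segment)

lemma slim_pos:
  assumes "slim x r" "\<And>n. 0 \<le> x n" shows "0 \<le> r"
  unfolding bop_le_iff
proof
  fix \<xi>
  have "(\<lambda>n. cinner \<xi> (app (x n) \<xi>)) \<longlonglongrightarrow> cinner \<xi> (app r \<xi>)"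
    using assms(1) by (auto simp: slim_def intro: tendsto_intros)
  moreover have "cinner \<xi> (app (x n) \<xi>) \<in> \<real>\<^sub>\<ge>\<^sub>0" for n
    using assms(2)[of n] by (simp add: bop_le_iff)
  ultimately show "cinner \<xi> (app (r - 0) \<xi>) \<in> \<real>\<^sub>\<ge>\<^sub>0"
    using closed_sequentially[OF closed_nonneg_Reals_complex,
        of "\<lambda>n. cinner \<xi> (app (x n) \<xi>)" "cinner \<xi> (app r \<xi>)"] by simp
qed

lemma slim_mono: "slim x r \<Longrightarrow> slim y s \<Longrightarrow> (\<And>n. x n \<le> y n) \<Longrightarrow> r \<le> s"
  using slim_pos[OF slim_diff, of y s x r] by simp

lemma slim_exists:
  assumes conv: "\<And>\<xi>. convergent (\<lambda>n. app (x n) \<xi>)"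
    and bound: "\<And>n \<xi>. norm (app (x n) \<xi>) \<le> B * norm \<xi>"
  obtains r where "slim x r"
proof -
  define f where "f \<xi> = lim (\<lambda>n. app (x n) \<xi>)" for \<xi>
  have f: "(\<lambda>n. app (x n) \<xi>) \<longlonglongrightarrow> f \<xi>" for \<xi>
    using conv[of \<xi>] by (simp add: f_def convergent_LIMSEQ_iff)
  have scl: "f (c *\<^sub>C \<xi>) = c *\<^sub>C f \<xi>" for c \<xi>
    by (rule LIMSEQ_unique[OF f]) (simp add: app_linear, intro tendsto_intros f)
  have "bounded_clinear f"
    unfolding bounded_clinear_def
  proof (intro conjI allI scl bounded_linear_intro[where K = B])
    show "f (\<xi> + \<eta>) = f \<xi> + f \<eta>" for \<xi> \<eta>
      by (rule LIMSEQ_unique[OF f]) (simp add: app_linear, intro tendsto_intros f)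
    show "f (r *\<^sub>R \<xi>) = r *\<^sub>R f \<xi>" for r \<xi>
      using scl[of "of_real r" \<xi>] by (simp add: scaleC_of_real)
    show "norm (f \<xi>) \<le> norm \<xi> * B" for \<xi>
      by (rule LIMSEQ_le_const2[OF tendsto_norm[OF f]]) (use bound in \<open>auto simp: mult.commute\<close>)
  qed
  then have "app (Bop f) = f" by (simp add: Bop_inverse)
  with f have "slim x (Bop f)" by (simp add: slim_def)
  then show ?thesis by (rule that)
qed

text \<open>Differences d of terms lie between 0 and 1, where d^2 <= d; hence |d\<xi>|^2 is at most
  a difference of the monotone, convergent numbers <\<xi>, x_n \<xi>>.\<close>

lemma decseq_slim:
  fixes x :: "nat \<Rightarrow> 'a::complex_hilbert_space bop"
  assumes dec: "\<And>n. x (Suc n) \<le> x n" and unit: "\<And>n. 0 \<le> x n" "\<And>n. x n \<le> 1"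
  obtains r where "slim x r" "0 \<le> r" "\<And>n. r \<le> x n"
proof -
  have mono: "x n \<le> x m" if "m \<le> n" for m n
    using lift_Suc_antimono_le[of x, OF dec that] .
  have conv: "convergent (\<lambda>n. app (x n) \<xi>)" for \<xi>
  proof -
    define f where "f n = inner \<xi> (app (x n) \<xi>)" for n
    have "decseq f"
      unfolding f_def decseq_def using bop_le_inner mono by blast
    moreover have "0 \<le> f n" for n using bop_le_inner[OF unit(1)] by (force simp: f_def)
    ultimately obtain l where "f \<longlonglongrightarrow> l" using decseq_convergent[of f 0] by blast
    then have "Cauchy f" by (auto simp: Cauchy_convergent_iff convergent_def)
    have step: "(norm (app (x m) \<xi> - app (x n) \<xi>))\<^sup>2 \<le> \<bar>f m - f n\<bar>" if "m \<le> n" for m n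
    proof -
      have d: "0 \<le> x m - x n" "x m - x n \<le> 1"
        using mono[OF that] unit(1)[of n] unit(2)[of m] by (auto simp: diff_le_eq intro: add_increasing2)
      have "(norm (app (x m - x n) \<xi>))\<^sup>2 \<le> inner \<xi> (app (x m - x n) \<xi>)"
        using bop_le_inner[OF bop_square_le_self[OF d], of \<xi>] bop_pos_star[OF d(1)]
        by (simp only: norm_app_squared)
      then show ?thesis by (simp add: f_def inner_diff_right)
    qed
    have "Cauchy (\<lambda>n. app (x n) \<xi>)"
    proof (rule CauchyI)
      fix e :: real assume e: "0 < e"
      obtain N where N: "\<And>m n. m \<ge> N \<Longrightarrow> n \<ge> N \<Longrightarrow> norm (f m - f n) < e\<^sup>2"
        using CauchyD[OF \<open>Cauchy f\<close>, of "e\<^sup>2"] e by auto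
      have "norm (app (x m) \<xi> - app (x n) \<xi>) < e" if "m \<ge> N" "n \<ge> N" for m n
      proof -
        have "(norm (app (x m) \<xi> - app (x n) \<xi>))\<^sup>2 \<le> \<bar>f m - f n\<bar>"
          using step[of m n] step[of n m] by (cases "m \<le> n") (auto simp: norm_minus_commute)
        also have "\<dots> < e\<^sup>2" using N[OF that] by simp
        finally show ?thesis using e by (auto intro: power_less_imp_less_base)
      qed
      then show "\<exists>N. \<forall>m\<ge>N. \<forall>n\<ge>N. norm (app (x m) \<xi> - app (x n) \<xi>) < e" by blast
    qed
    then show ?thesis by (rule Cauchy_convergent)
  qed
  obtain r where r: "slim x r"
    by (rule slim_exists[of x 1, OF conv]) (simp add: norm_app_le_one unit)
  have "0 \<le> r" by (rule slim_pos[OF r unit(1)])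
  moreover have "r \<le> x n" for n
    by (rule slim_mono[OF slim_shift[OF r, of n] slim_const]) (rule mono, simp)
  ultimately show ?thesis using r that by blast
qed


section \<open>Positive functionals and normal states\<close>

text \<open>The unit \<open>e\<close> may be a proper projection of the ambient space, as it is in a
  corner. Bounds from the order on all operators come with \<open>1\<close> and have to be traded
  for bounds with \<open>e\<close>.\<close>

locale op_algebra =
  fixes M :: "'a::complex_hilbert_space bop set" and e :: "'a bop"
  assumes zero: "0 \<in> M"
    and add: "x \<in> M \<Longrightarrow> y \<in> M \<Longrightarrow> x + y \<in> M"
    and csc: "x \<in> M \<Longrightarrow> csc c x \<in> M"
    and mult: "x \<in> M \<Longrightarrow> y \<in> M \<Longrightarrow> x * y \<in> M"
    and star: "x \<in> M \<Longrightarrow> star x \<in> M"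
    and unit: "e \<in> M"
    and unit_mult: "x \<in> M \<Longrightarrow> e * x = x" "x \<in> M \<Longrightarrow> x * e = x"
begin

lemma scaleR: "x \<in> M \<Longrightarrow> r *\<^sub>R x \<in> M"
  using csc[of x "of_real r"] by (simp add: csc_simps)

lemma minus: "x \<in> M \<Longrightarrow> - x \<in> M"
  using scaleR[of x "-1"] by simp

lemma diff: "x \<in> M \<Longrightarrow> y \<in> M \<Longrightarrow> x - y \<in> M"
  using add[of x "- y"] minus by simp

lemma sum: "(\<And>i. i \<in> I \<Longrightarrow> f i \<in> M) \<Longrightarrow> sum f I \<in> M"
  by (induction I rule: infinite_finite_induct) (auto intro: zero add)

lemmas closed_ops = zero add csc mult star unit scaleR minus diff sum

lemma unit_star: "star e = e"
  by (metis star star_simps(1) star_simps(7) unit unit_mult)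

lemma unit_pos: "0 \<le> e"
  by (metis bop_star_mult_pos unit unit_mult(1) unit_star)

lemma unit_le_one: "e \<le> 1"
proof -
  have "0 \<le> star (1 - e) * (1 - e)" by (rule bop_star_mult_pos)
  then show ?thesis by (simp add: unit_star algebra_simps unit_mult unit)
qed

lemma le_unit: "x \<in> M \<Longrightarrow> x \<le> c *\<^sub>R 1 \<Longrightarrow> x \<le> c *\<^sub>R e"
  using bop_conj_mono[of x "c *\<^sub>R 1" e] by (simp add: unit_star unit_mult unit)

lemma selfadjoint_decomposition:
  assumes "x \<in> M"
  obtains a b where "a \<in> M" "b \<in> M" "star a = a" "star b = b" "x = a + csc \<i> b"
proof (rule that[of "(1/2) *\<^sub>R (x + star x)" "csc (- \<i> / 2) (x - star x)"])
  have "csc \<i> (csc (- \<i> / 2) (x - star x)) = (1/2) *\<^sub>R (x - star x)"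
    by (simp add: csc_simps flip: csc_simps(7))
  then show "x = (1/2) *\<^sub>R (x + star x) + csc \<i> (csc (- \<i> / 2) (x - star x))"
    by (simp add: algebra_simps flip: scaleR_add_left)
  show "star (csc (- \<i> / 2) (x - star x)) = csc (- \<i> / 2) (x - star x)"
    by (simp add: csc_diff csc_minus_left)
qed (use assms in \<open>auto intro: closed_ops simp: add.commute\<close>)

end

text \<open>A shift and a rescaling take the place of the split into positive and negative parts:
  claims about self-adjoint elements reduce to elements between 0 and 1.\<close>

lemma (in op_algebra) selfadjoint_affine:
  assumes "x \<in> M" "star x = x"
  obtains c y where "0 < c" "y \<in> M" "0 \<le> y" "y \<le> 1" "x = (2 * c) *\<^sub>R y - c *\<^sub>R e"
proof -
  obtain c where c: "0 < c" "- (c *\<^sub>R 1) \<le> x" "x \<le> c *\<^sub>R 1"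
    using selfadjoint_bounded[OF assms(2)] by blast
  define y where "y = (1 / (2 * c)) *\<^sub>R (x + c *\<^sub>R e)"
  have "- x \<le> c *\<^sub>R e" using c(2) assms(1) by (intro le_unit minus) (simp_all add: minus_le_iff)
  then have "0 \<le> x + c *\<^sub>R e" using diff_ge_0_iff_ge[of "c *\<^sub>R e" "- x"] by (simp add: add.commute)
  then have "0 \<le> y" using c(1) by (auto simp: y_def intro: scaleR_nonneg_nonneg)
  moreover have "x + c *\<^sub>R e \<le> (2 * c) *\<^sub>R 1"
    using add_mono[OF c(3) scaleR_left_mono[OF unit_le_one, of c]] c(1)
    by (simp flip: scaleR_add_left)
  then have "y \<le> (1 / (2 * c)) *\<^sub>R (2 * c) *\<^sub>R 1"
    unfolding y_def using c(1) by (intro scaleR_left_mono) auto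
  then have "y \<le> 1" using c(1) by simp
  ultimately show ?thesis
    using c(1) by (intro that[of c y]) (auto simp: y_def assms closed_ops)
qed

locale positive_functional = op_algebra M e
  for M :: "'a::complex_hilbert_space bop set" and e +
  fixes \<psi> :: "'a bop \<Rightarrow> complex"
  assumes fadd: "x \<in> M \<Longrightarrow> y \<in> M \<Longrightarrow> \<psi> (x + y) = \<psi> x + \<psi> y"
    and fcsc: "x \<in> M \<Longrightarrow> \<psi> (csc c x) = c * \<psi> x"
    and fpos: "x \<in> M \<Longrightarrow> 0 \<le> x \<Longrightarrow> \<psi> x \<in> \<real>\<^sub>\<ge>\<^sub>0"
begin

lemma fscaleR: "x \<in> M \<Longrightarrow> \<psi> (r *\<^sub>R x) = of_real r * \<psi> x"
  using fcsc[of x "of_real r"] by (simp add: csc_simps)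

lemma fminus: "x \<in> M \<Longrightarrow> \<psi> (- x) = - \<psi> x"
  using fscaleR[of x "-1"] by simp

lemma fdiff: "x \<in> M \<Longrightarrow> y \<in> M \<Longrightarrow> \<psi> (x - y) = \<psi> x - \<psi> y"
  using fadd[of x "- y"] fminus[of y] minus by simp

lemma fzero: "\<psi> 0 = 0"
  using fscaleR[OF zero, of 0] by simp

lemma fsum: "(\<And>i. i \<in> I \<Longrightarrow> f i \<in> M) \<Longrightarrow> \<psi> (sum f I) = (\<Sum>i\<in>I. \<psi> (f i))"
  by (induction I rule: infinite_finite_induct) (auto simp: fzero fadd sum)

lemma fmono: "x \<in> M \<Longrightarrow> y \<in> M \<Longrightarrow> x \<le> y \<Longrightarrow> Re (\<psi> x) \<le> Re (\<psi> y)"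
  using fpos[of "y - x"] fdiff[of y x] diff[of y x] by (auto simp: complex_nonneg_Reals_iff)

lemma fpos_Re: "x \<in> M \<Longrightarrow> 0 \<le> x \<Longrightarrow> 0 \<le> Re (\<psi> x)"
  using fpos by (auto simp: complex_nonneg_Reals_iff)

lemma fselfadjoint:
  assumes "x \<in> M" "star x = x" shows "Im (\<psi> x) = 0"
proof -
  obtain c where c: "- (c *\<^sub>R 1) \<le> x" using selfadjoint_bounded[OF assms(2)] by blast
  have "- x \<le> c *\<^sub>R e" using c by (intro le_unit minus assms(1)) (simp add: minus_le_iff)
  then have "\<psi> (c *\<^sub>R e + x) \<in> \<real>\<^sub>\<ge>\<^sub>0"
    using diff_ge_0_iff_ge[of "c *\<^sub>R e" "- x"]
    by (intro fpos add scaleR unit assms(1)) simp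
  moreover have "Im (\<psi> (c *\<^sub>R e)) = 0"
    using fpos[OF unit unit_pos] by (simp add: fscaleR unit complex_nonneg_Reals_iff)
  ultimately show ?thesis
    using fadd[OF scaleR[OF unit] assms(1), of c] by (simp add: complex_nonneg_Reals_iff)
qed

lemma fstar:
  assumes "x \<in> M" shows "\<psi> (star x) = cnj (\<psi> x)"
proof -
  obtain a b where ab: "a \<in> M" "b \<in> M" "star a = a" "star b = b" and x: "x = a + csc \<i> b"
    using selfadjoint_decomposition[OF assms] by blast
  have "star x = a + csc (- \<i>) b" by (simp add: x ab)
  then have "\<psi> (star x) = \<psi> a - \<i> * \<psi> b" using ab by (simp add: fadd fcsc csc)
  moreover have "\<psi> x = \<psi> a + \<i> * \<psi> b" using ab by (simp add: x fadd fcsc csc)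
  moreover have "Im (\<psi> a) = 0" "Im (\<psi> b) = 0" using ab fselfadjoint by auto
  ultimately show ?thesis by (simp add: complex_eq_iff)
qed

lemma fcauchy_schwarz:
  assumes x: "x \<in> M" and y: "y \<in> M"
  shows "(cmod (\<psi> (star y * x)))\<^sup>2 \<le> Re (\<psi> (star y * y)) * Re (\<psi> (star x * x))"
proof -
  define z where "z = \<psi> (star y * x)"
  define A where "A = Re (\<psi> (star x * x))"
  define B where "B = Re (\<psi> (star y * y))"
  have B0: "0 \<le> B" unfolding B_def using y by (intro fpos_Re mult star bop_star_mult_pos)
  have xy: "\<psi> (star x * y) = cnj z"
    using fstar[of "star y * x"] x y by (simp add: z_def closed_ops)
  have yy: "\<psi> (star y * y) = of_real B"
    using fselfadjoint[of "star y * y"] y by (simp add: closed_ops B_def complex_eq_iff)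
  have quad: "0 \<le> A - 2 * Re (l * cnj z) + (cmod l)\<^sup>2 * B" for l
  proof -
    have "0 \<le> Re (\<psi> (star (x - csc l y) * (x - csc l y)))"
      using x y by (intro fpos_Re closed_ops bop_star_mult_pos)
    also have "star (x - csc l y) * (x - csc l y)
        = star x * x - csc l (star x * y) - csc (cnj l) (star y * x) + csc (l * cnj l) (star y * y)"
      by (simp add: algebra_simps csc_simps csc_diff)
    also have "\<psi> \<dots> = \<psi> (star x * x) - l * cnj z - cnj l * z + l * cnj l * of_real B"
      using x y by (simp add: fadd fdiff fcsc closed_ops xy yy z_def)
    also have "Re \<dots> = A - 2 * Re (l * cnj z) + (cmod l)\<^sup>2 * B"
      unfolding cmod_power2 by (simp add: A_def power2_eq_square algebra_simps)
    finally show ?thesis .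
  qed
  have "(cmod z)\<^sup>2 \<le> B * A"
  proof (cases "B = 0")
    case True
    have "z = 0"
    proof (rule ccontr)
      assume "z \<noteq> 0"
      then have p: "(cmod z)\<^sup>2 > 0" by simp
      \<comment> \<open>With \<open>B = 0\<close> the expression is affine in \<open>l\<close>, and
        this \<open>t\<close> brings it down to \<open>A - 2 * (A + 1)\<close>, which is
        negative.\<close>
      define t where "t = (A + 1) / (cmod z)\<^sup>2"
      have "Re (of_real t * z * cnj z) = t * (cmod z)\<^sup>2"
        by (simp add: mult.assoc complex_norm_square[symmetric] flip: of_real_power)
      then have "0 \<le> A - 2 * (t * (cmod z)\<^sup>2)"
        using quad[of "of_real t * z"] True by simp
      then have "0 \<le> A - 2 * (A + 1)" using p by (simp add: t_def)
      moreover have "0 \<le> A" unfolding A_def using x by (intro fpos_Re mult star bop_star_mult_pos)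
      ultimately show False by simp
    qed
    then show ?thesis using True by simp
  next
    case False
    then have B: "B > 0" using B0 by simp
    have 1: "Re (of_real (1/B) * z * cnj z) = (cmod z)\<^sup>2 / B"
      by (simp add: mult.assoc complex_norm_square[symmetric] flip: of_real_power)
    have 2: "(cmod (of_real (1/B) * z))\<^sup>2 * B = (cmod z)\<^sup>2 / B"
      using B by (simp add: norm_mult norm_divide power_mult_distrib power2_eq_square)
    show ?thesis using quad[of "of_real (1/B) * z"] B unfolding 1 2 by (simp add: field_simps)
  qed
  then show ?thesis by (simp add: z_def A_def B_def)
qed

lemma fcauchy_schwarz_Re:
  assumes "x \<in> M" "y \<in> M"
  shows "\<bar>Re (\<psi> (star y * x))\<bar> \<le> sqrt (Re (\<psi> (star y * y))) * sqrt (Re (\<psi> (star x * x)))"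
  using real_sqrt_le_mono[OF fcauchy_schwarz[OF assms]] abs_Re_le_cmod[of "\<psi> (star y * x)"]
  by (simp add: real_sqrt_mult)

end

definition is_lub_in :: "'a::complex_hilbert_space bop set \<Rightarrow> 'a bop set \<Rightarrow> 'a bop \<Rightarrow> bool"
  where "is_lub_in M D x \<longleftrightarrow> x \<in> M \<and> star x = x \<and> (\<forall>d\<in>D. d \<le> x) \<and>
    (\<forall>y\<in>M. star y = y \<longrightarrow> (\<forall>d\<in>D. d \<le> y) \<longrightarrow> x \<le> y)"

definition upward_directed :: "'a::order set \<Rightarrow> bool"
  where "upward_directed D \<longleftrightarrow> D \<noteq> {} \<and> (\<forall>x\<in>D. \<forall>y\<in>D. \<exists>z\<in>D. x \<le> z \<and> y \<le> z)"

locale op_state = positive_functional M e \<psi>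
  for M :: "'a::complex_hilbert_space bop set" and e and \<psi> +
  assumes funit: "\<psi> e = 1"
begin

lemma fle_const: "x \<in> M \<Longrightarrow> x \<le> c *\<^sub>R 1 \<Longrightarrow> Re (\<psi> x) \<le> c"
  using fmono[OF _ scaleR[OF unit], of x c] le_unit[of x c] by (simp add: fscaleR unit funit)

end

locale normal_op_state = op_state M e \<psi>
  for M :: "'a::complex_hilbert_space bop set" and e and \<psi> +
  assumes normal: "D \<subseteq> {x\<in>M. star x = x} \<Longrightarrow> upward_directed D \<Longrightarrow> is_lub_in M D x \<Longrightarrow>
    Re (\<psi> x) = (SUP d\<in>D. Re (\<psi> d))"
begin

text \<open>Normality speaks of suprema of directed sets. The negatives of a decreasing sequence
  form such a set, and the negative of the strong limit is its least upper bound in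
  \<open>M\<close>.\<close>

lemma normal_decseq:
  assumes x: "\<And>n. x n \<in> M" "\<And>n. star (x n) = x n" "\<And>n. x (Suc n) \<le> x n"
    and r: "slim x r" "r \<in> M"
  shows "(\<lambda>n. Re (\<psi> (x n))) \<longlonglongrightarrow> Re (\<psi> r)"
proof -
  define D where "D = range (\<lambda>n. - x n)"
  have mono: "x n \<le> x m" if "m \<le> n" for m n
    using lift_Suc_antimono_le[of x, OF x(3) that] .
  have rx: "r \<le> x n" for n
    by (rule slim_mono[OF slim_shift[OF r(1), of n] slim_const]) (rule mono, simp)
  have "star r = r" using bop_le_star[OF rx] x(2) by blast
  have "is_lub_in M D (- r)"
    unfolding is_lub_in_def
  proof (intro conjI ballI impI)
    fix y assume "\<forall>d\<in>D. d \<le> y"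
    then have "- y \<le> x n" for n by (auto simp: D_def minus_le_iff)
    then have "- y \<le> r" by (rule slim_mono[OF slim_const r(1)])
    then show "- r \<le> y" by (simp add: minus_le_iff)
  qed (use rx r \<open>star r = r\<close> in \<open>auto simp: D_def minus\<close>)
  moreover have "upward_directed D"
    unfolding upward_directed_def D_def
  proof (intro conjI ballI)
    fix a b assume "a \<in> range (\<lambda>n. - x n)" "b \<in> range (\<lambda>n. - x n)"
    then obtain m n where "a = - x m" "b = - x n" by auto
    then show "\<exists>z\<in>range (\<lambda>n. - x n). a \<le> z \<and> b \<le> z"
      using mono[of m "max m n"] mono[of n "max m n"] by (intro bexI[of _ "- x (max m n)"]) auto
  qed auto
  moreover have "D \<subseteq> {x\<in>M. star x = x}" using x by (auto simp: D_def minus)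
  ultimately have sup: "Re (\<psi> (- r)) = (SUP d\<in>D. Re (\<psi> d))" by (intro normal)
  have "(\<lambda>n. Re (\<psi> (- x n))) \<longlonglongrightarrow> (SUP n. Re (\<psi> (- x n)))"
  proof (rule LIMSEQ_incseq_SUP)
    show "bdd_above (range (\<lambda>n. Re (\<psi> (- x n))))"
      by (rule bdd_aboveI2[of _ _ "Re (\<psi> (- r))"]) (intro fmono minus x r, simp add: rx)
    show "incseq (\<lambda>n. Re (\<psi> (- x n)))"
      unfolding incseq_def using mono by (auto intro!: fmono minus x)
  qed
  also have "(SUP n. Re (\<psi> (- x n))) = Re (\<psi> (- r))"
    by (simp add: sup D_def image_image)
  finally have "(\<lambda>n. - Re (\<psi> (- x n))) \<longlonglongrightarrow> - Re (\<psi> (- r))" by (rule tendsto_minus)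
  then show ?thesis by (simp add: fminus x r)
qed

end

section \<open>A Radon--Nikodym theorem for a central abelian subalgebra\<close>

text \<open>Centrality is all that the arguments on densities see of the modular group, and closure
  under strong sequential limits is all they see of the weak operator topology.\<close>

locale central_subalgebra = normal_op_state M e \<psi> + N: op_algebra N e
  for M :: "'a::complex_hilbert_space bop set" and e \<psi> and N +
  assumes subset: "N \<subseteq> M"
    and comm: "a \<in> N \<Longrightarrow> b \<in> N \<Longrightarrow> a * b = b * a"
    and closed: "(\<And>n. X n \<in> N) \<Longrightarrow> slim X r \<Longrightarrow> r \<in> N"
    and faithful: "x \<in> M \<Longrightarrow> 0 \<le> x \<Longrightarrow> \<psi> x = 0 \<Longrightarrow> x = 0"
    and central: "a \<in> N \<Longrightarrow> x \<in> M \<Longrightarrow> \<psi> (a * x) = \<psi> (x * a)"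
begin

abbreviation (input) f where "f x \<equiv> Re (\<psi> x)"

lemma NM: "a \<in> N \<Longrightarrow> a \<in> M"
  using subset by blast

lemma f_zero: "x \<in> M \<Longrightarrow> 0 \<le> x \<Longrightarrow> f x \<le> 0 \<Longrightarrow> x = 0"
  using faithful[of x] fpos[of x] by (auto simp: complex_nonneg_Reals_iff complex_eq_iff)

lemma residual_in: "a \<in> N \<Longrightarrow> residual a n \<in> N"
  by (induction n) (auto intro: N.closed_ops)

text \<open>The factors need not commute, so \<open>x * a\<close> need not be positive. For each
  square r^2 peeled off \<open>a\<close>, centrality replaces \<psi>(x r^2) by \<psi>(r x r), and
  Cauchy-Schwarz controls the residual.\<close>

lemma f_mult_pos:
  assumes x: "x \<in> M" "0 \<le> x" and a: "a \<in> N" "0 \<le> a" shows "0 \<le> f (x * a)"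
proof -
  have unit: "0 \<le> f (x * a)" if a: "a \<in> N" "0 \<le> a" "a \<le> 1" for a
  proof -
    let ?r = "residual a"
    have rN: "?r n \<in> N" for n by (rule residual_in[OF a(1)])
    have r: "0 \<le> ?r n" "?r n \<le> (1 / (real n + 1)) *\<^sub>R 1" for n
      using residual_bounds[OF a(2,3)] by auto
    have r1: "?r n \<le> 1" for n
      using r(2)[of n] scaleR_right_mono[of "1/(real n + 1)" 1 "1::'a bop"] bop_one_pos
      by (force simp: field_simps)
    have low: "- (sqrt (f (x * x)) * sqrt (1 / (real n + 1))) \<le> f (x * a)" for n
    proof -
      have "f (?r n * ?r n) \<le> 1 / (real n + 1)"
        using order_trans[OF bop_square_le_self[OF r(1) r1] r(2)] rN NM
        by (intro fle_const mult) auto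
      then have "sqrt (f (x * x)) * sqrt (f (?r n * ?r n)) \<le> sqrt (f (x * x)) * sqrt (1 / (real n + 1))"
        using x bop_square_pos[OF bop_pos_star[OF x(2)]]
        by (intro mult_left_mono real_sqrt_le_mono real_sqrt_ge_zero fpos_Re mult) auto
      then have 1: "\<bar>f (x * ?r n)\<bar> \<le> sqrt (f (x * x)) * sqrt (1 / (real n + 1))"
        using fcauchy_schwarz_Re[of "?r n" x] x bop_pos_star[OF x(2)] bop_pos_star[OF r(1)] rN NM
        by fastforce
      have sq: "0 \<le> f (x * (?r k * ?r k))" for k
      proof -
        have "\<psi> (x * (?r k * ?r k)) = \<psi> (?r k * x * ?r k)"
          using central[OF rN[of k], of "x * ?r k"] x(1) NM[OF rN] by (simp add: mult.assoc mult)
        then show ?thesis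
          using fpos_Re[of "?r k * x * ?r k"] bop_conj_pos[OF x(2), of "?r k"]
            bop_pos_star[OF r(1)] x(1) NM[OF rN] by (simp add: mult)
      qed
      have "x * a = (\<Sum>k<n. x * (?r k * ?r k)) + x * ?r n"
        by (subst residual_sum[of a n]) (simp add: distrib_left sum_distrib_left)
      then have "f (x * a) = (\<Sum>k<n. f (x * (?r k * ?r k))) + f (x * ?r n)"
        using x(1) NM[OF rN] by (simp add: fadd fsum sum mult)
      with sum_nonneg[of "{..<n}" "\<lambda>k. f (x * (?r k * ?r k))"] sq 1 show ?thesis by fastforce
    qed
    have "(\<lambda>n. - (sqrt (f (x * x)) * sqrt (1 / (real n + 1)))) \<longlonglongrightarrow> 0" by real_asymp
    then show ?thesis by (rule LIMSEQ_le_const2) (use low in auto)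
  qed
  obtain c where c: "0 < c" "a \<le> c *\<^sub>R 1"
    using selfadjoint_bounded[OF bop_pos_star[OF a(2)]] by blast
  have "0 \<le> f (x * (inverse c *\<^sub>R a))"
  proof (rule unit)
    show "inverse c *\<^sub>R a \<le> 1"
      using scaleR_left_mono[OF c(2), of "inverse c"] c(1) by simp
  qed (use a c in \<open>auto simp: scaleR_nonneg_nonneg N.scaleR\<close>)
  moreover have "\<psi> (x * (inverse c *\<^sub>R a)) = of_real (inverse c) * \<psi> (x * a)"
    using x a NM by (simp add: fscaleR mult)
  ultimately show ?thesis using c(1) by (simp add: zero_le_mult_iff zero_le_divide_iff)
qed

section \<open>The unit interval of the abelian subalgebra\<close>

definition C where "C = {h \<in> N. 0 \<le> h \<and> h \<le> 1}"

lemma CD: "h \<in> C \<Longrightarrow> h \<in> N" "h \<in> C \<Longrightarrow> 0 \<le> h" "h \<in> C \<Longrightarrow> h \<le> 1" "h \<in> C \<Longrightarrow> h \<in> M"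
    "h \<in> C \<Longrightarrow> star h = h"
  using NM bop_pos_star by (auto simp: C_def)

lemma C_zero: "0 \<in> C"
  by (simp add: C_def N.zero bop_one_pos)

lemma C_unit: "e \<in> C"
  by (simp add: C_def N.unit unit_pos unit_le_one)

lemma C_mult: "g \<in> C \<Longrightarrow> h \<in> C \<Longrightarrow> g * h \<in> C"
  using bop_unit_mult[of g h] comm by (auto simp: C_def N.mult)

lemma C_mult_complement: "g \<in> C \<Longrightarrow> h \<in> C \<Longrightarrow> g - g * h \<in> C"
  using bop_unit_mult[of g "1 - h"] comm[of g h] by (auto simp: C_def N.closed_ops algebra_simps)

lemma C_mult_powers:
  assumes "g \<in> C" "h \<in> C" shows "g * h ^ n \<in> C" "g * (1 - h) ^ n \<in> C"
proof -
  show "g * h ^ n \<in> C"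
  proof (induction n)
    case (Suc n)
    then show ?case using C_mult[OF Suc assms(2)] by (simp add: mult.assoc power_commutes)
  qed (use assms in simp)
  show "g * (1 - h) ^ n \<in> C"
  proof (induction n)
    case (Suc n)
    have "g * (1 - h) ^ Suc n = g * (1 - h) ^ n * (1 - h)"
      by (simp add: mult.assoc power_commutes)
    then show ?case using C_mult_complement[OF Suc assms(2)] by (simp add: right_diff_distrib)
  qed (use assms in simp)
qed

lemma C_diff_square: "g \<in> C \<Longrightarrow> h \<in> C \<Longrightarrow> (g - h) * (g - h) \<in> C"
proof -
  assume gh: "g \<in> C" "h \<in> C"
  have "0 \<le> (1 - g) + h" "0 \<le> (1 - h) + g"
    using CD[OF gh(1)] CD[OF gh(2)] by (auto intro!: add_nonneg_nonneg)
  then have "0 \<le> (1 - (g - h)) * (1 + (g - h))"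
    by (intro bop_commuting_mult_pos) (simp_all add: algebra_simps)
  moreover have "(1 - (g - h)) * (1 + (g - h)) = 1 - (g - h) * (g - h)"
    by (simp add: algebra_simps)
  moreover have "0 \<le> (g - h) * (g - h)"
    by (rule bop_square_pos) (simp add: CD(5)[OF gh(1)] CD(5)[OF gh(2)])
  moreover have "(g - h) * (g - h) \<in> N"
    using CD(1)[OF gh(1)] CD(1)[OF gh(2)] by (intro N.closed_ops)
  ultimately show ?thesis by (simp add: C_def)
qed

text \<open>The union of fuzzy sets, chosen because complements multiply.\<close>

definition join where "join g h = g + h - g * h" for g h :: "'a bop"

lemma join_complement: "1 - join g h = (1 - g) * (1 - h)"
  by (simp add: join_def algebra_simps)

lemma join_in_C:
  assumes "g \<in> C" "h \<in> C"
  shows "join g h \<in> C" "g \<le> join g h" "h \<le> join g h" "f (join g h) \<le> f g + f h"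
proof -
  have gh: "0 \<le> g - g * h" "0 \<le> h - g * h" "0 \<le> g * h"
    using C_mult_complement[OF assms] C_mult_complement[OF assms(2,1)] comm[of g h]
      C_mult[OF assms] assms by (auto simp: C_def)
  show "g \<le> join g h" "h \<le> join g h"
    using gh by (auto simp: join_def algebra_simps)
  have "0 \<le> join g h" using CD(2)[OF assms(1)] \<open>g \<le> join g h\<close> by (rule order_trans)
  moreover have "0 \<le> (1 - g) * (1 - h)"
    using CD[OF assms(1)] CD[OF assms(2)] comm[of g h]
    by (intro bop_commuting_mult_pos) (simp_all add: algebra_simps)
  then have "join g h \<le> 1" by (simp flip: join_complement)
  ultimately show "join g h \<in> C"
    using assms by (auto simp: C_def join_def intro: N.closed_ops)
  show "f (join g h) \<le> f g + f h"
    using fpos_Re[of "g * h"] gh(3) CD(4)[OF assms(1)] CD(4)[OF assms(2)]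
    by (simp add: join_def fadd fdiff closed_ops)
qed

lemma join_mono_left:
  assumes "g \<in> C" "h \<in> C" "k \<in> C" "g \<le> h" shows "join g k \<le> join h k"
proof -
  have "0 \<le> (h - g) * (1 - k)"
    using assms CD(3)[OF assms(3)] comm[OF CD(1)[OF assms(1)] CD(1)[OF assms(3)]]
      comm[OF CD(1)[OF assms(2)] CD(1)[OF assms(3)]]
    by (intro bop_commuting_mult_pos) (simp_all add: algebra_simps)
  then show ?thesis by (simp add: join_def algebra_simps)
qed

text \<open>Repeated union with itself pushes \<open>g\<close> towards the indicator of its support,
  at the cost of a factor \<open>n\<close> in \<psi>.\<close>

primrec join_power where
  "join_power g 0 = 0"
| "join_power g (Suc n) = join g (join_power g n)"

lemma join_power_complement: "1 - join_power g n = (1 - g) ^ n"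
  by (induction n) (simp_all add: join_complement)

lemma join_power_in_C:
  "g \<in> C \<Longrightarrow> join_power g n \<in> C \<and> f (join_power g n) \<le> real n * f g"
proof (induction n)
  case (Suc n)
  then show ?case using join_in_C[of g "join_power g n"] by (auto simp: algebra_simps)
qed (simp add: C_zero fzero)

text \<open>Letting \<open>n\<close> grow gives the union of all \<open>E k\<close> with
  \<open>k \<ge> m\<close>; the start index is kept so that these tails can be compared for
  different \<open>m\<close>.\<close>

primrec join_seq where
  "join_seq E m 0 = 0"
| "join_seq E m (Suc n) = join (join_seq E m n) (E (m + n))"

lemma join_seq_in_C: "(\<And>k. E k \<in> C) \<Longrightarrow> join_seq E m n \<in> C"
  by (induction n) (auto intro: C_zero join_in_C)

lemma join_seq_incr: "(\<And>k. E k \<in> C) \<Longrightarrow> join_seq E m n \<le> join_seq E m (Suc n)"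
  using join_in_C(2)[OF join_seq_in_C] by simp

lemma join_seq_ge: "(\<And>k. E k \<in> C) \<Longrightarrow> E (m + n) \<le> join_seq E m (Suc n)"
  using join_in_C(3)[OF join_seq_in_C] by simp

lemma join_seq_shift: "(\<And>k. E k \<in> C) \<Longrightarrow> join_seq E (Suc m) n \<le> join_seq E m (Suc n)"
proof (induction n)
  case 0
  then show ?case using CD(2)[OF join_seq_in_C[of E m 1]] by simp
next
  case (Suc n)
  then show ?case
    using join_mono_left[of "join_seq E (Suc m) n" "join_seq E m (Suc n)" "E (Suc (m + n))"]
      join_seq_in_C[of E "Suc m" n] join_seq_in_C[of E m "Suc n"]
    by simp
qed

lemma C_slim: "(\<And>n. x n \<in> C) \<Longrightarrow> slim x r \<Longrightarrow> r \<in> C"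
  using slim_mono[OF slim_const, of x r 0] slim_mono[OF _ slim_const, of x r 1] closed[of x r]
  by (auto simp: C_def)

text \<open>Countable subadditivity with a geometric series. Its tail is 4/3 times the first term,
  rounded up to 2.\<close>

lemma join_seq_limit:
  assumes E: "\<And>k. E k \<in> C" and c: "\<And>k. f (E k) \<le> c * (1/4) ^ k"
  obtains g where "slim (join_seq E m) g" "g \<in> C" "f g \<le> 2 * c * (1/4) ^ m"
    "\<And>k. m \<le> k \<Longrightarrow> E k \<le> g"
proof -
  have c0: "0 \<le> c" using c[of 0] fpos_Re[OF CD(4)[OF E] CD(2)[OF E], of 0] by simp
  have bound: "f (join_seq E m n) \<le> 2 * c * ((1/4) ^ m - (1/4) ^ (m + n))" for n
  proof (induction n)
    case (Suc n)
    have "f (join_seq E m (Suc n)) \<le> 2 * c * ((1/4) ^ m - (1/4) ^ (m + n)) + c * (1/4) ^ (m + n)"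
      using join_in_C(4)[OF join_seq_in_C[of E m n, OF E] E[of "m + n"]] Suc c[of "m + n"] by simp
    also have "\<dots> \<le> 2 * c * ((1/4) ^ m - (1/4) ^ (m + Suc n))"
      using c0 by (simp add: algebra_simps)
    finally show ?case .
  qed (simp add: fzero)
  have J: "join_seq E m n \<in> C" for n by (rule join_seq_in_C) (rule E)
  have Jinc: "join_seq E m n \<le> join_seq E m (Suc n)" for n by (rule join_seq_incr) (rule E)
  obtain r where r: "slim (\<lambda>n. 1 - join_seq E m n) r" "\<And>n. r \<le> 1 - join_seq E m n"
    by (rule decseq_slim[of "\<lambda>n. 1 - join_seq E m n"])
      (auto simp del: join_seq.simps intro: Jinc CD(2)[OF J] CD(3)[OF J])
  define g where "g = 1 - r"
  have g: "slim (join_seq E m) g"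
    using slim_diff[OF slim_const r(1), of 1] by (simp add: g_def)
  have gC: "g \<in> C" by (rule C_slim[OF J g])
  have ge: "join_seq E m n \<le> g" for n using r(2)[of n] by (simp add: g_def algebra_simps)
  have "(\<lambda>n. f (- join_seq E m n)) \<longlonglongrightarrow> f (- g)"
  proof (rule normal_decseq)
    show "slim (\<lambda>n. - join_seq E m n) (- g)"
      using slim_diff[OF slim_const g, of 0] by simp
    show "- join_seq E m (Suc n) \<le> - join_seq E m n" for n
      using Jinc[of n] by (simp del: join_seq.simps)
  qed (simp_all add: minus CD(4)[OF J] CD(5)[OF J] CD(4)[OF gC])
  then have "(\<lambda>n. - f (join_seq E m n)) \<longlonglongrightarrow> - f g"
    by (simp add: fminus CD(4)[OF J] CD(4)[OF gC])
  then have "(\<lambda>n. f (join_seq E m n)) \<longlonglongrightarrow> f g" by (simp add: tendsto_minus_cancel_left)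
  moreover have "f (join_seq E m n) \<le> 2 * c * (1/4) ^ m" for n
    using bound[of n] c0 by (smt (verit) mult_left_mono zero_le_power divide_nonneg_nonneg)
  ultimately have "f g \<le> 2 * c * (1/4) ^ m"
    by (intro LIMSEQ_le_const2[of _ "f g"]) auto
  moreover have "E k \<le> g" if "m \<le> k" for k
    using order_trans[OF join_seq_ge[of E m "k - m", OF E] ge] that by simp
  ultimately show ?thesis using g gC that by blast
qed

text \<open>The bounded part of \<open>N\<close> is complete for \<open>x \<mapsto> \<psi> (x\<^sup>2)\<close>. The sets where consecutive
  terms of a fast Cauchy sequence differ by much have small total \<open>\<psi>\<close>-mass; the role of their indicator
  functions is played by the powers \<open>1 - (1 - d)\<^sup>n\<close>.\<close>

lemma C_complete:
  assumes h: "\<And>k. h k \<in> C"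
    and fast: "\<And>k. f ((h (Suc k) - h k) * (h (Suc k) - h k)) \<le> c * (1/16) ^ k"
  obtains H where "H \<in> C" "(\<lambda>n. f ((h n - H) * (h n - H))) \<longlonglongrightarrow> 0"
proof -
  define d where "d k = (h (Suc k) - h k) * (h (Suc k) - h k)" for k
  \<comment> \<open>Chebyshev and Borel-Cantelli: the exponent \<open>4 ^ k\<close> raises the mass
    of \<open>d k\<close> from order 16^(-k) to order 4^(-k), still summable, while off
    \<open>E k\<close> the square \<open>d k\<close> is at most about 4^(-k), so that steps there
    have size 2^(-k).\<close>
  define E where "E k = join_power (d k) (4 ^ k)" for k
  have d: "d k \<in> C" for k unfolding d_def using C_diff_square h by blast
  have E: "E k \<in> C" for k using join_power_in_C[OF d] by (simp add: E_def)
  have fE: "f (E k) \<le> c * (1/4) ^ k" for k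
  proof -
    have "f (E k) \<le> 4 ^ k * f (d k)" using join_power_in_C[OF d, of k "4 ^ k"] by (simp add: E_def)
    also have "\<dots> \<le> 4 ^ k * (c * (1/16) ^ k)" using fast[of k] by (simp add: d_def)
    also have "\<dots> = c * (4 * (1/16)) ^ k" by (simp only: power_mult_distrib mult_ac)
    finally show ?thesis by simp
  qed
  have "\<exists>g. slim (join_seq E m) g \<and> g \<in> C \<and> f g \<le> 2 * c * (1/4) ^ m \<and> (\<forall>k\<ge>m. E k \<le> g)" for m
    by (rule join_seq_limit[of E c m, OF E fE]) blast
  then obtain g where g: "\<And>m. slim (join_seq E m) (g m)" "\<And>m. g m \<in> C"
      "\<And>m. f (g m) \<le> 2 * c * (1/4) ^ m" "\<And>m k. m \<le> k \<Longrightarrow> E k \<le> g m"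
    by metis
  have gdec: "g (Suc m) \<le> g m" for m
  proof (rule slim_mono[OF g(1)[of "Suc m"]])
    show "slim (\<lambda>n. join_seq E m (n + 1)) (g m)" by (rule slim_shift[OF g(1)])
    show "join_seq E (Suc m) n \<le> join_seq E m (n + 1)" for n
      using join_seq_shift[of E m n, OF E] by (simp only: Suc_eq_plus1)
  qed
  \<comment> \<open>The tails \<open>g m\<close> decrease to an element of mass zero, which
    faithfulness makes 0; so the complements \<open>1 - g m\<close> converge strongly to
    \<open>1\<close>.\<close>
  obtain s where s: "slim g s" "0 \<le> s"
    by (rule decseq_slim[of g, OF gdec CD(2)[OF g(2)] CD(3)[OF g(2)]])
  have sC: "s \<in> C" by (rule C_slim[OF g(2) s(1)])
  have "(\<lambda>m. f (g m)) \<longlonglongrightarrow> f s"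
    by (rule normal_decseq[OF CD(4)[OF g(2)] CD(5)[OF g(2)] gdec s(1) CD(4)[OF sC]])
  moreover have "(\<lambda>m. 2 * c * (1/4) ^ m) \<longlonglongrightarrow> 2 * c * 0"
    by (intro tendsto_intros LIMSEQ_power_zero) simp
  ultimately have "f s \<le> 0" using LIMSEQ_le g(3) by fastforce
  then have "s = 0" using f_zero CD[OF sC] by blast
  then have g0: "(\<lambda>m. app (g m) \<xi>) \<longlonglongrightarrow> 0" for \<xi> using s(1) by (simp add: slim_def)
  \<comment> \<open>Since \<open>1 - g m\<close> is at most \<open>(1 - d k) ^ (4 ^ k)\<close>,
    power decay bounds \<open>d k\<close> there, and the root of that bound controls the
    step.\<close>
  have step: "norm (app ((h (Suc k) - h k) * (1 - g m)) \<xi>) \<le> (1/2) ^ k * norm \<xi>"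
    if "m \<le> k" for k m \<xi>
  proof (rule norm_app_le)
    define \<delta> where "\<delta> = h (Suc k) - h k"
    define r where "r = 1 - g m"
    have r: "0 \<le> r" "r \<le> 1" using CD[OF g(2)] by (auto simp: r_def)
    have dr: "d k * r = r * d k" using comm[OF CD(1)[OF d] CD(1)[OF g(2)]]
      by (simp add: r_def algebra_simps)
    have \<delta>r: "\<delta> * r = r * \<delta>"
      using comm[of \<delta> "g m"] CD(1)[OF h] CD(1)[OF g(2)] by (simp add: r_def \<delta>_def algebra_simps N.diff)
    have le: "r \<le> (1 - d k) ^ (4 ^ k)"
      using g(4)[OF that] by (simp add: r_def E_def flip: join_power_complement)
    have "star (\<delta> * r) * (\<delta> * r) = (r * d k) * r"
      using CD(5)[OF h] bop_pos_star[OF r(1)] by (simp add: d_def \<delta>_def mult.assoc)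
    also have "\<dots> \<le> r * d k"
      using bop_commuting_mult_mono[of r 1 "r * d k"] r dr CD(2)[OF d]
        bop_commuting_mult_pos[of r "d k"] by (simp add: mult.assoc)
    also have "\<dots> \<le> (1 - d k) ^ (4 ^ k) * d k"
    proof (rule bop_commuting_mult_mono[OF le CD(2)[OF d]])
      have "(1 - d k) * d k = d k * (1 - d k)" by (simp add: algebra_simps)
      then show "(1 - d k) ^ 4 ^ k * d k = d k * (1 - d k) ^ 4 ^ k"
        by (rule power_commuting_commutes)
    qed (simp add: dr)
    also have "\<dots> \<le> (1 / (real (4 ^ k) + 1)) *\<^sub>R 1"
    proof -
      have "(1 - d k) * d k = d k * (1 - d k)" by (simp add: algebra_simps)
      then have "(1 - d k) ^ (4 ^ k) * d k = d k * (1 - d k) ^ (4 ^ k)"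
        by (rule power_commuting_commutes)
      then show ?thesis using bop_power_decay[of "1 - d k" "4 ^ k"] CD[OF d] by simp
    qed
    also have "\<dots> \<le> ((1/2) ^ k)\<^sup>2 *\<^sub>R 1"
    proof (rule scaleR_right_mono[OF _ bop_one_pos])
      have "((1/2) ^ k)\<^sup>2 = 1 / (4::real) ^ k"
        by (simp only: power2_eq_square power_mult_distrib[symmetric]) (simp add: power_divide)
      then show "1 / (real (4 ^ k) + 1) \<le> ((1/2) ^ k)\<^sup>2" by (simp add: frac_le)
    qed
    finally show "star ((h (Suc k) - h k) * (1 - g m)) * ((h (Suc k) - h k) * (1 - g m))
      \<le> ((1/2) ^ k)\<^sup>2 *\<^sub>R 1" by (simp add: \<delta>_def r_def)
  qed simp
  have far: "norm (app ((h k - h n) * (1 - g m)) \<xi>) \<le> 2 * (1/2) ^ n * norm \<xi>"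
    if "m \<le> n" "n \<le> k" for k n m \<xi>
  proof -
    have "norm (app ((h (n + j) - h n) * (1 - g m)) \<xi>) \<le> 2 * ((1/2) ^ n - (1/2) ^ (n + j)) * norm \<xi>" for j
    proof (induction j)
      case (Suc j)
      have "app ((h (n + Suc j) - h n) * (1 - g m)) \<xi>
        = app ((h (Suc (n + j)) - h (n + j)) * (1 - g m)) \<xi> + app ((h (n + j) - h n) * (1 - g m)) \<xi>"
        by simp
      also have "norm \<dots> \<le> (1/2) ^ (n + j) * norm \<xi> + 2 * ((1/2) ^ n - (1/2) ^ (n + j)) * norm \<xi>"
        using step[of m "n + j" \<xi>] that Suc by (intro order_trans[OF norm_triangle_ineq] add_mono) auto
      also have "\<dots> = 2 * ((1/2) ^ n - (1/2) ^ (n + Suc j)) * norm \<xi>" by (simp add: algebra_simps)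
      finally show ?case .
    qed simp
    from this[of "k - n"] that have "norm (app ((h k - h n) * (1 - g m)) \<xi>) \<le> 2 * ((1/2) ^ n - (1/2) ^ k) * norm \<xi>"
      by simp
    also have "\<dots> \<le> 2 * (1/2) ^ n * norm \<xi>" by (intro mult_right_mono) auto
    finally show ?thesis .
  qed
  have h_norm: "norm (app (h k) \<xi>) \<le> norm \<xi>" for k \<xi>
    using norm_app_le_one CD[OF h] by blast
  \<comment> \<open>The vector splits into a part under \<open>1 - g m\<close>, where the steps are
    summable, and a part under \<open>g m\<close>, which is small and stays small under the
    contractions \<open>h n\<close>.\<close>
  have "Cauchy (\<lambda>n. app (h n) \<xi>)" for \<xi>
  proof (rule CauchyI')
    fix \<epsilon> :: real assume \<epsilon>: "0 < \<epsilon>"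
    obtain m where m: "norm (app (g m) \<xi>) < \<epsilon> / 4"
      using LIMSEQ_D[OF g0[of \<xi>], of "\<epsilon> / 4"] \<epsilon> by auto
    have "(\<lambda>n. 2 * (1/2) ^ n * norm \<xi>) \<longlonglongrightarrow> 0" by real_asymp
    then obtain n0 where n0: "\<And>n. n \<ge> n0 \<Longrightarrow> 2 * (1/2) ^ n * norm \<xi> < \<epsilon> / 2"
      using \<epsilon> unfolding LIMSEQ_iff by (metis diff_zero half_gt_zero abs_less_iff real_norm_def)
    have "dist (app (h n) \<xi>) (app (h k) \<xi>) < \<epsilon>" if "n \<ge> max m n0" "k > n" for n k
    proof -
      have "app (h k) \<xi> - app (h n) \<xi>
        = app ((h k - h n) * (1 - g m)) \<xi> + (app (h k) (app (g m) \<xi>) - app (h n) (app (g m) \<xi>))"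
        by (simp add: app_linear)
      also have "norm \<dots> \<le> 2 * (1/2) ^ n * norm \<xi> + (norm (app (g m) \<xi>) + norm (app (g m) \<xi>))"
        using far[of m n k \<xi>] that h_norm
        by (intro order_trans[OF norm_triangle_ineq] add_mono order_trans[OF norm_triangle_ineq4]) auto
      also have "\<dots> < \<epsilon>" using m n0[of n] that by simp
      finally show ?thesis by (simp add: dist_norm norm_minus_commute)
    qed
    then show "\<exists>M. \<forall>m\<ge>M. \<forall>n>m. dist (app (h m) \<xi>) (app (h n) \<xi>) < \<epsilon>" by blast
  qed
  then have "convergent (\<lambda>n. app (h n) \<xi>)" for \<xi> by (rule Cauchy_convergent)
  then obtain H where H: "slim h H"
    by (rule slim_exists[of h 1]) (use h_norm in simp)
  have HC: "H \<in> C" by (rule C_slim[OF h H])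
  \<comment> \<open>Strong convergence alone does not pass through \<psi>, as the sequence is not
    monotone. The square is therefore split: off \<open>g n\<close> it is uniformly small, and on
    \<open>g n\<close> it is at most \<open>g n\<close> itself.\<close>
  have bound: "f ((h n - H) * (h n - H)) \<le> 2 * (1/2) ^ n + 2 * c * (1/4) ^ n" for n
  proof -
    define \<delta> where "\<delta> = h n - H"
    define r where "r = 1 - g n"
    have \<delta>N: "\<delta> \<in> N" and \<delta>s: "star \<delta> = \<delta>" using CD[OF h] CD[OF HC] by (auto simp: \<delta>_def N.diff)
    have \<delta>2: "\<delta> * \<delta> \<in> C" unfolding \<delta>_def using C_diff_square h HC by blast
    have comm2: "\<delta> * \<delta> * g n = g n * (\<delta> * \<delta>)" by (rule comm[OF CD(1)[OF \<delta>2] CD(1)[OF g(2)]])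
    have "norm (app (\<delta> * r) \<xi>) \<le> 2 * (1/2) ^ n * norm \<xi>" for \<xi>
    proof -
      have "(\<lambda>k. norm (app (h k * r - h n * r) \<xi>)) \<longlonglongrightarrow> norm (app (H * r - h n * r) \<xi>)"
        using H by (auto simp: slim_def intro!: tendsto_intros)
      then have "norm (app (H * r - h n * r) \<xi>) \<le> 2 * (1/2) ^ n * norm \<xi>"
        by (rule LIMSEQ_le_const2)
          (use far[of n n _ \<xi>] in \<open>auto simp: r_def left_diff_distrib intro!: exI[of _ n]\<close>)
      then show ?thesis by (simp add: \<delta>_def norm_minus_commute)
    qed
    then have small: "norm (app \<delta> (app r \<xi>)) \<le> 2 * (1/2) ^ n * norm \<xi>" for \<xi> by simp
    have "\<delta> * \<delta> * r \<le> (2 * (1/2) ^ n) *\<^sub>R 1"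
    proof (rule bop_leI)
      show "star (\<delta> * \<delta> * r) = \<delta> * \<delta> * r"
        using \<delta>s CD(5)[OF g(2)] comm2 by (simp add: r_def algebra_simps)
      fix \<xi>
      have "norm (app \<delta> \<xi>) \<le> 1 * norm \<xi>" by (rule norm_app_le) (use CD(3)[OF \<delta>2] \<delta>s in auto)
      then have "inner (app \<delta> \<xi>) (app \<delta> (app r \<xi>)) \<le> norm \<xi> * (2 * (1/2) ^ n * norm \<xi>)"
        using small[of \<xi>] by (intro order_trans[OF norm_cauchy_schwarz] mult_mono) auto
      then have "inner \<xi> (app (\<delta> * \<delta> * r) \<xi>) \<le> norm \<xi> * (2 * (1/2) ^ n * norm \<xi>)"
        using inner_star_right[of \<xi> \<delta> "app \<delta> (app r \<xi>)"] by (simp add: \<delta>s)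
      then show "inner \<xi> (app (\<delta> * \<delta> * r) \<xi>) \<le> inner \<xi> (app ((2 * (1/2) ^ n) *\<^sub>R 1) \<xi>)"
        by (simp add: power2_norm_eq_inner[symmetric] power2_eq_square mult_ac)
    qed simp
    moreover have "\<delta> * \<delta> * r = \<delta> * \<delta> - \<delta> * \<delta> * g n" by (simp add: r_def algebra_simps)
    ultimately have 1: "f (\<delta> * \<delta> - \<delta> * \<delta> * g n) \<le> 2 * (1/2) ^ n"
      using NM[OF \<delta>N] CD(4)[OF g(2)] by (intro fle_const closed_ops) auto
    have "\<delta> * \<delta> * g n \<le> g n"
      by (rule bop_unit_mult(2)[OF CD(2)[OF \<delta>2] CD(3)[OF \<delta>2] CD(2)[OF g(2)] CD(3)[OF g(2)] comm2])
    then have "f (\<delta> * \<delta> * g n) \<le> f (g n)"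
      using NM[OF \<delta>N] CD(4)[OF g(2)] by (intro fmono closed_ops) auto
    with 1 g(3)[of n] have "f (\<delta> * \<delta>) \<le> 2 * (1/2) ^ n + 2 * c * (1/4) ^ n"
      using NM[OF \<delta>N] CD(4)[OF g(2)] by (simp add: fdiff closed_ops)
    then show ?thesis by (simp add: \<delta>_def)
  qed
  have "(\<lambda>n. f ((h n - H) * (h n - H))) \<longlonglongrightarrow> 0"
  proof (rule tendsto_sandwich[where f = "\<lambda>n. 0"])
    show "(\<lambda>n. 2 * (1/2) ^ n + 2 * c * (1/4) ^ n) \<longlonglongrightarrow> 0" by real_asymp
    have "0 \<le> f ((h n - H) * (h n - H))" for n
      using CD[OF C_diff_square[OF h HC]] by (intro fpos_Re)
    then show "\<forall>\<^sub>F n in sequentially. 0 \<le> f ((h n - H) * (h n - H))" by simp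
  qed (use bound in auto)
  with HC show ?thesis by (rule that)
qed

end

lemma bounded_by_fractions: "(\<And>n. (y::real) \<le> 1 / (real n + 1)) \<Longrightarrow> y \<le> 0"
proof -
  assume *: "\<And>n. y \<le> 1 / (real n + 1)"
  have "(\<lambda>n. 1 / (real n + 1)) \<longlonglongrightarrow> 0" by real_asymp
  then show "y \<le> 0" by (rule LIMSEQ_le_const) (use * in auto)
qed

context central_subalgebra
begin

lemma f_square_sum:
  assumes a: "a \<in> M" "star a = a" and b: "b \<in> N" "star b = b"
  shows "f ((a + b) * (a + b)) = f (a * a) + 2 * f (a * b) + f (b * b)"
proof -
  have "(a + b) * (a + b) = a * a + a * b + b * a + b * b" by (simp add: algebra_simps)
  then show ?thesis using a NM[OF b(1)] central[OF b(1) a(1)] by (simp add: fadd closed_ops)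
qed

text \<open>Projection onto a convex set for the norm with square \<psi>(y^2) on self-adjoint
  elements: the parallelogram law makes a minimising sequence Cauchy, and \<open>C_complete\<close>
  supplies its limit inside \<open>C\<close>.\<close>

lemma minimizer_exists:
  assumes x: "x \<in> M" "star x = x"
  obtains H where "H \<in> C" "\<And>k. k \<in> C \<Longrightarrow> f ((x - H) * (x - H)) \<le> f ((x - k) * (x - k))"
proof -
  define q where "q h = f ((x - h) * (x - h))" for h
  have q0: "0 \<le> q h" if "h \<in> C" for h
    unfolding q_def using x CD[OF that] by (intro fpos_Re closed_ops bop_square_pos) auto
  define I where "I = Inf (q ` C)"
  have bdd: "bdd_below (q ` C)" using q0 by (rule bdd_belowI2)
  have I_le: "I \<le> q h" if "h \<in> C" for h
    unfolding I_def using bdd that by (auto intro: cInf_lower)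
  \<comment> \<open>The rate is the one that \<open>C_complete\<close> asks for; the parallelogram
    law turns it into \<open>4 * (1/16) ^ k\<close>.\<close>
  have "\<exists>h\<in>C. q h < I + (1/16) ^ n" for n
  proof -
    have "Inf (q ` C) < I + (1/16) ^ n" by (simp add: I_def)
    then show ?thesis using bdd C_zero by (subst (asm) cInf_less_iff) auto
  qed
  then obtain h where h: "\<And>n. h n \<in> C" and qh: "\<And>n. q (h n) < I + (1/16) ^ n" by metis
  have hM: "h n \<in> M" "star (h n) = h n" "h n \<in> N" for n using CD[OF h] by auto
  have "f ((h (Suc k) - h k) * (h (Suc k) - h k)) \<le> 4 * (1/16) ^ k" for k
  proof -
    define m where "m = (1/2) *\<^sub>R (h (Suc k) + h k)"
    have "m \<le> (1/2) *\<^sub>R (1 + 1)"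
      unfolding m_def by (intro scaleR_left_mono add_mono CD(3)[OF h]) auto
    then have "m \<le> 1" by (simp flip: scaleR_2)
    moreover have "0 \<le> m" unfolding m_def by (auto intro!: scaleR_nonneg_nonneg add_nonneg_nonneg CD(2)[OF h])
    ultimately have mC: "m \<in> C" by (simp add: C_def m_def N.closed_ops hM)
    have "(h (Suc k) - h k) * (h (Suc k) - h k) = 2 *\<^sub>R ((x - h (Suc k)) * (x - h (Suc k)))
        + 2 *\<^sub>R ((x - h k) * (x - h k)) - 4 *\<^sub>R ((x - m) * (x - m))"
    proof -
      define u where "u = x - h (Suc k)"
      define v where "v = x - h k"
      have "(1/2) *\<^sub>R (u + v) = (1/2) *\<^sub>R (x + x) - m"
        unfolding m_def u_def v_def by (simp only: scaleR_add_right scaleR_diff_right) simp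
      then have "x - m = (1/2) *\<^sub>R (u + v)" by (simp only: scaleR_half_double)
      then have 1: "4 *\<^sub>R ((x - m) * (x - m)) = (u + v) * (u + v)" by simp
      have 2: "h (Suc k) - h k = v - u" by (simp add: u_def v_def)
      show ?thesis
        unfolding 1 2 u_def[symmetric] v_def[symmetric] by (simp add: scaleR_2 algebra_simps)
    qed
    then have "f ((h (Suc k) - h k) * (h (Suc k) - h k)) = 2 * q (h (Suc k)) + 2 * q (h k) - 4 * q m"
      using x hM CD(4)[OF mC] by (simp add: q_def fadd fdiff fscaleR closed_ops)
    moreover have "(0::real) \<le> (1/16) ^ k" by simp
    ultimately show ?thesis
      using qh[of k] qh[of "Suc k"] I_le[OF mC] unfolding power_Suc by linarith
  qed
  then obtain H where HC: "H \<in> C" and lim: "(\<lambda>n. f ((h n - H) * (h n - H))) \<longlonglongrightarrow> 0"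
    by (rule C_complete[OF h])
  have "q H \<le> I"
  proof -
    define t where "t n = f ((h n - H) * (h n - H))" for n
    have bound: "q H \<le> I + (1/16) ^ n + 2 * (sqrt (I + 1) * sqrt (t n)) + t n" for n
    proof -
      have d: "h n - H \<in> N" "star (h n - H) = h n - H" "h n - H \<in> M" and dx: "x - h n \<in> M" "star (x - h n) = x - h n"
        using hM CD[OF HC] x by (auto intro: N.closed_ops closed_ops)
      have "q H = q (h n) + 2 * f ((x - h n) * (h n - H)) + t n"
        using f_square_sum[OF dx d(1,2)] by (simp add: q_def t_def)
      moreover have "f ((x - h n) * (h n - H)) \<le> sqrt (q (h n)) * sqrt (t n)"
        using fcauchy_schwarz_Re[OF d(3) dx(1), unfolded dx(2) d(2)]
        by (simp only: q_def t_def abs_le_iff)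
      moreover have "sqrt (q (h n)) * sqrt (t n) \<le> sqrt (I + 1) * sqrt (t n)"
      proof (intro mult_right_mono real_sqrt_le_mono)
        have "(1/16::real) ^ n \<le> 1" by (simp add: power_le_one)
        then show "q (h n) \<le> I + 1" using qh[of n] by linarith
        show "0 \<le> sqrt (t n)"
          unfolding t_def using bop_square_pos[OF d(2)] d(3) by (intro real_sqrt_ge_zero fpos_Re mult)
      qed
      ultimately show ?thesis using qh[of n] by linarith
    qed
    have "(\<lambda>n. I + (1/16) ^ n + 2 * (sqrt (I + 1) * sqrt (t n)) + t n)
        \<longlonglongrightarrow> I + 0 + 2 * (sqrt (I + 1) * sqrt 0) + 0"
      using lim unfolding t_def[symmetric] by (intro tendsto_intros LIMSEQ_power_zero) auto
    from LIMSEQ_le_const[OF this] show ?thesis using bound by auto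
  qed
  then show ?thesis using I_le HC that unfolding q_def by (meson order_trans)
qed

lemma N_induct_C:
  assumes "a \<in> N" and "\<And>a. a \<in> C \<Longrightarrow> P a"
    and "\<And>a b. a \<in> N \<Longrightarrow> b \<in> N \<Longrightarrow> P a \<Longrightarrow> P b \<Longrightarrow> P (a + b)"
    and "\<And>c a. a \<in> N \<Longrightarrow> P a \<Longrightarrow> P (csc c a)"
  shows "P a"
proof -
  have sa: "P b" if b: "b \<in> N" "star b = b" for b
  proof -
    obtain c y where "0 < c" and y: "y \<in> N" "0 \<le> y" "y \<le> 1" "b = (2 * c) *\<^sub>R y - c *\<^sub>R e"
      using N.selfadjoint_affine[OF b] by blast
    have "b = csc (of_real (2 * c)) y + csc (of_real (- c)) e"
      unfolding y(4) csc_simps(7) by simp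
    moreover have "P (csc (of_real (2 * c)) y + csc (of_real (- c)) e)"
      using y by (intro assms(2-4) N.closed_ops C_unit) (auto simp: C_def)
    ultimately show ?thesis by simp
  qed
  obtain b c where bc: "b \<in> N" "c \<in> N" "star b = b" "star c = c" "a = b + csc \<i> c"
    using N.selfadjoint_decomposition[OF assms(1)] by blast
  have "P (b + csc \<i> c)" using bc by (intro assms(3,4) sa N.closed_ops)
  then show ?thesis using bc by simp
qed

text \<open>Where the minimiser \<open>H\<close> of \<open>\<psi> ((x - h)\<^sup>2)\<close> over the unit interval of \<open>N\<close> is positive it can be
  decreased, and where it is less than \<open>1\<close> it can be increased. So \<open>\<phi> = \<psi> ((x - H) \<cdot>)\<close> vanishes
  away from \<open>H = 0\<close> and \<open>H = 1\<close>, and there the bounds on \<open>x\<close> force it to vanish as well.\<close>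

lemma radon_nikodym:
  assumes x: "x \<in> M" "star x = x"
    and lower: "\<And>a. a \<in> N \<Longrightarrow> 0 \<le> a \<Longrightarrow> 0 \<le> f (x * a)"
    and upper: "\<And>a. a \<in> N \<Longrightarrow> 0 \<le> a \<Longrightarrow> f (x * a) \<le> f a"
  obtains H where "H \<in> C" "\<And>a. a \<in> N \<Longrightarrow> \<psi> (H * a) = \<psi> (x * a)"
proof -
  obtain H where HC: "H \<in> C"
    and min: "\<And>k. k \<in> C \<Longrightarrow> f ((x - H) * (x - H)) \<le> f ((x - k) * (x - k))"
    using minimizer_exists[OF x] by blast
  note H = CD[OF HC]
  define \<phi> where "\<phi> a = f ((x - H) * a)" for a
  have \<phi>_diff: "\<phi> (a - b) = \<phi> a - \<phi> b" if "a \<in> N" "b \<in> N" for a b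
    using that NM x H by (simp add: \<phi>_def right_diff_distrib fdiff closed_ops)
  have \<phi>_eq: "\<phi> a = f (x * a) - f (H * a)" if "a \<in> N" for a
    using that NM x H by (simp add: \<phi>_def left_diff_distrib fdiff closed_ops)
  \<comment> \<open>First-order condition: the segment from \<open>H\<close> to \<open>k\<close>
    stays in \<open>C\<close>, so the derivative of the squared distance along it, -2 \<phi>(k - H),
    cannot be negative.\<close>
  have variation: "\<phi> (k - H) \<le> 0" if k: "k \<in> C" for k
  proof (rule ccontr)
    assume "\<not> \<phi> (k - H) \<le> 0"
    then have B: "\<phi> (k - H) > 0" by simp
    define D where "D = k - H"
    define Q where "Q = f (D * D)"
    have D: "D \<in> N" "star D = D" "D \<in> M" using CD[OF k] H by (auto simp: D_def intro: N.closed_ops closed_ops)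
    have Q0: "0 \<le> Q" unfolding Q_def using bop_square_pos[OF D(2)] D(3) by (intro fpos_Re mult)
    have quad: "2 * \<phi> D \<le> t * Q" if t: "0 < t" "t \<le> 1" for t
    proof -
      have Ht: "H + t *\<^sub>R D = (1 - t) *\<^sub>R H + t *\<^sub>R k" by (simp add: D_def algebra_simps)
      have "(1 - t) *\<^sub>R H + t *\<^sub>R k \<le> (1 - t) *\<^sub>R 1 + t *\<^sub>R 1"
        using t by (intro add_mono scaleR_left_mono H CD(3)[OF k]) auto
      then have "(1 - t) *\<^sub>R H + t *\<^sub>R k \<le> 1" by (simp flip: scaleR_add_left)
      moreover have "0 \<le> (1 - t) *\<^sub>R H + t *\<^sub>R k"
        using t by (intro add_nonneg_nonneg scaleR_nonneg_nonneg H CD(2)[OF k]) auto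
      ultimately have "H + t *\<^sub>R D \<in> C"
        using Ht H(1) CD(1)[OF k] by (simp add: C_def N.closed_ops)
      from min[OF this] have "f ((x - H) * (x - H)) \<le> f (((x - H) + (- t) *\<^sub>R D) * ((x - H) + (- t) *\<^sub>R D))"
        by (simp add: algebra_simps)
      also have "\<dots> = f ((x - H) * (x - H)) + 2 * f ((x - H) * ((- t) *\<^sub>R D)) + f (((- t) *\<^sub>R D) * ((- t) *\<^sub>R D))"
        using x H D by (intro f_square_sum closed_ops N.closed_ops) auto
      also have "\<dots> = f ((x - H) * (x - H)) - 2 * t * \<phi> D + t * t * Q"
        using x H D by (simp add: \<phi>_def Q_def fscaleR fminus closed_ops)
      finally have "t * (2 * \<phi> D) \<le> t * (t * Q)" by simp
      then show ?thesis using t by simp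
    qed
    \<comment> \<open>Small enough that \<open>t * Q \<le> \<phi> D\<close>, which contradicts
      \<open>2 * \<phi> D \<le> t * Q\<close> when \<open>\<phi> D\<close> is positive.\<close>
    define t where "t = min 1 (\<phi> D / (Q + 1))"
    have t: "0 < t" "t \<le> 1" using B Q0 by (auto simp: t_def D_def)
    have "t * Q \<le> \<phi> D / (Q + 1) * Q" using Q0 by (intro mult_right_mono) (auto simp: t_def)
    also have "\<dots> \<le> \<phi> D" using Q0 B by (simp add: D_def field_simps)
    finally show False using quad[OF t] B by (simp add: D_def)
  qed
  \<comment> \<open>An upward move, from \<open>H\<close> to the union of \<open>a\<close> and
    \<open>H\<close>, has increment a (1 - H). The next fact uses the downward move by a H.\<close>
  have inc: "\<phi> (a - a * H) \<le> 0" if a: "a \<in> C" for a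
  proof -
    have "join a H \<in> C" by (rule join_in_C(1)[OF a HC])
    from variation[OF this] show ?thesis by (simp add: join_def)
  qed
  have dec: "0 \<le> \<phi> (a * H)" if a: "a \<in> C" for a
  proof -
    have "H - H * a \<in> C" by (rule C_mult_complement[OF HC a])
    from variation[OF this] have "\<phi> (0 - a * H) \<le> 0" using comm[OF H(1) CD(1)[OF a]] by simp
    then show ?thesis using CD(1)[OF a] H(1) by (subst (asm) \<phi>_diff) (auto simp: N.closed_ops \<phi>_def fzero)
  qed
  \<comment> \<open>The element a H (1 - H) is an upward increment belonging to \<open>a * H\<close>
    and a downward one belonging to \<open>a - a * H\<close>, so \<phi> vanishes on it.\<close>
  have mixed: "\<phi> (a * H) = \<phi> (a * H * H)" "\<phi> (a - a * H) = \<phi> ((a - a * H) - (a - a * H) * H)"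
    if a: "a \<in> C" for a
  proof -
    have aH: "a * H \<in> C" "a - a * H \<in> C" using C_mult C_mult_complement a HC by auto
    have eq: "(a - a * H) * H = a * H - a * H * H" by (simp add: algebra_simps)
    have "\<phi> (a * H - a * H * H) = 0"
      using inc[OF aH(1)] dec[OF aH(2)] unfolding eq by linarith
    moreover have "\<phi> (a * H - a * H * H) = \<phi> (a * H) - \<phi> (a * H * H)"
      by (rule \<phi>_diff[OF CD(1)[OF aH(1)] N.mult[OF CD(1)[OF aH(1)] H(1)]])
    moreover have "\<phi> ((a - a * H) - (a - a * H) * H) = \<phi> (a - a * H) - \<phi> ((a - a * H) * H)"
      by (rule \<phi>_diff[OF CD(1)[OF aH(2)] N.mult[OF CD(1)[OF aH(2)] H(1)]])
    ultimately show "\<phi> (a * H) = \<phi> (a * H * H)" "\<phi> (a - a * H) = \<phi> ((a - a * H) - (a - a * H) * H)"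
      unfolding eq by linarith+
  qed
  \<comment> \<open>By \<open>mixed\<close> the factor \<open>H\<close> may be repeated at will.
    High powers live where \<open>H\<close> is near 1, and there \<open>upper\<close> bounds \<phi>
    by \<psi> of a H (1 - H) H^n, which is of order 1/n.\<close>
  have zero_H: "\<phi> (a * H) = 0" if a: "a \<in> C" for a
  proof -
    have pow: "\<phi> (a * H) = \<phi> (a * H ^ Suc n)" for n
    proof (induction n)
      case (Suc n)
      have "\<phi> (a * H ^ n * H) = \<phi> (a * H ^ n * H * H)"
        by (rule mixed(1)[OF C_mult_powers(1)[OF a HC]])
      then show ?case using Suc by (simp add: mult.assoc power_commutes)
    qed simp
    have "\<phi> (a * H) \<le> 1 / (real n + 1)" for n
    proof -
      define z where "z = a * H ^ n"
      have zC: "z \<in> C" unfolding z_def by (rule C_mult_powers[OF a HC])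
      have zHC: "z * H \<in> C" by (rule C_mult[OF zC HC])
      have "\<phi> (a * H) = \<phi> (z * H)"
        using pow[of n] by (simp add: z_def mult.assoc power_commutes)
      also have "\<dots> \<le> f (z * H) - f (H * (z * H))"
        using \<phi>_eq[OF CD(1)[OF zHC]] upper[OF CD(1,2)[OF zHC]] by simp
      also have "\<dots> = f (z * H - H * (z * H))"
        using CD(4)[OF zHC] H by (simp add: fdiff closed_ops)
      also have "\<dots> \<le> 1 / (real n + 1)"
      proof (rule fle_const)
        show "z * H - H * (z * H) \<in> M" using CD(4)[OF zHC] H by (simp add: closed_ops)
        have "z * H - H * (z * H) = (a * H) * ((1 - H) * H ^ n)"
          using comm[OF H(1) CD(1)[OF zC]] comm[OF H(1) CD(1)[OF a]]
          by (simp add: z_def algebra_simps) (metis (no_types, lifting) mult.assoc power_commutes)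
        also have "\<dots> \<le> (1 - H) * H ^ n"
        proof -
          have d: "0 \<le> (1 - H) * H ^ n" using bop_power_decay[OF H(2,3)] by blast
          have c: "a * H * ((1 - H) * H ^ n) = (1 - H) * H ^ n * (a * H)"
            using comm[OF H(1) CD(1)[OF a]]
            by (simp add: algebra_simps) (metis (no_types, lifting) mult.assoc power_commutes power_commuting_commutes)
          have "a * H \<le> 1" by (rule CD(3)[OF C_mult[OF a HC]])
          from bop_commuting_mult_mono[OF this d] c show ?thesis by simp
        qed
        also have "\<dots> \<le> (1 / (real n + 1)) *\<^sub>R 1" using bop_power_decay[OF H(2,3)] by blast
        finally show "z * H - H * (z * H) \<le> (1 / (real n + 1)) *\<^sub>R 1" .
      qed
      finally show ?thesis .
    qed
    then show ?thesis using bounded_by_fractions dec[OF a] by (meson antisym)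
  qed
  \<comment> \<open>The mirror image: powers of \<open>K = 1 - H\<close> live where \<open>H\<close>
    is near 0, and there \<open>lower\<close> leaves only \<open>H * z\<close>, again of order
    1/n.\<close>
  have zero_1H: "\<phi> (a - a * H) = 0" if a: "a \<in> C" for a
  proof -
    define K where "K = 1 - H"
    have K: "0 \<le> K" "K \<le> 1" using H by (auto simp: K_def)
    have step: "b - b * H = b * K" for b by (simp add: K_def algebra_simps)
    have bK: "b * K ^ n \<in> C" if "b \<in> C" for b n
      using C_mult_powers(2)[OF that HC] by (simp add: K_def)
    have pow: "\<phi> (a * K) = \<phi> (a * K ^ Suc n)" for n
    proof (induction n)
      case (Suc n)
      have "\<phi> (a * K ^ n * K) = \<phi> (a * K ^ n * K * K)"
        using mixed(2)[OF bK[OF a, of n]] by (simp only: step)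
      then show ?case using Suc by (simp add: mult.assoc power_commutes)
    qed simp
    have "- \<phi> (a * K) \<le> 1 / (real n + 1)" for n
    proof -
      define z where "z = a * K ^ Suc n"
      have zC: "z \<in> C" unfolding z_def by (rule bK[OF a])
      have "\<phi> (a * K) = \<phi> z" unfolding z_def by (rule pow)
      then have "- \<phi> (a * K) \<le> f (H * z)"
        using \<phi>_eq[OF CD(1)[OF zC]] lower[OF CD(1,2)[OF zC]] by simp
      also have "\<dots> \<le> 1 / (real n + 1)"
      proof (rule fle_const)
        show "H * z \<in> M" using CD(4)[OF zC] H by (simp add: closed_ops)
        define y where "y = a * K"
        have yC: "y \<in> C" using bK[OF a, of 1] by (simp add: y_def)
        have Ha: "H * a = a * H" by (rule comm[OF H(1) CD(1)[OF a]])
        then have Ka: "K * a = a * K" by (simp add: K_def algebra_simps)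
        have HK: "H * K = K * H" by (simp add: K_def algebra_simps)
        have Kna: "K ^ m * a = a * K ^ m" for m by (rule power_commuting_commutes[OF Ka])
        have "H * z = y * ((1 - K) * K ^ n)"
        proof -
          have "H * z = a * (H * K) * K ^ n" by (simp add: z_def mult.assoc[symmetric] Ha)
          then show ?thesis by (simp add: HK y_def mult.assoc) (simp add: K_def)
        qed
        moreover have "y * ((1 - K) * K ^ n) = (1 - K) * K ^ n * y"
        proof -
          have "(1 - K) * K ^ n * y = (H * (K ^ n * a)) * K" by (simp add: y_def K_def mult.assoc)
          also have "\<dots> = a * (H * (K ^ n * K))" by (simp add: Kna) (simp add: mult.assoc[symmetric] Ha)
          also have "\<dots> = a * (H * K) * K ^ n" by (simp add: mult.assoc power_commutes)
          also have "\<dots> = y * ((1 - K) * K ^ n)" by (simp add: HK y_def mult.assoc) (simp add: K_def)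
          finally show ?thesis by simp
        qed
        moreover have "0 \<le> (1 - K) * K ^ n" "(1 - K) * K ^ n \<le> (1 / (real n + 1)) *\<^sub>R 1"
          using bop_power_decay[OF K] by auto
        ultimately show "H * z \<le> (1 / (real n + 1)) *\<^sub>R 1"
          using bop_commuting_mult_mono[OF CD(3)[OF yC], of "(1 - K) * K ^ n"] by simp
      qed
      finally show ?thesis .
    qed
    then have "- \<phi> (a * K) \<le> 0" by (rule bounded_by_fractions)
    then show ?thesis using inc[OF a] by (simp add: step)
  qed
  have zero: "\<phi> a = 0" if a: "a \<in> C" for a
    using zero_H[OF a] zero_1H[OF a] \<phi>_diff[of a "a * H"] CD(1)[OF a] H(1) by (simp add: N.closed_ops)
  have "\<psi> ((x - H) * a) = 0" if "a \<in> N" for a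
    using that
  proof (rule N_induct_C)
    fix a assume a: "a \<in> C"
    have "cnj (\<psi> ((x - H) * a)) = \<psi> ((x - H) * a)"
      using fstar[of "(x - H) * a"] central[OF CD(1)[OF a], of "x - H"] x H CD[OF a]
      by (simp add: closed_ops)
    then show "\<psi> ((x - H) * a) = 0" using zero[OF a] by (simp add: \<phi>_def complex_eq_iff)
  next
    fix a b assume "a \<in> N" "b \<in> N" "\<psi> ((x - H) * a) = 0" "\<psi> ((x - H) * b) = 0"
    then show "\<psi> ((x - H) * (a + b)) = 0"
      using NM x H by (simp add: distrib_left fadd closed_ops)
  next
    fix c a assume "a \<in> N" "\<psi> ((x - H) * a) = 0"
    then show "\<psi> ((x - H) * csc c a) = 0"
      using NM x H by (simp add: csc_simps fcsc closed_ops)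
  qed
  then have "\<psi> (H * a) = \<psi> (x * a)" if "a \<in> N" for a
    using that NM x H by (simp add: left_diff_distrib fdiff closed_ops)
  with HC show ?thesis by (rule that)
qed

end

section \<open>The conditional expectation\<close>

context central_subalgebra
begin

text \<open>The Radon-Nikodym density, relative to \<psi> on \<open>N\<close>, of the functional
  that sends \<open>a\<close> to \<open>\<psi> (x * a)\<close>.\<close>

definition cond :: "'a bop \<Rightarrow> 'a bop"
  where "cond x = (THE h. h \<in> N \<and> (\<forall>a\<in>N. \<psi> (h * a) = \<psi> (x * a)))"

lemma f_mult_le:
  assumes "x \<in> M" "x \<le> 1" "a \<in> N" "0 \<le> a" shows "f (x * a) \<le> f a"
proof -
  have "x \<le> 1 *\<^sub>R e" using assms by (intro le_unit) auto
  then have "0 \<le> f ((e - x) * a)" using assms by (intro f_mult_pos closed_ops) auto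
  then show ?thesis
    using assms NM N.unit_mult by (simp add: left_diff_distrib fdiff closed_ops)
qed

text \<open>Applying \<open>radon_nikodym\<close> to the element itself, scaled below 1, yields a
  positive density; testing the difference against itself shows that the two agree. This takes the
  place of cutting \<open>z\<close> with its negative part.\<close>

lemma pos_if_f_mult_pos:
  assumes z: "z \<in> N" "star z = z" and pos: "\<And>a. a \<in> N \<Longrightarrow> 0 \<le> a \<Longrightarrow> 0 \<le> f (z * a)"
  shows "0 \<le> z"
proof -
  obtain c where c: "0 < c" "z \<le> c *\<^sub>R 1" using selfadjoint_bounded[OF z(2)] by blast
  define y where "y = inverse c *\<^sub>R z"
  have yN: "y \<in> N" "star y = y" using z by (auto simp: y_def N.scaleR)
  have y1: "y \<le> 1" using scaleR_left_mono[OF c(2), of "inverse c"] c(1) by (simp add: y_def)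
  obtain H where H: "H \<in> C" "\<And>a. a \<in> N \<Longrightarrow> \<psi> (H * a) = \<psi> (y * a)"
  proof (rule radon_nikodym[OF NM[OF yN(1)] yN(2)])
    show "0 \<le> f (y * a)" if "a \<in> N" "0 \<le> a" for a
      using pos[OF that] c(1) NM[OF that(1)] NM[OF z(1)] by (simp add: y_def fscaleR mult)
    show "f (y * a) \<le> f a" if "a \<in> N" "0 \<le> a" for a
      using f_mult_le[OF NM[OF yN(1)] y1 that] .
  qed blast
  have "\<psi> ((y - H) * (y - H)) = 0"
    using H(2)[of "y - H"] yN CD[OF H(1)] NM
    by (simp add: left_diff_distrib fdiff closed_ops N.closed_ops)
  moreover have "0 \<le> (y - H) * (y - H)" using yN CD(5)[OF H(1)] by (intro bop_square_pos) simp
  ultimately have "(y - H) * (y - H) = 0"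
    using yN CD[OF H(1)] NM by (intro faithful closed_ops) auto
  then have "star (y - H) * (y - H) = 0" by (simp only: star_simps yN(2) CD(5)[OF H(1)])
  then have "y - H = 0" by (rule star_mult_eq_zero)
  then have "0 \<le> y" using CD(2)[OF H(1)] by simp
  then have "0 \<le> c *\<^sub>R y" using c(1) by (intro scaleR_nonneg_nonneg) auto
  then show ?thesis using c(1) by (simp add: y_def)
qed

lemma N_eqI:
  assumes "g \<in> N" "h \<in> N" "\<And>a. a \<in> N \<Longrightarrow> \<psi> (g * a) = \<psi> (h * a)" shows "g = h"
proof -
  define z where "z = g - h"
  have zN: "z \<in> N" using assms by (simp add: z_def N.diff)
  have "\<psi> (z * star z) = 0"
    using assms(3)[of "star z"] assms(1,2) zN NM
    by (simp add: z_def left_diff_distrib fdiff closed_ops N.closed_ops)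
  then have "\<psi> (star z * z) = 0" using comm[OF zN N.star[OF zN]] by simp
  then have "star z * z = 0"
    using NM[OF zN] by (intro faithful bop_star_mult_pos closed_ops)
  then have "z = 0" by (rule star_mult_eq_zero)
  then show ?thesis by (simp add: z_def)
qed

lemma density_exists_C:
  assumes "x \<in> M" "0 \<le> x" "x \<le> 1"
  obtains h where "h \<in> C" "\<And>a. a \<in> N \<Longrightarrow> \<psi> (h * a) = \<psi> (x * a)"
  using radon_nikodym[OF assms(1) bop_pos_star[OF assms(2)]] f_mult_pos[OF assms(1,2)]
    f_mult_le[OF assms(1,3)] by blast

lemma density_exists:
  assumes x: "x \<in> M" shows "\<exists>h\<in>N. \<forall>a\<in>N. \<psi> (h * a) = \<psi> (x * a)"
proof -
  have sa: "\<exists>h\<in>N. \<forall>a\<in>N. \<psi> (h * a) = \<psi> (x * a)" if x: "x \<in> M" "star x = x" for x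
  proof -
    obtain c y where y: "y \<in> M" "0 \<le> y" "y \<le> 1" "x = (2 * c) *\<^sub>R y - c *\<^sub>R e"
      using selfadjoint_affine[OF x] by blast
    obtain h where h: "h \<in> C" "\<And>a. a \<in> N \<Longrightarrow> \<psi> (h * a) = \<psi> (y * a)"
      using density_exists_C[OF y(1-3)] by blast
    have "\<psi> (((2 * c) *\<^sub>R h - c *\<^sub>R e) * a) = \<psi> (x * a)" if "a \<in> N" for a
      using h(2)[OF that] CD(4)[OF h(1)] y(1) NM[OF that]
      by (simp add: y(4) left_diff_distrib fdiff fscaleR closed_ops)
    then show ?thesis using CD(1)[OF h(1)] by (intro bexI[of _ "(2 * c) *\<^sub>R h - c *\<^sub>R e"]) (auto intro: N.closed_ops)
  qed
  obtain u v where uv: "u \<in> M" "v \<in> M" "star u = u" "star v = v" "x = u + csc \<i> v"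
    using selfadjoint_decomposition[OF x] by blast
  obtain g h where g: "g \<in> N" "\<And>a. a \<in> N \<Longrightarrow> \<psi> (g * a) = \<psi> (u * a)"
    and h: "h \<in> N" "\<And>a. a \<in> N \<Longrightarrow> \<psi> (h * a) = \<psi> (v * a)"
    using sa[OF uv(1,3)] sa[OF uv(2,4)] by blast
  have "\<psi> ((g + csc \<i> h) * a) = \<psi> (x * a)" if "a \<in> N" for a
    using g h uv(1,2) that NM by (simp add: uv(5) distrib_right csc_simps fadd fcsc closed_ops)
  then show ?thesis using g(1) h(1) by (intro bexI[of _ "g + csc \<i> h"]) (auto intro: N.closed_ops)
qed

lemma cond_unique:
  assumes "x \<in> M" "h \<in> N" "\<And>a. a \<in> N \<Longrightarrow> \<psi> (h * a) = \<psi> (x * a)" shows "cond x = h"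
  unfolding cond_def
proof (rule the_equality)
  fix g assume "g \<in> N \<and> (\<forall>a\<in>N. \<psi> (g * a) = \<psi> (x * a))"
  then show "g = h" using assms by (intro N_eqI) auto
qed (use assms in blast)

lemma
  assumes "x \<in> M"
  shows cond_in: "cond x \<in> N" and f_cond_mult: "\<And>a. a \<in> N \<Longrightarrow> \<psi> (cond x * a) = \<psi> (x * a)"
proof -
  obtain h where h: "h \<in> N" "\<And>a. a \<in> N \<Longrightarrow> \<psi> (h * a) = \<psi> (x * a)"
    using density_exists[OF assms] by blast
  with cond_unique[OF assms h] show "cond x \<in> N" "\<And>a. a \<in> N \<Longrightarrow> \<psi> (cond x * a) = \<psi> (x * a)"
    by auto
qed

lemma f_cond: "x \<in> M \<Longrightarrow> \<psi> (cond x) = \<psi> x"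
  using f_cond_mult[of x e] by (simp add: N.unit N.unit_mult unit_mult cond_in)

lemma cond_add: "x \<in> M \<Longrightarrow> y \<in> M \<Longrightarrow> cond (x + y) = cond x + cond y"
  by (rule cond_unique)
    (auto simp: distrib_right fadd mult NM cond_in f_cond_mult intro: add N.add)

lemma cond_csc: "x \<in> M \<Longrightarrow> cond (csc c x) = csc c (cond x)"
  by (rule cond_unique) (auto simp: csc_simps fcsc mult NM cond_in f_cond_mult intro: csc N.csc)

lemma cond_scaleR: "x \<in> M \<Longrightarrow> cond (r *\<^sub>R x) = r *\<^sub>R cond x"
  using cond_csc[of x "of_real r"] by (simp add: csc_simps)

lemma cond_diff: "x \<in> M \<Longrightarrow> y \<in> M \<Longrightarrow> cond (x - y) = cond x - cond y"
  using cond_add[of x "- y"] cond_scaleR[of y "-1"] minus[of y] by simp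

lemma cond_id: "a \<in> N \<Longrightarrow> cond a = a"
  by (rule cond_unique) (auto intro: NM)

text \<open>Inside \<psi>, centrality carries the left factor around to the right end, where the
  defining property of \<open>cond\<close> takes \<open>b * c * a\<close> as a single element of
  \<open>N\<close>.\<close>

lemma cond_bimodule:
  assumes "a \<in> N" "b \<in> N" "x \<in> M" shows "cond (a * x * b) = a * cond x * b"
proof (rule cond_unique)
  fix c assume c: "c \<in> N"
  have M: "a \<in> M" "b \<in> M" "c \<in> M" using assms c NM by auto
  have "\<psi> (a * cond x * b * c) = \<psi> (cond x * (b * c * a))"
    using central[of a "cond x * b * c"] assms c M NM[OF cond_in[OF assms(3)]]
    by (simp add: mult.assoc closed_ops)
  also have "\<dots> = \<psi> (x * (b * c * a))" using assms c by (intro f_cond_mult N.closed_ops)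
  also have "\<dots> = \<psi> (a * x * b * c)"
    using central[of a "x * b * c"] assms c M by (simp add: mult.assoc closed_ops)
  finally show "\<psi> (a * cond x * b * c) = \<psi> (a * x * b * c)" .
qed (use assms NM cond_in in \<open>auto intro: closed_ops N.closed_ops\<close>)

lemma cond_star: assumes x: "x \<in> M" shows "cond (star x) = star (cond x)"
proof (rule cond_unique)
  fix a assume a: "a \<in> N"
  have "\<psi> (star (cond x) * a) = cnj (\<psi> (star a * cond x))"
    using fstar[of "star a * cond x"] NM[OF a] NM[OF cond_in[OF x]] by (simp add: closed_ops)
  also have "\<dots> = cnj (\<psi> (cond x * star a))"
    using central[OF N.star[OF a] NM[OF cond_in[OF x]]] by simp
  also have "\<dots> = cnj (\<psi> (x * star a))" by (simp add: f_cond_mult[OF x N.star[OF a]])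
  also have "\<dots> = cnj (\<psi> (star a * x))" using central[OF N.star[OF a] x] by simp
  also have "\<dots> = \<psi> (star x * a)"
    using fstar[of "star a * x"] NM[OF a] x by (simp add: closed_ops)
  finally show "\<psi> (star (cond x) * a) = \<psi> (star x * a)" .
qed (use x cond_in in \<open>auto intro: star N.star\<close>)

lemma cond_pos: assumes x: "x \<in> M" "0 \<le> x" shows "0 \<le> cond x"
proof (rule pos_if_f_mult_pos)
  show "star (cond x) = cond x" using cond_star[OF x(1)] bop_pos_star[OF x(2)] by simp
  show "0 \<le> f (cond x * a)" if "a \<in> N" "0 \<le> a" for a
    using f_mult_pos[OF x that] f_cond_mult[OF x(1) that(1)] by simp
qed (rule cond_in[OF x(1)])

lemma cond_mono: "x \<in> M \<Longrightarrow> y \<in> M \<Longrightarrow> x \<le> y \<Longrightarrow> cond x \<le> cond y"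
  using cond_pos[of "y - x"] by (simp add: cond_diff diff)

lemma cond_kadison_schwarz:
  assumes x: "x \<in> M" shows "star (cond x) * cond x \<le> cond (star x * x)"
proof -
  define h where "h = cond x"
  have hN: "h \<in> N" "star h \<in> N" "h \<in> M" "star h \<in> M"
    using cond_in[OF x] NM by (auto simp: h_def intro: N.star)
  have "0 \<le> cond (star (x - h) * (x - h))"
    using x hN by (intro cond_pos bop_star_mult_pos closed_ops)
  \<comment> \<open>The units \<open>e\<close> are inserted so that each cross term has the
    two-sided form of \<open>cond_bimodule\<close>.\<close>
  also have "star (x - h) * (x - h) = star x * x - e * star x * h - star h * x * e + star h * h * e"
    using x hN by (simp add: algebra_simps unit_mult closed_ops flip: mult.assoc)
  also have "cond \<dots> = cond (star x * x) - cond (e * star x * h) - cond (star h * x * e) + cond (star h * h * e)"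
    using x hN by (simp add: cond_add cond_diff closed_ops unit)
  also have "\<dots> = cond (star x * x) - star h * h"
  proof -
    have "cond (e * star x * h) = star h * h"
      using cond_bimodule[OF N.unit hN(1) star[OF x]] N.unit_mult(1)[OF hN(2)]
      by (simp add: cond_star[OF x] h_def[symmetric])
    moreover have "cond (star h * x * e) = star h * h"
      using cond_bimodule[OF hN(2) N.unit x] N.unit_mult(2)[OF hN(1)]
      by (simp add: mult.assoc h_def[symmetric])
    moreover have "cond (star h * h * e) = star h * h"
      using hN N.unit_mult(2)[OF hN(1)] by (simp add: mult.assoc cond_id N.mult)
    ultimately show ?thesis by simp
  qed
  finally show ?thesis by (simp add: h_def)
qed

lemma cond_norm:
  assumes x: "x \<in> M" and c: "star x * x \<le> c *\<^sub>R 1" "0 \<le> c" shows "star (cond x) * cond x \<le> c *\<^sub>R 1"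
proof -
  have "star (cond x) * cond x \<le> cond (star x * x)" by (rule cond_kadison_schwarz[OF x])
  also have "\<dots> \<le> cond (c *\<^sub>R e)"
    using x c by (intro cond_mono le_unit closed_ops)
  also have "\<dots> = c *\<^sub>R e" by (rule cond_id) (intro N.closed_ops)
  also have "\<dots> \<le> c *\<^sub>R 1" by (rule scaleR_left_mono[OF unit_le_one c(2)])
  finally show ?thesis .
qed

text \<open>An upper bound \<open>y\<close> in \<open>N\<close> is compared with
  \<open>cond x\<close> by testing against \<open>a \<ge> 0\<close>. As \<open>a\<close> is at most
  c e, replacing \<open>x\<close> by \<open>d\<close> costs at most c (\<psi>(x) - \<psi>(d)), which
  normality of \<psi> makes arbitrarily small.\<close>

lemma cond_normal:
  assumes D: "D \<subseteq> {x\<in>M. star x = x}" "upward_directed D" and lub: "is_lub_in M D x"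
  shows "is_lub_in N (cond ` D) (cond x)"
  unfolding is_lub_in_def
proof (intro conjI ballI impI)
  have x: "x \<in> M" "star x = x" "\<And>d. d \<in> D \<Longrightarrow> d \<le> x" using lub by (auto simp: is_lub_in_def)
  have dM: "d \<in> M" "star d = d" if "d \<in> D" for d using D(1) that by auto
  show cx: "cond x \<in> N" "star (cond x) = cond x"
    using cond_in[OF x(1)] cond_star[OF x(1)] x(2) by auto
  show "d \<le> cond x" if "d \<in> cond ` D" for d
    using that x dM by (auto intro: cond_mono)
  fix y assume y: "y \<in> N" "star y = y" "\<forall>d\<in>cond ` D. d \<le> y"
  have "0 \<le> y - cond x"
  proof (rule pos_if_f_mult_pos)
    fix a assume a: "a \<in> N" "0 \<le> a"
    obtain c where c: "0 < c" "a \<le> c *\<^sub>R 1"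
      using selfadjoint_bounded[OF bop_pos_star[OF a(2)]] by blast
    have le: "- (c * (f x - f d)) \<le> f ((y - cond x) * a)" if d: "d \<in> D" for d
    proof -
      have "0 \<le> f ((y - cond d) * a)"
        using y(1,3) d dM[OF d] a cond_in NM by (intro f_mult_pos closed_ops) auto
      moreover have "f ((y - cond d) * a) = f ((y - cond x) * a) + f ((x - d) * a)"
        using y(1) d dM[OF d] a(1) cond_in NM x(1) f_cond_mult
        by (simp add: left_diff_distrib fdiff closed_ops)
      moreover have "f ((x - d) * a) \<le> c * (f x - f d)"
      proof -
        have "a \<le> c *\<^sub>R e" by (rule N.le_unit[OF a(1) c(2)])
        then have "0 \<le> f ((x - d) * (c *\<^sub>R e - a))"
          using x d dM[OF d] a(1) by (intro f_mult_pos closed_ops N.closed_ops) auto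
        then show ?thesis using x(1) dM[OF d] NM[OF a(1)]
          by (simp add: right_diff_distrib fdiff fscaleR closed_ops unit_mult)
      qed
      ultimately show ?thesis by linarith
    qed
    show "0 \<le> f ((y - cond x) * a)"
    proof (rule ccontr)
      assume neg: "\<not> 0 \<le> f ((y - cond x) * a)"
      define \<epsilon> where "\<epsilon> = - f ((y - cond x) * a) / c"
      have \<epsilon>: "0 < \<epsilon>" using neg c(1) by (simp add: \<epsilon>_def divide_neg_pos)
      have "f x - \<epsilon> < (SUP d\<in>D. f d)" using normal[OF D lub] \<epsilon> by simp
      moreover have "bdd_above (f ` D)"
        using x dM by (auto intro!: bdd_aboveI2[of _ _ "f x"] fmono)
      moreover have "D \<noteq> {}" using D(2) by (simp add: upward_directed_def)
      ultimately obtain d where d: "d \<in> D" "f x - \<epsilon> < f d" by (auto simp: less_cSUP_iff)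
      then have "c * (f x - f d) < c * \<epsilon>" using c(1) by simp
      then show False using le[OF d(1)] c(1) by (simp add: \<epsilon>_def)
    qed
  qed (use y cx in \<open>auto intro: N.diff\<close>)
  then show "cond x \<le> y" by simp
qed

end

section \<open>Complete positivity of the expectation\<close>

definition positive_matrix :: "nat \<Rightarrow> (nat \<Rightarrow> nat \<Rightarrow> 'a::complex_hilbert_space bop) \<Rightarrow> bool"
  where "positive_matrix n X \<longleftrightarrow>
    (\<forall>\<xi>. (\<Sum>i<n. \<Sum>j<n. cinner (\<xi> i) (app (X i j) (\<xi> j))) \<in> \<real>\<^sub>\<ge>\<^sub>0)"

lemma cinner_sum_right: "cinner x (sum g A) = (\<Sum>i\<in>A. cinner x (g i))"
  by (induction A rule: infinite_finite_induct) (auto simp: cinner_add_right)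

context central_subalgebra
begin

lemma cond_sum: "finite I \<Longrightarrow> (\<And>i. i \<in> I \<Longrightarrow> x i \<in> M) \<Longrightarrow> cond (\<Sum>i\<in>I. x i) = (\<Sum>i\<in>I. cond (x i))"
  by (induction I rule: finite_induct) (auto simp: cond_add sum cond_id N.zero)

text \<open>Over a common vector \<eta> the entries combine into one positive operator
  \<open>Z\<close> of \<open>M\<close>, and the bimodule property lets \<open>cond\<close> pass into
  the combination. So plain positivity of \<open>cond\<close> suffices here.\<close>

lemma cond_matrix_cyclic:
  assumes X: "\<And>i j. i < n \<Longrightarrow> j < n \<Longrightarrow> X i j \<in> M" and pos: "positive_matrix n X"
    and a: "\<And>i. a i \<in> N"
  shows "(\<Sum>i<n. \<Sum>j<n. cinner (app (a i) \<eta>) (app (cond (X i j)) (app (a j) \<eta>))) \<in> \<real>\<^sub>\<ge>\<^sub>0"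
proof -
  define Z where "Z = (\<Sum>i<n. \<Sum>j<n. star (a i) * X i j * a j)"
  have ZM: "Z \<in> M" unfolding Z_def using X a NM by (intro sum closed_ops) auto
  have "0 \<le> Z"
    unfolding bop_le_iff
  proof
    fix \<xi>
    have "cinner \<xi> (app (Z - 0) \<xi>) = (\<Sum>i<n. \<Sum>j<n. cinner (app (a i) \<xi>) (app (X i j) (app (a j) \<xi>)))"
      by (simp add: Z_def app_sum cinner_sum_right cinner_star_right)
    also have "\<dots> \<in> \<real>\<^sub>\<ge>\<^sub>0"
      using pos unfolding positive_matrix_def by (rule allE[where x = "\<lambda>i. app (a i) \<xi>"])
    finally show "cinner \<xi> (app (Z - 0) \<xi>) \<in> \<real>\<^sub>\<ge>\<^sub>0" .
  qed
  then have "0 \<le> cond Z" by (rule cond_pos[OF ZM])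
  moreover have "cond Z = (\<Sum>i<n. \<Sum>j<n. star (a i) * cond (X i j) * a j)"
  proof -
    have T: "star (a i) * X i j * a j \<in> M" if "i < n" "j < n" for i j
      using X[OF that] NM[OF a] by (intro closed_ops)
    have "cond Z = (\<Sum>i<n. cond (\<Sum>j<n. star (a i) * X i j * a j))"
      unfolding Z_def by (rule cond_sum) (auto intro!: sum T)
    also have "\<dots> = (\<Sum>i<n. \<Sum>j<n. cond (star (a i) * X i j * a j))"
      by (intro sum.cong refl cond_sum) (auto intro: T)
    also have "\<dots> = (\<Sum>i<n. \<Sum>j<n. star (a i) * cond (X i j) * a j)"
      by (intro sum.cong refl cond_bimodule) (auto intro: N.star a X)
    finally show ?thesis .
  qed
  ultimately have "cinner \<eta> (app (\<Sum>i<n. \<Sum>j<n. star (a i) * cond (X i j) * a j) \<eta>) \<in> \<real>\<^sub>\<ge>\<^sub>0"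
    by (simp add: bop_le_iff)
  then show ?thesis by (simp add: app_sum cinner_sum_right cinner_star_right)
qed

text \<open>The cyclic subspace generated by \<eta>. It is handled as a real subspace, since the
  projection theorem above is real; invariance under multiplication by \<open>\<i>\<close> comes
  from the element \<open>csc \<i> e\<close>.\<close>

definition orbit where "orbit \<eta> = closure ((\<lambda>a. app a \<eta>) ` N)"

lemma orbit_subspace: "subspace (orbit \<eta>)" "closed (orbit \<eta>)"
proof -
  show "closed (orbit \<eta>)" by (simp add: orbit_def)
  have seq: "\<exists>a. (\<forall>n. a n \<in> N) \<and> (\<lambda>n. app (a n) \<eta>) \<longlonglongrightarrow> \<kappa>" if \<kappa>: "\<kappa> \<in> orbit \<eta>" for \<kappa>
  proof -
    obtain x where x: "\<forall>n. x n \<in> (\<lambda>a. app a \<eta>) ` N" "x \<longlonglongrightarrow> \<kappa>"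
      using \<kappa> by (auto simp: orbit_def closure_sequential)
    from x(1) have "\<forall>n. \<exists>a. a \<in> N \<and> x n = app a \<eta>" by blast
    then obtain a where a: "\<And>n. a n \<in> N" "\<And>n. x n = app (a n) \<eta>" by metis
    then have "x = (\<lambda>n. app (a n) \<eta>)" by auto
    then show ?thesis using a(1) x(2) by blast
  qed
  have mem: "\<kappa> \<in> orbit \<eta>" if "\<And>n. a n \<in> N" "(\<lambda>n. app (a n) \<eta>) \<longlonglongrightarrow> \<kappa>" for a \<kappa>
    unfolding orbit_def closure_sequential using that by (intro exI[of _ "\<lambda>n. app (a n) \<eta>"]) auto
  show "subspace (orbit \<eta>)"
    unfolding subspace_def
  proof (intro conjI ballI allI)
    show "0 \<in> orbit \<eta>" by (rule mem[of "\<lambda>_. 0"]) (auto intro: N.zero)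
  next
    fix x y assume xy: "x \<in> orbit \<eta>" "y \<in> orbit \<eta>"
    obtain a where a: "\<forall>n. a n \<in> N" "(\<lambda>n. app (a n) \<eta>) \<longlonglongrightarrow> x" using seq[OF xy(1)] by blast
    obtain b where b: "\<forall>n. b n \<in> N" "(\<lambda>n. app (b n) \<eta>) \<longlonglongrightarrow> y" using seq[OF xy(2)] by blast
    show "x + y \<in> orbit \<eta>"
      by (rule mem[of "\<lambda>n. a n + b n"]) (use a b in \<open>auto intro: N.add tendsto_add\<close>)
  next
    fix c x assume x: "x \<in> orbit \<eta>"
    obtain a where a: "\<forall>n. a n \<in> N" "(\<lambda>n. app (a n) \<eta>) \<longlonglongrightarrow> x" using seq[OF x] by blast
    show "c *\<^sub>R x \<in> orbit \<eta>"
      by (rule mem[of "\<lambda>n. c *\<^sub>R a n"]) (use a in \<open>auto intro: N.scaleR tendsto_scaleR\<close>)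
  qed
qed

lemma orbit_invariant:
  assumes b: "b \<in> N" and \<kappa>: "\<kappa> \<in> orbit \<eta>" shows "app b \<kappa> \<in> orbit \<eta>"
proof -
  obtain x where x: "\<And>n. x n \<in> (\<lambda>a. app a \<eta>) ` N" "x \<longlonglongrightarrow> \<kappa>"
    using \<kappa> by (auto simp: orbit_def closure_sequential)
  have "app b (x n) \<in> (\<lambda>a. app a \<eta>) ` N" for n
    using x(1)[of n] b N.mult by (auto simp flip: app_simps(6))
  then show ?thesis
    using tendsto_app[OF x(2), of b] unfolding orbit_def closure_sequential
    by (intro exI[of _ "\<lambda>n. app b (x n)"]) auto
qed

lemma orbit_unit: "\<kappa> \<in> orbit \<eta> \<Longrightarrow> app e \<kappa> = \<kappa>"
proof -
  assume "\<kappa> \<in> orbit \<eta>"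
  then obtain x where x: "\<And>n. x n \<in> (\<lambda>a. app a \<eta>) ` N" "x \<longlonglongrightarrow> \<kappa>"
    by (auto simp: orbit_def closure_sequential)
  have "app e (x n) = x n" for n
    using x(1)[of n] N.unit_mult(1) by (auto simp flip: app_simps(6))
  then have "x \<longlonglongrightarrow> app e \<kappa>" using tendsto_app[OF x(2), of e] by simp
  then show ?thesis using x(2) by (rule LIMSEQ_unique)
qed

lemma orbit_generator: "app e \<eta> = \<eta> \<Longrightarrow> \<eta> \<in> orbit \<eta>"
  unfolding orbit_def using N.unit closure_subset by (metis (no_types, lifting) image_eqI subsetD)

lemma orbit_orthogonal:
  assumes \<beta>: "\<And>\<kappa>. \<kappa> \<in> orbit \<eta> \<Longrightarrow> inner \<beta> \<kappa> = 0" and \<kappa>: "\<kappa> \<in> orbit \<eta>"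
  shows "cinner \<beta> \<kappa> = 0" "cinner \<kappa> \<beta> = 0"
proof -
  have "app (csc \<i> e) \<kappa> \<in> orbit \<eta>" by (intro orbit_invariant N.closed_ops \<kappa>)
  then have "\<i> *\<^sub>C \<kappa> \<in> orbit \<eta>" using orbit_unit[OF \<kappa>] by simp
  then show "cinner \<beta> \<kappa> = 0" using \<beta> \<kappa> by (simp add: complex_eq_iff Re_cinner Im_cinner)
  then show "cinner \<kappa> \<beta> = 0" by (metis cinner_commute complex_cnj_zero)
qed

lemma cond_matrix_orbit:
  assumes X: "\<And>i j. i < n \<Longrightarrow> j < n \<Longrightarrow> X i j \<in> M" and pos: "positive_matrix n X"
    and \<xi>: "\<And>i. i < n \<Longrightarrow> \<xi> i \<in> orbit \<eta>"
  shows "(\<Sum>i<n. \<Sum>j<n. cinner (\<xi> i) (app (cond (X i j)) (\<xi> j))) \<in> \<real>\<^sub>\<ge>\<^sub>0"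
proof -
  have "\<exists>a. (\<forall>k. a k \<in> N) \<and> (i < n \<longrightarrow> (\<lambda>k. app (a k) \<eta>) \<longlonglongrightarrow> \<xi> i)" for i
  proof (cases "i < n")
    case True
    then obtain x where x: "\<And>n. x n \<in> (\<lambda>a. app a \<eta>) ` N" "x \<longlonglongrightarrow> \<xi> i"
      using \<xi>[OF True] by (auto simp: orbit_def closure_sequential)
    from x(1) have "\<forall>k. \<exists>a. a \<in> N \<and> x k = app a \<eta>" by blast
    then obtain a where a: "\<And>k. a k \<in> N" "\<And>k. x k = app (a k) \<eta>" by metis
    then have "x = (\<lambda>k. app (a k) \<eta>)" by auto
    then show ?thesis using a(1) x(2) by blast
  qed (use N.zero in auto)
  then obtain a where a: "\<And>i k. a i k \<in> N" "\<And>i. i < n \<Longrightarrow> (\<lambda>k. app (a i k) \<eta>) \<longlonglongrightarrow> \<xi> i"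
    by metis
  define S where "S k = (\<Sum>i<n. \<Sum>j<n. cinner (app (a i k) \<eta>) (app (cond (X i j)) (app (a j k) \<eta>)))" for k
  have "S
      \<longlonglongrightarrow> (\<Sum>i<n. \<Sum>j<n. cinner (\<xi> i) (app (cond (X i j)) (\<xi> j)))"
    unfolding S_def by (intro tendsto_sum tendsto_cinner tendsto_app a(2)) auto
  moreover have "S k \<in> \<real>\<^sub>\<ge>\<^sub>0" for k
    unfolding S_def by (rule cond_matrix_cyclic[of n X "\<lambda>i. a i k", OF X pos a(1)])
  ultimately show ?thesis
    using closed_sequentially[OF closed_nonneg_Reals_complex, of S] by blast
qed

text \<open>The ranges of the projections onto \<open>orbit \<eta>\<close> reduce \<open>N\<close>, so the quadratic form splits along
  them, and each orthogonal splitting annihilates one more component of \<open>\<xi>\<close>.\<close>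

lemma cond_matrix_unit:
  assumes X: "\<And>i j. i < n \<Longrightarrow> j < n \<Longrightarrow> X i j \<in> M" and pos: "positive_matrix n X"
    and \<xi>: "\<And>i. i < n \<Longrightarrow> app e (\<xi> i) = \<xi> i"
  shows "(\<Sum>i<n. \<Sum>j<n. cinner (\<xi> i) (app (cond (X i j)) (\<xi> j))) \<in> \<real>\<^sub>\<ge>\<^sub>0"
  using \<xi>
proof (induction "card {i. i < n \<and> \<xi> i \<noteq> 0}" arbitrary: \<xi> rule: less_induct)
  case less
  show ?case
  proof (cases "\<forall>i<n. \<xi> i = 0")
    case True
    then show ?thesis by simp
  next
    case False
    then obtain i0 where i0: "i0 < n" "\<xi> i0 \<noteq> 0" by blast
    define \<eta> where "\<eta> = \<xi> i0"
    have "\<exists>y. y \<in> orbit \<eta> \<and> (\<forall>\<kappa>\<in>orbit \<eta>. inner (\<xi> i - y) \<kappa> = 0)" for i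
      using orthogonal_decomposition[OF orbit_subspace, of \<eta> "\<xi> i"] by metis
    then obtain \<alpha> where \<alpha>: "\<And>i. \<alpha> i \<in> orbit \<eta>"
      and orth: "\<And>i \<kappa>. \<kappa> \<in> orbit \<eta> \<Longrightarrow> inner (\<xi> i - \<alpha> i) \<kappa> = 0"
      by metis
    define \<beta> where "\<beta> i = \<xi> i - \<alpha> i" for i
    have \<beta>_zero: "\<beta> i = 0" if "\<xi> i \<in> orbit \<eta>" for i
    proof -
      have "\<beta> i \<in> orbit \<eta>" using that \<alpha> orbit_subspace(1) by (simp add: \<beta>_def subspace_diff)
      then have "inner (\<beta> i) (\<beta> i) = 0" using orth by (simp add: \<beta>_def)
      then show ?thesis by simp
    qed
    \<comment> \<open>Both \<open>y\<close> and \<open>star y\<close> leave the orbit invariant,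
      hence \<open>y\<close> leaves its orthogonal complement invariant as well.\<close>
    have cross: "cinner (\<alpha> i) (app y (\<beta> j)) = 0" "cinner (\<beta> i) (app y (\<alpha> j)) = 0" if "y \<in> N" for i j y
    proof -
      have o: "\<And>\<kappa>. \<kappa> \<in> orbit \<eta> \<Longrightarrow> inner (\<beta> i) \<kappa> = 0" for i using orth by (simp add: \<beta>_def)
      have "app (star y) (\<alpha> i) \<in> orbit \<eta>" by (intro orbit_invariant N.star that \<alpha>)
      then have "cinner (app (star y) (\<alpha> i)) (\<beta> j) = 0"
        by (intro orbit_orthogonal(2)[of \<eta> "\<beta> j"] o)
      then show "cinner (\<alpha> i) (app y (\<beta> j)) = 0" by (simp add: cinner_star_left)
      show "cinner (\<beta> i) (app y (\<alpha> j)) = 0"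
        by (intro orbit_orthogonal(1)[of \<eta> "\<beta> i"] o orbit_invariant[OF that \<alpha>])
    qed
    have split: "cinner (\<xi> i) (app (cond (X i j)) (\<xi> j))
        = cinner (\<alpha> i) (app (cond (X i j)) (\<alpha> j)) + cinner (\<beta> i) (app (cond (X i j)) (\<beta> j))"
      if "i < n" "j < n" for i j
    proof -
      have "\<xi> i = \<alpha> i + \<beta> i" "\<xi> j = \<alpha> j + \<beta> j" by (auto simp: \<beta>_def)
      then show ?thesis using cross[OF cond_in[OF X[OF that]]]
        by (simp add: app_linear cinner_add_left cinner_add_right)
    qed
    have zero_orbit: "0 \<in> orbit \<eta>" by (rule subspace_0[OF orbit_subspace(1)])
    \<comment> \<open>The component that generates the orbit is absorbed by it, and zero components
      stay zero, so the remainder \<beta> has fewer nonzero components.\<close>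
    have "\<eta> \<in> orbit \<eta>" using less.prems[OF i0(1)] by (intro orbit_generator) (simp add: \<eta>_def)
    then have "\<beta> i0 = 0" by (intro \<beta>_zero) (simp add: \<eta>_def)
    moreover have "\<beta> i = 0" if "\<xi> i = 0" for i using that zero_orbit \<beta>_zero by simp
    ultimately have "{i. i < n \<and> \<beta> i \<noteq> 0} \<subset> {i. i < n \<and> \<xi> i \<noteq> 0}" using i0 by blast
    then have "card {i. i < n \<and> \<beta> i \<noteq> 0} < card {i. i < n \<and> \<xi> i \<noteq> 0}"
      by (intro psubset_card_mono) auto
    moreover have "app e (\<beta> i) = \<beta> i" if "i < n" for i
      using less.prems[OF that] orbit_unit[OF \<alpha>[of i]] by (simp add: \<beta>_def app_linear)
    ultimately have "(\<Sum>i<n. \<Sum>j<n. cinner (\<beta> i) (app (cond (X i j)) (\<beta> j))) \<in> \<real>\<^sub>\<ge>\<^sub>0"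
      by (rule less.hyps)
    moreover have "(\<Sum>i<n. \<Sum>j<n. cinner (\<alpha> i) (app (cond (X i j)) (\<alpha> j))) \<in> \<real>\<^sub>\<ge>\<^sub>0"
      by (rule cond_matrix_orbit[OF X pos \<alpha>])
    ultimately have "(\<Sum>i<n. \<Sum>j<n. cinner (\<alpha> i) (app (cond (X i j)) (\<alpha> j)))
        + (\<Sum>i<n. \<Sum>j<n. cinner (\<beta> i) (app (cond (X i j)) (\<beta> j))) \<in> \<real>\<^sub>\<ge>\<^sub>0"
      by (intro nonneg_Reals_add_I)
    then show ?thesis by (simp add: split flip: sum.distrib)
  qed
qed

text \<open>The values of \<open>cond\<close> are compressed by \<open>e\<close>, so each vector may
  be replaced by its image under \<open>e\<close>; such vectors lie in their own orbits.\<close>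

lemma cond_completely_positive:
  assumes X: "\<And>i j. i < n \<Longrightarrow> j < n \<Longrightarrow> X i j \<in> M" and pos: "positive_matrix n X"
  shows "positive_matrix n (\<lambda>i j. cond (X i j))"
  unfolding positive_matrix_def
proof
  fix \<xi> :: "nat \<Rightarrow> 'a"
  have "cinner (\<xi> i) (app (cond (X i j)) (\<xi> j))
      = cinner (app e (\<xi> i)) (app (cond (X i j)) (app e (\<xi> j)))" if "i < n" "j < n" for i j
  proof -
    have "cond (X i j) = star e * cond (X i j) * e"
      using cond_in[OF X[OF that]] by (simp add: unit_star N.unit_mult mult.assoc)
    then show ?thesis by (metis app_simps(6) cinner_star_right)
  qed
  moreover have "app e (app e (\<xi> i)) = app e (\<xi> i)" for i
    using unit_mult(1)[OF unit] by (metis app_simps(6))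
  then have "(\<Sum>i<n. \<Sum>j<n. cinner (app e (\<xi> i)) (app (cond (X i j)) (app e (\<xi> j)))) \<in> \<real>\<^sub>\<ge>\<^sub>0"
    by (intro cond_matrix_unit X pos)
  ultimately show "(\<Sum>i<n. \<Sum>j<n. cinner (\<xi> i) (app (cond (X i j)) (\<xi> j))) \<in> \<real>\<^sub>\<ge>\<^sub>0"
    by simp
qed

text \<open>Up to the factor \<open>e\<close> this is binom(n,j) a^j (1-a)^(n-j), the binomial law
  with success probability \<open>a\<close>, built by Pascal's recursion: the last trial fails or
  succeeds.\<close>

primrec bernstein :: "'a bop \<Rightarrow> nat \<Rightarrow> nat \<Rightarrow> 'a bop" where
  "bernstein a 0 = (\<lambda>j. if j = 0 then e else 0)"
| "bernstein a (Suc n) = (\<lambda>j. bernstein a n j * (1 - a) + (case j of 0 \<Rightarrow> 0 | Suc i \<Rightarrow> bernstein a n i * a))"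

lemma bernstein_in: "a \<in> C \<Longrightarrow> bernstein a n j \<in> N \<and> 0 \<le> bernstein a n j"
proof (induction n arbitrary: j)
  case (Suc n)
  have *: "bernstein a n i * (1 - a) \<in> N \<and> 0 \<le> bernstein a n i * (1 - a)"
    "bernstein a n i * a \<in> N \<and> 0 \<le> bernstein a n i * a" for i
  proof -
    have i: "bernstein a n i \<in> N" "0 \<le> bernstein a n i" using Suc by auto
    have a: "a \<in> N" "0 \<le> a" "0 \<le> 1 - a" using CD[OF Suc.prems] by auto
    have c: "bernstein a n i * a = a * bernstein a n i" by (rule comm[OF i(1) a(1)])
    then have c': "bernstein a n i * (1 - a) = (1 - a) * bernstein a n i"
      by (simp add: left_diff_distrib right_diff_distrib)
    have "bernstein a n i * (1 - a) \<in> N"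
      using N.diff[OF i(1) N.mult[OF i(1) a(1)]] by (simp add: right_diff_distrib)
    then show "bernstein a n i * (1 - a) \<in> N \<and> 0 \<le> bernstein a n i * (1 - a)"
      using bop_commuting_mult_pos[OF i(2) a(3) c'] by blast
    show "bernstein a n i * a \<in> N \<and> 0 \<le> bernstein a n i * a"
      using bop_commuting_mult_pos[OF i(2) a(2) c] N.mult[OF i(1) a(1)] by blast
  qed
  show ?case using *[of j] *(2)[of "j - 1"] by (auto split: nat.split intro: N.add add_nonneg_nonneg)
qed (use N.unit N.zero unit_pos in auto)

lemma bernstein_zero: "n < j \<Longrightarrow> bernstein a n j = 0"
  by (induction n arbitrary: j) (auto split: nat.split)

definition bsum where "bsum a c n = (\<Sum>j\<le>n. c j *\<^sub>R bernstein a n j)" for a :: "'a bop" and c :: "nat \<Rightarrow> real"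

lemma bsum_Suc: "bsum a c (Suc n) = bsum a c n * (1 - a) + bsum a (\<lambda>j. c (Suc j)) n * a"
proof -
  have "bsum a c (Suc n) = (\<Sum>j\<le>Suc n. c j *\<^sub>R (bernstein a n j * (1 - a)))
      + (\<Sum>j\<le>Suc n. c j *\<^sub>R (case j of 0 \<Rightarrow> 0 | Suc i \<Rightarrow> bernstein a n i * a))"
    by (simp add: bsum_def scaleR_add_right sum.distrib del: sum.atMost_Suc)
  also have "(\<Sum>j\<le>Suc n. c j *\<^sub>R (bernstein a n j * (1 - a))) = bsum a c n * (1 - a)"
    by (simp add: bsum_def bernstein_zero sum_distrib_right)
  also have "(\<Sum>j\<le>Suc n. c j *\<^sub>R (case j of 0 \<Rightarrow> 0 | Suc i \<Rightarrow> bernstein a n i * a))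
      = bsum a (\<lambda>j. c (Suc j)) n * a"
    unfolding sum.atMost_Suc_shift by (simp add: bsum_def sum_distrib_right)
  finally show ?thesis .
qed

lemma bsum_add: "bsum a (\<lambda>j. c j + d j) n = bsum a c n + bsum a d n"
  by (simp add: bsum_def scaleR_add_left sum.distrib)

lemma bsum_scale: "bsum a (\<lambda>j. r * c j) n = r *\<^sub>R bsum a c n"
  by (simp add: bsum_def scaleR_sum_right)

text \<open>By conditioning on the last trial, as in \<open>bsum_Suc\<close>. Total mass, mean and
  second moment are what a Chebyshev estimate needs.\<close>

lemma bsum_moments:
  assumes "a \<in> N"
  shows "bsum a (\<lambda>j. 1) n = e" "bsum a real n = real n *\<^sub>R a"
    "bsum a (\<lambda>j. (real j)\<^sup>2) n = real n *\<^sub>R a + (real n * (real n - 1)) *\<^sub>R (a * a)"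
proof -
  show 0: "bsum a (\<lambda>j. 1) n = e" for n
    by (induction n) (simp add: bsum_def, simp add: bsum_Suc algebra_simps)
  show 1: "bsum a real n = real n *\<^sub>R a" for n
  proof (induction n)
    case (Suc n)
    have "bsum a (\<lambda>j. real (Suc j)) n = bsum a real n + bsum a (\<lambda>j. 1) n"
      by (simp flip: bsum_add add: add.commute)
    then show ?case
      using Suc by (simp add: bsum_Suc 0 algebra_simps N.unit_mult assms)
  qed (simp add: bsum_def)
  show "bsum a (\<lambda>j. (real j)\<^sup>2) n = real n *\<^sub>R a + (real n * (real n - 1)) *\<^sub>R (a * a)"
  proof (induction n)
    case (Suc n)
    have "bsum a (\<lambda>j. (real (Suc j))\<^sup>2) n
      = bsum a (\<lambda>j. (real j)\<^sup>2) n + 2 *\<^sub>R bsum a real n + bsum a (\<lambda>j. 1) n"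
      by (simp flip: bsum_add bsum_scale add: power2_eq_square algebra_simps)
    then have "bsum a (\<lambda>j. (real j)\<^sup>2) (Suc n)
        = bsum a (\<lambda>j. (real j)\<^sup>2) n + a + (2 * real n) *\<^sub>R (a * a)"
      unfolding bsum_Suc 0 1 by (simp add: algebra_simps N.unit_mult assms)
    moreover have "real (Suc n) *\<^sub>R a = real n *\<^sub>R a + a" by (simp add: algebra_simps)
    moreover have "(real (Suc n) * (real (Suc n) - 1)) *\<^sub>R (a * a)
        = (real n * (real n - 1)) *\<^sub>R (a * a) + (2 * real n) *\<^sub>R (a * a)"
      by (simp add: algebra_simps flip: scaleR_add_left)
    ultimately show ?case using Suc by simp
  qed (simp add: bsum_def)
qed

end


section \<open>Norm-one projections preserving the state\<close>

text \<open>An arbitrary competitor for \<open>cond\<close>. Positivity is not part of being a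
  norm-one projection and has to be derived. The contraction bound is phrased with vectors because
  the operator type carries no norm.\<close>

locale expectation = central_subalgebra M e \<psi> N
  for M :: "'a::complex_hilbert_space bop set" and e \<psi> N +
  fixes F :: "'a bop \<Rightarrow> 'a bop"
  assumes F_add: "x \<in> M \<Longrightarrow> y \<in> M \<Longrightarrow> F (x + y) = F x + F y"
    and F_csc: "x \<in> M \<Longrightarrow> F (csc c x) = csc c (F x)"
    and F_in: "x \<in> M \<Longrightarrow> F x \<in> N"
    and F_id: "a \<in> N \<Longrightarrow> F a = a"
    and F_bound: "x \<in> M \<Longrightarrow> 0 \<le> r \<Longrightarrow> (\<And>\<xi>. norm (app x \<xi>) \<le> r * norm \<xi>) \<Longrightarrow> norm (app (F x) \<xi>) \<le> r * norm \<xi>"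
    and F_state: "x \<in> M \<Longrightarrow> \<psi> (F x) = \<psi> x"
begin

lemma F_scaleR: "x \<in> M \<Longrightarrow> F (r *\<^sub>R x) = r *\<^sub>R F x"
  using F_csc[of x "of_real r"] by (simp add: csc_simps)

lemma F_diff: "x \<in> M \<Longrightarrow> y \<in> M \<Longrightarrow> F (x - y) = F x - F y"
  using F_add[of x "- y"] F_scaleR[of y "-1"] minus[of y] by simp

text \<open>A unital contraction keeps operators within distance \<open>r\<close> of c e at that
  distance, which places the quadratic form in a disc. Suitable discs then force positivity.\<close>

lemma F_disc:
  assumes x: "x \<in> M" and r: "star (x - csc c e) * (x - csc c e) \<le> r\<^sup>2 *\<^sub>R 1" "0 \<le> r"
    and \<xi>: "app e \<xi> = \<xi>"
  shows "cmod (cinner \<xi> (app (F x) \<xi>) - c * of_real ((norm \<xi>)\<^sup>2)) \<le> r * (norm \<xi>)\<^sup>2"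
proof -
  have "F (x - csc c e) = F x - csc c e"
    using x by (simp add: F_diff F_csc F_id closed_ops N.unit)
  then have "norm (app (F x - csc c e) \<xi>) \<le> r * norm \<xi>"
    using F_bound[of "x - csc c e" r \<xi>] norm_app_le[OF r] x r(2) by (simp add: closed_ops)
  then have "cmod (cinner \<xi> (app (F x - csc c e) \<xi>)) \<le> norm \<xi> * (r * norm \<xi>)"
    by (intro order_trans[OF cinner_cauchy_schwarz] mult_left_mono) auto
  then show ?thesis by (simp add: \<xi> cinner_algebra cinner_self power2_eq_square mult_ac)
qed

text \<open>The classical argument that unital contractions are positive: discs about i t of radius
  sqrt(1 + t^2) rule out nonreal values as t varies, and the disc about 1 of radius 1 rules out
  negative ones.\<close>

lemma F_pos_unit:
  assumes x: "x \<in> M" "0 \<le> x" "x \<le> 1" shows "0 \<le> F x"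
  unfolding bop_le_iff
proof
  fix \<xi>
  define \<eta> where "\<eta> = app e \<xi>"
  define s where "s = (norm \<eta>)\<^sup>2"
  define w where "w = cinner \<eta> (app (F x) \<eta>)"
  have \<eta>: "app e \<eta> = \<eta>" using unit_mult(1)[OF unit] by (metis app_simps(6) \<eta>_def)
  have sx: "star x = x" by (rule bop_pos_star[OF x(2)])
  have w: "cinner \<xi> (app (F x) \<xi>) = w"
  proof -
    have "F x = star e * F x * e" using F_in[OF x(1)] by (simp add: unit_star N.unit_mult mult.assoc)
    then show ?thesis unfolding w_def \<eta>_def by (metis app_simps(6) cinner_star_right)
  qed
  have "(Im w)\<^sup>2 \<le> s\<^sup>2 + 2 * t * (s * Im w)" for t
  proof -
    have "star (x - csc (\<i> * of_real t) e) * (x - csc (\<i> * of_real t) e) = x * x + (t\<^sup>2) *\<^sub>R e"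
      using x by (simp add: sx unit_star algebra_simps csc_simps csc_diff csc_minus_left unit_mult unit)
        (simp add: power2_eq_square flip: of_real_mult csc_simps(7))
    also have "\<dots> \<le> 1 + t\<^sup>2 *\<^sub>R 1"
      using order_trans[OF bop_square_le_self[OF x(2,3)] x(3)]
      by (intro add_mono scaleR_left_mono unit_le_one) auto
    also have "\<dots> = (sqrt (1 + t\<^sup>2))\<^sup>2 *\<^sub>R 1" by (simp add: scaleR_add_left)
    finally have "cmod (w - \<i> * of_real t * of_real s) \<le> sqrt (1 + t\<^sup>2) * s"
      unfolding w_def s_def by (rule F_disc[OF x(1) _ _ \<eta>]) simp
    then have "\<bar>Im w - t * s\<bar> \<le> sqrt (1 + t\<^sup>2) * s"
      using abs_Im_le_cmod[of "w - \<i> * of_real t * of_real s"] by simp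
    then have "(Im w - t * s)\<^sup>2 \<le> (sqrt (1 + t\<^sup>2) * s)\<^sup>2"
      by (rule power2_le_iff_abs_le[THEN iffD2, rotated]) (simp add: s_def)
    then show ?thesis by (simp add: power_mult_distrib power2_diff algebra_simps)
  qed note quad = this
  have "s * Im w = 0"
  proof (rule ccontr)
    define k where "k = s * Im w"
    assume "s * Im w \<noteq> 0"
    then have k: "k \<noteq> 0" by (simp add: k_def)
    \<comment> \<open>This \<open>t\<close> turns the right-hand side into -1.\<close>
    have "(Im w)\<^sup>2 \<le> s\<^sup>2 + 2 * (- (s\<^sup>2 + 1) / (2 * k)) * k" unfolding k_def by (rule quad)
    also have "2 * (- (s\<^sup>2 + 1) / (2 * k)) * k = - (s\<^sup>2 + 1)" using k by (simp add: field_simps)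
    also have "s\<^sup>2 + - (s\<^sup>2 + 1) = - 1" by simp
    finally show False using zero_le_power2[of "Im w"] by linarith
  qed
  moreover have "Im w = 0" if "s = 0" using that by (simp add: s_def w_def)
  ultimately have Im: "Im w = 0" by auto
  have "star (x - csc 1 e) * (x - csc 1 e) = (e - x) * (e - x)"
    by (simp add: sx unit_star csc_simps algebra_simps)
  also have "\<dots> \<le> 1\<^sup>2 *\<^sub>R 1"
  proof -
    have "x \<le> 1 *\<^sub>R e" using x by (intro le_unit) auto
    then have 0: "0 \<le> e - x" by simp
    have "e - x \<le> e - 0" using x(2) by (intro diff_left_mono)
    then have 1: "e - x \<le> 1" using unit_le_one by (metis diff_zero order_trans)
    from order_trans[OF bop_square_le_self[OF 0 1] 1] show ?thesis by simp
  qed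
  finally have "cmod (w - 1 * of_real s) \<le> 1 * s"
    unfolding w_def s_def by (rule F_disc[OF x(1) _ _ \<eta>]) simp
  then have "0 \<le> Re w" using abs_Re_le_cmod[of "w - of_real s"] by auto
  with Im w show "cinner \<xi> (app (F x - 0) \<xi>) \<in> \<real>\<^sub>\<ge>\<^sub>0" by (simp add: complex_nonneg_Reals_iff)
qed

lemma F_pos:
  assumes x: "x \<in> M" "0 \<le> x" shows "0 \<le> F x"
proof -
  obtain c where c: "0 < c" "x \<le> c *\<^sub>R 1"
    using selfadjoint_bounded[OF bop_pos_star[OF x(2)]] by blast
  have "0 \<le> F (inverse c *\<^sub>R x)"
  proof (rule F_pos_unit)
    show "inverse c *\<^sub>R x \<le> 1"
      using scaleR_left_mono[OF c(2), of "inverse c"] c(1) by simp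
  qed (use x c in \<open>auto simp: scaleR_nonneg_nonneg scaleR\<close>)
  then have "0 \<le> c *\<^sub>R F (inverse c *\<^sub>R x)" using c(1) by (intro scaleR_nonneg_nonneg) auto
  then show ?thesis using c(1) x(1) by (simp add: F_scaleR)
qed

lemma positive_functional_F:
  assumes b: "b \<in> N" "0 \<le> b" shows "positive_functional M e (\<lambda>x. \<psi> (b * F x))"
proof
  show "\<psi> (b * F x) \<in> \<real>\<^sub>\<ge>\<^sub>0" if "x \<in> M" "0 \<le> x" for x
    using that b F_in[OF that(1)] F_pos[OF that] comm NM
    by (intro fpos bop_commuting_mult_pos) (auto intro: mult)
qed (use b F_in NM in \<open>simp_all add: F_add F_csc distrib_left csc_simps fadd fcsc mult\<close>)

text \<open>\<open>a\<close> lies in the multiplicative domain of \<open>F\<close>: cut \<open>F\<close> into the positive functionals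
  \<open>\<psi> (w\<^sub>j F \<cdot>)\<close>, where the Bernstein weight \<open>w\<^sub>j\<close> is concentrated where \<open>a\<close> is close to \<open>j / n\<close>.\<close>

lemma f_F_mult_C:
  assumes x: "x \<in> M" and a: "a \<in> C" shows "\<psi> (a * F x) = \<psi> (a * x)"
proof -
  have aN: "a \<in> N" "a \<in> M" "star a = a" using CD[OF a] by auto
  define X where "X = f (star x * x)"
  have bound: "(cmod (\<psi> (a * x) - \<psi> (a * F x)))\<^sup>2 \<le> X * (1 / (real m + 1))" for m
  proof -
    define n where "n = Suc m"
    define w where "w = bernstein a n"
    define t where "t j = real j / real n" for j
    have w: "w j \<in> N" "0 \<le> w j" "w j \<in> M" for j using bernstein_in[OF a] NM by (auto simp: w_def)
    have Fx: "F x \<in> M" "F (a * x) \<in> M" "F (star x * x) \<in> M"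
      using F_in NM x aN by (simp_all add: closed_ops)
    have sum1: "(\<Sum>j\<le>n. w j) = e"
      using bsum_moments(1)[OF aN(1), of n] by (simp add: bsum_def w_def)
    have sumt: "(\<Sum>j\<le>n. t j *\<^sub>R w j) = a"
    proof -
      have "(\<Sum>j\<le>n. t j *\<^sub>R w j) = (1 / real n) *\<^sub>R bsum a real n"
        by (simp add: bsum_def w_def t_def scaleR_sum_right)
      then show ?thesis using bsum_moments(2)[OF aN(1), of n] by (simp add: n_def)
    qed
    have sumt2: "(\<Sum>j\<le>n. (t j)\<^sup>2 *\<^sub>R w j) = (1 / real n) *\<^sub>R a + (1 - 1 / real n) *\<^sub>R (a * a)"
    proof -
      have "(\<Sum>j\<le>n. (t j)\<^sup>2 *\<^sub>R w j) = (1 / (real n)\<^sup>2) *\<^sub>R bsum a (\<lambda>j. (real j)\<^sup>2) n"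
        by (simp add: bsum_def w_def t_def scaleR_sum_right power_divide)
      also have "\<dots> = (1 / real n) *\<^sub>R a + (1 - 1 / real n) *\<^sub>R (a * a)"
        unfolding bsum_moments(3)[OF aN(1)]
        by (simp add: scaleR_add_right n_def power2_eq_square divide_simps)
      finally show ?thesis .
    qed
    define y where "y j = a - t j *\<^sub>R e" for j
    have y: "y j \<in> N" "y j \<in> M" "star (y j) = y j" for j
      using aN by (auto simp: y_def unit_star N.closed_ops closed_ops)
    \<comment> \<open>Cauchy-Schwarz for the positive functional that sends \<open>x\<close> to
      \<open>\<psi> (w j * F x)\<close>; \<open>F\<close> leaves the square of \<open>y j\<close>
      alone because it lies in \<open>N\<close>.\<close>
    have cs: "(cmod (\<psi> (w j * F (y j * x))))\<^sup>2 \<le> f (w j * (y j * y j)) * f (w j * F (star x * x))" for j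
    proof -
      interpret \<theta>: positive_functional M e "\<lambda>x. \<psi> (w j * F x)"
        by (rule positive_functional_F[OF w(1,2)])
      show ?thesis
        using \<theta>.fcauchy_schwarz[OF x y(2)[of j]] y[of j] by (simp add: F_id N.mult)
    qed
    \<comment> \<open>The weights sum to \<open>e\<close> and have mean \<open>a\<close>, so the
      defect is a weighted sum in which \<open>a\<close> is replaced by its deviation
      \<open>y j\<close> from j/n.\<close>
    have "\<psi> (a * x) - \<psi> (a * F x) = (\<Sum>j\<le>n. \<psi> (w j * F (y j * x)))"
    proof -
      have "\<psi> (a * x) = \<psi> (e * F (a * x))"
        using F_state[of "a * x"] x aN unit_mult(1)[OF Fx(2)] by (simp add: mult)
      also have "\<dots> = (\<Sum>j\<le>n. \<psi> (w j * F (a * x)))"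
        unfolding sum1[symmetric] using w(3) Fx by (simp add: sum_distrib_right fsum mult)
      finally have 1: "\<psi> (a * x) = (\<Sum>j\<le>n. \<psi> (w j * F (a * x)))" .
      have "\<psi> (a * F x) = \<psi> ((\<Sum>j\<le>n. t j *\<^sub>R w j) * F x)" by (simp only: sumt)
      also have "\<dots> = (\<Sum>j\<le>n. \<psi> (w j * F (t j *\<^sub>R x)))"
        using w(3) Fx x by (simp add: sum_distrib_right fsum closed_ops F_scaleR)
      finally have 2: "\<psi> (a * F x) = (\<Sum>j\<le>n. \<psi> (w j * F (t j *\<^sub>R x)))" .
      have "F (y j * x) = F (a * x) - F (t j *\<^sub>R x)" for j
        using x aN by (simp add: y_def left_diff_distrib F_diff closed_ops unit_mult)
      then have "\<psi> (w j * F (y j * x)) = \<psi> (w j * F (a * x)) - \<psi> (w j * F (t j *\<^sub>R x))" for j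
        using w(3) Fx F_in[OF scaleR[OF x]] NM by (simp add: right_diff_distrib fdiff mult)
      then show ?thesis unfolding 1 2 by (simp add: sum_subtractf)
    qed
    then have "cmod (\<psi> (a * x) - \<psi> (a * F x)) \<le> (\<Sum>j\<le>n. cmod (\<psi> (w j * F (y j * x))))"
      by (simp add: norm_sum)
    also have "\<dots> \<le> (\<Sum>j\<le>n. sqrt (f (w j * (y j * y j))) * sqrt (f (w j * F (star x * x))))"
      by (intro sum_mono) (use real_sqrt_le_mono[OF cs] in \<open>simp add: real_sqrt_mult\<close>)
    finally have "(cmod (\<psi> (a * x) - \<psi> (a * F x)))\<^sup>2
        \<le> (\<Sum>j\<le>n. sqrt (f (w j * (y j * y j))) * sqrt (f (w j * F (star x * x))))\<^sup>2"
      by (intro power_mono) auto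
    also have "\<dots> \<le> (\<Sum>j\<le>n. (sqrt (f (w j * (y j * y j))))\<^sup>2) * (\<Sum>j\<le>n. (sqrt (f (w j * F (star x * x))))\<^sup>2)"
      by (rule Cauchy_Schwarz_ineq_sum)
    also have "(\<Sum>j\<le>n. (sqrt (f (w j * (y j * y j))))\<^sup>2) = (\<Sum>j\<le>n. f (w j * (y j * y j)))"
    proof (intro sum.cong refl real_sqrt_pow2)
      fix j
      have "0 \<le> y j * y j" using y(3) by (rule bop_square_pos)
      then have "0 \<le> w j * (y j * y j)"
        by (rule bop_commuting_mult_pos[OF w(2) _ comm[OF w(1) N.mult[OF y(1) y(1)]]])
      then show "0 \<le> f (w j * (y j * y j))" using w(3) y(2) by (intro fpos_Re) (auto intro: mult)
    qed
    \<comment> \<open>The variance a (1 - a) / n of the binomial proportion; its factor 1/n is what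
      makes the defect vanish.\<close>
    also have "(\<Sum>j\<le>n. f (w j * (y j * y j))) = f ((1 / real n) *\<^sub>R (a - a * a))"
    proof -
      have wa: "w j * a = a * w j" for j by (rule comm[OF w(1) aN(1)])
      have "w j * (y j * y j) = w j * (a * a) - (t j *\<^sub>R w j * a + t j *\<^sub>R w j * a) + (t j)\<^sup>2 *\<^sub>R w j" for j
        using w(3) aN by (simp add: y_def algebra_simps unit_mult unit closed_ops power2_eq_square)
      then have "(\<Sum>j\<le>n. w j * (y j * y j))
          = (\<Sum>j\<le>n. w j) * (a * a)
            - ((\<Sum>j\<le>n. t j *\<^sub>R w j) * a + (\<Sum>j\<le>n. t j *\<^sub>R w j) * a) + (\<Sum>j\<le>n. (t j)\<^sup>2 *\<^sub>R w j)"
        by (simp add: sum.distrib sum_subtractf sum_distrib_right scaleR_sum_right)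
      also have "\<dots> = (1 / real n) *\<^sub>R (a - a * a)"
        unfolding sum1 sumt sumt2 using aN
        by (simp add: unit_mult mult algebra_simps)
      finally have "\<psi> (\<Sum>j\<le>n. w j * (y j * y j)) = \<psi> ((1 / real n) *\<^sub>R (a - a * a))" by simp
      then show ?thesis using w(3) y(2) by (simp add: fsum mult flip: Re_sum)
    qed
    also have "(\<Sum>j\<le>n. (sqrt (f (w j * F (star x * x))))\<^sup>2) = (\<Sum>j\<le>n. f (w j * F (star x * x)))"
    proof (intro sum.cong refl real_sqrt_pow2)
      fix j
      interpret \<theta>: positive_functional M e "\<lambda>x. \<psi> (w j * F x)"
        by (rule positive_functional_F[OF w(1,2)])
      show "0 \<le> f (w j * F (star x * x))" using x by (intro \<theta>.fpos_Re bop_star_mult_pos closed_ops)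
    qed
    also have "\<dots> = X"
    proof -
      have "\<psi> (star x * x) = \<psi> (e * F (star x * x))"
        using F_state[of "star x * x"] x unit_mult(1)[OF Fx(3)] by (simp add: closed_ops)
      also have "\<dots> = (\<Sum>j\<le>n. \<psi> (w j * F (star x * x)))"
        unfolding sum1[symmetric] using w(3) Fx by (simp add: sum_distrib_right fsum mult)
      finally show ?thesis by (simp add: X_def)
    qed
    also have "f ((1 / real n) *\<^sub>R (a - a * a)) * X \<le> X * (1 / (real m + 1))"
    proof -
      have "a - a * a \<le> 1" using CD(3)[OF C_mult_complement[OF a a]] .
      then have "f (a - a * a) \<le> 1" using aN by (intro fle_const closed_ops) auto
      then have "f ((1 / real n) *\<^sub>R (a - a * a)) \<le> 1 / (real m + 1)"
        using aN by (simp add: fscaleR closed_ops n_def divide_right_mono add.commute)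
      moreover have "0 \<le> X" unfolding X_def using x by (intro fpos_Re bop_star_mult_pos closed_ops)
      ultimately show ?thesis by (metis mult.commute mult_left_mono)
    qed
    finally show ?thesis .
  qed
  have "(\<lambda>m. X * (1 / (real m + 1))) \<longlonglongrightarrow> 0" by real_asymp
  then have "(cmod (\<psi> (a * x) - \<psi> (a * F x)))\<^sup>2 \<le> 0"
    by (rule LIMSEQ_le_const) (use bound in auto)
  then show ?thesis by simp
qed

lemma F_eq_cond:
  assumes x: "x \<in> M" shows "F x = cond x"
proof -
  have "\<psi> (a * F x) = \<psi> (a * x)" if "a \<in> N" for a
    using that
  proof (rule N_induct_C)
    show "\<psi> (a * F x) = \<psi> (a * x)" if "a \<in> C" for a by (rule f_F_mult_C[OF x that])
  qed (use x F_in[OF x] NM in \<open>simp_all add: distrib_right csc_simps fadd fcsc mult\<close>)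
  then have "\<psi> (F x * a) = \<psi> (x * a)" if "a \<in> N" for a
    using that central[OF that x] central[OF that NM[OF F_in[OF x]]] by simp
  then show ?thesis using cond_unique[OF x F_in[OF x]] by simp
qed

end

section \<open>Spectral measures\<close>

text \<open>If \<open>\<nu>'\<close> is the image of \<open>\<nu>\<close> under \<open>l \<mapsto> 1 / l\<close>, the two bounds add up to
  \<open>\<integral> (l + 1 / l) \<partial>\<nu> \<le> 2\<close>.\<close>

lemma prob_concentrated_at_one:
  fixes \<nu> \<nu>' :: "real measure"
  assumes "prob_space \<nu>" "prob_space \<nu>'"
    and sets [measurable_cong, simp]: "sets \<nu> = sets borel" "sets \<nu>' = sets borel"
    and pos: "AE l in \<nu>. 0 < l" "AE l in \<nu>'. 0 < l"
    and char: "\<And>s. (\<integral>l. iexp (s * ln l) \<partial>\<nu>') = cnj (\<integral>l. iexp (s * ln l) \<partial>\<nu>)"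
    and int: "integrable \<nu> (\<lambda>l. l)" "(\<integral>l. l \<partial>\<nu>) \<le> 1" "integrable \<nu>' (\<lambda>l. l)" "(\<integral>l. l \<partial>\<nu>') \<le> 1"
  shows "AE l in \<nu>. l = 1"
proof -
  interpret \<nu>: prob_space \<nu> by fact
  interpret \<nu>': prob_space \<nu>' by fact
  \<comment> \<open>On the logarithmic scale inversion is a change of sign; \<open>char\<close> says
    that \<open>- ln\<close> under \<nu> and \<open>ln\<close> under \<nu>' have the same
    characteristic function.\<close>
  define D where "D = distr \<nu> borel (\<lambda>l. - ln l)"
  define D' where "D' = distr \<nu>' borel ln"
  have "char D = char D'"
  proof
    fix t
    have "char D t = (\<integral>l. cnj (iexp (t * ln l)) \<partial>\<nu>)"
      by (simp add: char_def D_def integral_distr exp_cnj)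
    also have "\<dots> = (\<integral>l. iexp (t * ln l) \<partial>\<nu>')" 
      using char[of t] by (simp only: Bochner_Integration.integral_cnj)
    also have "\<dots> = char D' t" by (simp add: char_def D'_def integral_distr)
    finally show "char D t = char D' t" .
  qed
  then have DD: "D = D'"
    by (intro Levy_uniqueness) (auto simp: D_def D'_def)
  have AE': "AE l in \<nu>'. exp (ln l) = l" using pos(2) by eventually_elim simp
  have "integrable \<nu>' (\<lambda>l. exp (ln l))"
  proof (rule integrable_cong_AE_imp[OF int(3)])
    show "AE l in \<nu>'. l = exp (ln l)" using AE' by eventually_elim simp
  qed simp
  then have "integrable D' exp" by (simp add: D'_def integrable_distr_eq)
  then have i: "integrable \<nu> (\<lambda>l. exp (- ln l))"
    by (simp add: D_def integrable_distr_eq flip: DD)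
  have "(\<integral>l. exp (- ln l) \<partial>\<nu>) = (\<integral>x. exp x \<partial>D)" by (simp add: D_def integral_distr)
  also have "\<dots> = (\<integral>l. exp (ln l) \<partial>\<nu>')" by (simp add: DD D'_def integral_distr)
  also have "\<dots> = (\<integral>l. l \<partial>\<nu>')" using AE' by (intro integral_cong_AE) auto
  finally have le: "(\<integral>l. exp (- ln l) \<partial>\<nu>) \<le> 1" using int(4) by simp
  \<comment> \<open>For positive l this is (l - 1)^2 / l. The inverse is written
    \<open>exp (- ln l)\<close>, the form in which it was transported through
    \<open>D\<close>.\<close>
  define h where "h l = l + exp (- ln l) - 2" for l :: real
  have h: "h l = (l - 1)\<^sup>2 / l" if "0 < l" for l
    using that by (simp add: h_def exp_minus field_simps power2_eq_square)
  have hi: "integrable \<nu> h" unfolding h_def using int(1) i by simp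
  have "(\<integral>l. h l \<partial>\<nu>) = (\<integral>l. l \<partial>\<nu>) + (\<integral>l. exp (- ln l) \<partial>\<nu>) - 2"
    unfolding h_def using int(1) i by (simp add: \<nu>.prob_space)
  then have "(\<integral>l. h l \<partial>\<nu>) \<le> 0" using int(2) le by linarith
  moreover have nn: "AE l in \<nu>. 0 \<le> h l" using pos(1) by eventually_elim (simp add: h)
  ultimately have "(\<integral>l. h l \<partial>\<nu>) = 0" using integral_nonneg_AE[OF nn] by simp
  then have "AE l in \<nu>. h l = 0" using integral_nonneg_eq_0_iff_AE[OF hi nn] by simp
  then show ?thesis using pos(1) by eventually_elim (simp add: h)
qed

text \<open>Uniqueness of characteristic functions concerns probability measures, so both measures
  are divided by their common mass; mass 0 is trivial.\<close>

lemma concentrated_at_one: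
  fixes \<nu> \<nu>' :: "real measure"
  assumes fin: "finite_measure \<nu>" "finite_measure \<nu>'"
    and sets [measurable_cong, simp]: "sets \<nu> = sets borel" "sets \<nu>' = sets borel"
    and mass: "measure \<nu> UNIV = m" "measure \<nu>' UNIV = m"
    and pos: "AE l in \<nu>. 0 < l" "AE l in \<nu>'. 0 < l"
    and char: "\<And>s. (\<integral>l. iexp (s * ln l) \<partial>\<nu>') = cnj (\<integral>l. iexp (s * ln l) \<partial>\<nu>)"
    and int: "integrable \<nu> (\<lambda>l. l)" "(\<integral>l. l \<partial>\<nu>) \<le> m" "integrable \<nu>' (\<lambda>l. l)" "(\<integral>l. l \<partial>\<nu>') \<le> m"
  shows "AE l in \<nu>. l = 1"
proof (cases "m = 0")
  case True
  interpret finite_measure \<nu> by fact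
  have "emeasure \<nu> UNIV = 0" using mass(1) True by (simp add: emeasure_eq_measure)
  then show ?thesis
    by (intro AE_I[where N = UNIV]) auto
next
  case False
  interpret \<nu>: finite_measure \<nu> by fact
  interpret \<nu>': finite_measure \<nu>' by fact
  have m: "0 < m" using mass(1) False measure_nonneg[of \<nu> UNIV] by linarith
  define p where "p = density \<nu> (\<lambda>_. ennreal (1 / m))"
  define p' where "p' = density \<nu>' (\<lambda>_. ennreal (1 / m))"
  have sp [simp]: "space \<nu> = UNIV" "space \<nu>' = UNIV"
    using sets_eq_imp_space_eq[OF sets(1)] sets_eq_imp_space_eq[OF sets(2)] by auto
  have "AE l in p. l = 1"
  proof (rule prob_concentrated_at_one)
    have "emeasure \<nu> UNIV = ennreal m" "emeasure \<nu>' UNIV = ennreal m"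
      using mass by (simp_all add: \<nu>.emeasure_eq_measure \<nu>'.emeasure_eq_measure)
    then show "prob_space p" "prob_space p'"
      using m by (auto intro!: prob_spaceI simp: p_def p'_def emeasure_density nn_integral_cmult
          ennreal_mult[symmetric])
    show "sets p = sets borel" "sets p' = sets borel" by (auto simp: p_def p'_def)
    show "AE l in p. 0 < l" "AE l in p'. 0 < l"
      unfolding p_def p'_def using pos
      by (subst AE_density; auto elim!: eventually_mono)+
    show "(\<integral>l. iexp (s * ln l) \<partial>p') = cnj (\<integral>l. iexp (s * ln l) \<partial>p)" for s
    proof -
      have "(\<integral>l. iexp (s * ln l) \<partial>p) = (\<integral>l. (1 / m) *\<^sub>R iexp (s * ln l) \<partial>\<nu>)"
        unfolding p_def using m by (intro integral_density) auto
      also have "\<dots> = (1 / m) *\<^sub>R (\<integral>l. iexp (s * ln l) \<partial>\<nu>)" by (rule integral_scaleR_right)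
      finally have 1: "(\<integral>l. iexp (s * ln l) \<partial>p) = (1 / m) *\<^sub>R (\<integral>l. iexp (s * ln l) \<partial>\<nu>)" .
      have "(\<integral>l. iexp (s * ln l) \<partial>p') = (\<integral>l. (1 / m) *\<^sub>R iexp (s * ln l) \<partial>\<nu>')"
        unfolding p'_def using m by (intro integral_density) auto
      also have "\<dots> = (1 / m) *\<^sub>R (\<integral>l. iexp (s * ln l) \<partial>\<nu>')" by (rule integral_scaleR_right)
      finally show ?thesis unfolding 1 char by (simp only: complex_cnj_scaleR)
    qed
    have "integrable p (\<lambda>l. l) \<longleftrightarrow> integrable \<nu> (\<lambda>l. (1 / m) *\<^sub>R l)"
      "integrable p' (\<lambda>l. l) \<longleftrightarrow> integrable \<nu>' (\<lambda>l. (1 / m) *\<^sub>R l)"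
      unfolding p_def p'_def using m by (intro integrable_density; auto)+
    then show "integrable p (\<lambda>l. l)" "integrable p' (\<lambda>l. l)"
      using integrable_scaleR_right[OF int(1)] integrable_scaleR_right[OF int(3)] by blast+
    have "(\<integral>l. l \<partial>p) = (\<integral>l. (1 / m) *\<^sub>R l \<partial>\<nu>)" "(\<integral>l. l \<partial>p') = (\<integral>l. (1 / m) *\<^sub>R l \<partial>\<nu>')"
      unfolding p_def p'_def using m by (intro integral_density; auto)+
    then have "(\<integral>l. l \<partial>p) = (1 / m) *\<^sub>R (\<integral>l. l \<partial>\<nu>)" "(\<integral>l. l \<partial>p') = (1 / m) *\<^sub>R (\<integral>l. l \<partial>\<nu>')"
      by (simp_all only: integral_scaleR_right)
    then show "(\<integral>l. l \<partial>p) \<le> 1" "(\<integral>l. l \<partial>p') \<le> 1"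
      using int(2,4) m by (simp_all add: divide_le_eq_1)
  qed
  then have "AE l in \<nu>. 0 < ennreal (1 / m) \<longrightarrow> l = 1"
    unfolding p_def by (subst (asm) AE_density) auto
  then show ?thesis using m by simp
qed

section \<open>Projection-valued measures and their spectral distributions\<close>

locale spectral_projections =
  fixes P :: "real set \<Rightarrow> 'b::complex_hilbert_space \<Rightarrow> 'b"
  assumes pvm: "projection_valued_measure P"
begin

abbreviation \<mu> where "\<mu> \<equiv> spectral_distribution P"

lemma P_clinear: "B \<in> sets borel \<Longrightarrow> bounded_clinear (P B)"
  using pvm by (auto simp: projection_valued_measure_def is_projection_def)

lemma P_linear:
  assumes "B \<in> sets borel"
  shows "P B (\<xi> + \<eta>) = P B \<xi> + P B \<eta>" "P B (\<xi> - \<eta>) = P B \<xi> - P B \<eta>" "P B (c *\<^sub>C \<xi>) = c *\<^sub>C P B \<xi>"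
    "P B 0 = 0"
  using P_clinear[OF assms] bounded_linear.linear[of "P B"]
  by (auto simp: bounded_clinear_def linear_add linear_diff linear_0)

lemma P_selfadjoint: "B \<in> sets borel \<Longrightarrow> cinner (P B \<xi>) \<eta> = cinner \<xi> (P B \<eta>)"
  using cinner_adj_left[OF P_clinear, of B \<xi> \<eta>] pvm
  by (simp add: projection_valued_measure_def is_projection_def)

lemma P_idem: "B \<in> sets borel \<Longrightarrow> P B (P B \<xi>) = P B \<xi>"
  using pvm by (auto simp: projection_valued_measure_def is_projection_def o_def fun_eq_iff)

lemma P_UNIV [simp]: "P UNIV \<xi> = \<xi>"
  using pvm by (simp add: projection_valued_measure_def)

lemma P_sums: "range A \<subseteq> sets borel \<Longrightarrow> disjoint_family A \<Longrightarrow> (\<lambda>n::nat. P (A n) \<xi>) sums P (\<Union>n. A n) \<xi>"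
  using pvm by (simp add: projection_valued_measure_def)

lemma P_empty [simp]: "P {} \<xi> = 0"
proof -
  have "(\<lambda>n::nat. P {} \<xi>) sums P (\<Union>n::nat. {}) \<xi>"
    by (rule P_sums) (auto simp: disjoint_family_on_def)
  then have "(\<lambda>n::nat. P {} \<xi>) \<longlonglongrightarrow> 0" by (intro summable_LIMSEQ_zero) (auto simp: sums_iff)
  then show ?thesis using LIMSEQ_unique tendsto_const by blast
qed

lemma P_Un:
  assumes "A \<in> sets borel" "B \<in> sets borel" "A \<inter> B = {}"
  shows "P (A \<union> B) \<xi> = P A \<xi> + P B \<xi>"
proof -
  have "(\<lambda>n. P (binaryset A B n) \<xi>) sums P (\<Union>n. binaryset A B n) \<xi>"
    using assms by (intro P_sums) (auto simp: range_binaryset_eq disjoint_family_on_def binaryset_def)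
  moreover have "(\<lambda>n. P (binaryset A B n) \<xi>) sums (P A \<xi> + P B \<xi>)"
    by (rule binaryset_sums) simp
  ultimately show ?thesis unfolding UN_binaryset_eq by (rule sums_unique2)
qed

lemma cinner_P: "B \<in> sets borel \<Longrightarrow> cinner \<xi> (P B \<xi>) = of_real ((norm (P B \<xi>))\<^sup>2)"
  by (metis P_idem P_selfadjoint cinner_self)

lemma norm_P_le: assumes "B \<in> sets borel" shows "norm (P B \<xi>) \<le> norm \<xi>"
proof -
  have "norm (P B \<xi>) * norm (P B \<xi>) = cmod (cinner \<xi> (P B \<xi>))"
    by (simp add: cinner_P[OF assms] power2_eq_square norm_mult)
  also have "\<dots> \<le> norm \<xi> * norm (P B \<xi>)" by (rule cinner_cauchy_schwarz)
  finally show ?thesis by (cases "P B \<xi> = 0") auto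
qed

text \<open>By additivity the squared norm of \<open>P (A \<union> B)\<close> at
  \<open>P B \<xi>\<close> exceeds that of \<open>P B \<xi>\<close> by the square in question, while
  projections are contractions. Multiplicativity of \<open>P\<close> follows from this.\<close>

lemma P_disjoint:
  assumes AB: "A \<in> sets borel" "B \<in> sets borel" "A \<inter> B = {}" shows "P A (P B \<xi>) = 0"
proof -
  define \<zeta> where "\<zeta> = P B \<xi>"
  have U: "A \<union> B \<in> sets borel" using AB by auto
  have "P (A \<union> B) \<zeta> = P A \<zeta> + \<zeta>" using P_Un[OF AB] P_idem[OF AB(2)] by (simp add: \<zeta>_def)
  then have "cinner \<zeta> (P (A \<union> B) \<zeta>) = cinner \<zeta> (P A \<zeta>) + cinner \<zeta> \<zeta>"
    by (simp add: cinner_add_right)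
  then have "complex_of_real ((norm (P (A \<union> B) \<zeta>))\<^sup>2) = of_real ((norm (P A \<zeta>))\<^sup>2 + (norm \<zeta>)\<^sup>2)"
    by (simp add: cinner_P[OF U] cinner_P[OF AB(1)] cinner_self)
  then have "(norm (P (A \<union> B) \<zeta>))\<^sup>2 = (norm (P A \<zeta>))\<^sup>2 + (norm \<zeta>)\<^sup>2" by (simp only: of_real_eq_iff)
  moreover have "(norm (P (A \<union> B) \<zeta>))\<^sup>2 \<le> (norm \<zeta>)\<^sup>2"
    using norm_P_le[OF U] by (intro power_mono) auto
  ultimately have "norm (P A \<zeta>) = 0" by (smt (verit) zero_le_power2 zero_eq_power2)
  then show ?thesis by (simp add: \<zeta>_def)
qed

lemma P_Int:
  assumes AB: "A \<in> sets borel" "B \<in> sets borel" shows "P A (P B \<xi>) = P (A \<inter> B) \<xi>"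
proof -
  have I: "A \<inter> B \<in> sets borel" "A - B \<in> sets borel" "B - A \<in> sets borel" using AB by auto
  have "P B \<xi> = P (A \<inter> B) \<xi> + P (B - A) \<xi>"
  proof -
    have "A \<inter> B \<union> (B - A) = B" "A \<inter> B \<inter> (B - A) = {}" by blast+
    then show ?thesis using P_Un[OF I(1,3), of \<xi>] by simp
  qed
  moreover have "P A (P (B - A) \<xi>) = 0" using AB I by (intro P_disjoint) auto
  moreover have "P A (P (A \<inter> B) \<xi>) = P (A \<inter> B) \<xi>"
  proof -
    have "P A (P (A \<inter> B) \<xi>) = P (A \<inter> B) (P (A \<inter> B) \<xi>) + P (A - B) (P (A \<inter> B) \<xi>)"
    proof -
      have "A \<inter> B \<union> (A - B) = A" "A \<inter> B \<inter> (A - B) = {}" by blast+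
      then show ?thesis using P_Un[OF I(1,2), of "P (A \<inter> B) \<xi>"] by simp
    qed
    moreover have "P (A - B) (P (A \<inter> B) \<xi>) = 0" using I by (intro P_disjoint) auto
    ultimately show ?thesis using P_idem[OF I(1)] by simp
  qed
  ultimately show ?thesis using P_linear(1)[OF AB(1)] by simp
qed

lemma P_split: "B \<in> sets borel \<Longrightarrow> \<xi> = P B \<xi> + P (- B) \<xi>"
  using P_Un[of B "- B" \<xi>] by simp

lemma
  shows space_\<mu> [simp]: "space (\<mu> \<xi>) = UNIV" and sets_\<mu> [simp, measurable_cong]: "sets (\<mu> \<xi>) = sets borel"
    and emeasure_\<mu>: "B \<in> sets borel \<Longrightarrow> emeasure (\<mu> \<xi>) B = ennreal ((norm (P B \<xi>))\<^sup>2)"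
proof -
  have sa: "sigma_algebra UNIV (sets (borel :: real measure))"
    using sets.sigma_algebra_axioms[of "borel :: real measure"] by simp
  show "space (\<mu> \<xi>) = UNIV"
    by (simp add: spectral_distribution_def space_measure_of_conv)
  show "sets (\<mu> \<xi>) = sets borel"
    using sigma_algebra.sets_measure_of_eq[OF sa] by (simp add: spectral_distribution_def)
  assume B: "B \<in> sets borel"
  show "emeasure (\<mu> \<xi>) B = ennreal ((norm (P B \<xi>))\<^sup>2)"
    unfolding spectral_distribution_def
  proof (subst emeasure_measure_of_sigma[OF sa])
    show "positive (sets borel) (\<lambda>B. ennreal (Re (cinner \<xi> (P B \<xi>))))"
      by (simp add: positive_def)
    show "countably_additive (sets borel) (\<lambda>B. ennreal (Re (cinner \<xi> (P B \<xi>))))"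
      unfolding countably_additive_def
    proof (intro allI impI)
      fix A :: "nat \<Rightarrow> real set"
      assume A: "range A \<subseteq> sets borel" "disjoint_family A"
      have "(\<lambda>n. inner \<xi> (P (A n) \<xi>)) sums inner \<xi> (P (\<Union>n. A n) \<xi>)"
        by (rule bounded_linear.sums[OF bounded_linear_inner_right P_sums[OF A]])
      moreover have "0 \<le> inner \<xi> (P (A n) \<xi>)" for n
        using cinner_P[of "A n" \<xi>] A(1) by (simp flip: Re_cinner add: range_subsetD)
      ultimately show "(\<Sum>i. ennreal (Re (cinner \<xi> (P (A i) \<xi>)))) = ennreal (Re (cinner \<xi> (P (\<Union> (range A)) \<xi>)))"
        unfolding Re_cinner by (intro suminf_ennreal_eq)
    qed
  qed (use B in \<open>simp_all add: cinner_P\<close>)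
qed

lemma finite_measure_\<mu>: "finite_measure (\<mu> \<xi>)"
  by (rule finite_measureI) (simp add: emeasure_\<mu>)

lemma measure_\<mu>: "B \<in> sets borel \<Longrightarrow> measure (\<mu> \<xi>) B = (norm (P B \<xi>))\<^sup>2"
  by (simp add: measure_def emeasure_\<mu>)

lemma measurable_\<mu> [simp]: "borel_measurable (\<mu> \<xi>) = borel_measurable borel"
  by (rule measurable_cong_sets) simp_all

lemma \<mu>_scale: "cmod c = 1 \<Longrightarrow> \<mu> (c *\<^sub>C \<xi>) = \<mu> \<xi>"
  by (rule measure_eqI) (auto simp: emeasure_\<mu> P_linear norm_scaleC)

text \<open>Multiplicativity of \<open>P\<close> makes cutting a vector the same as restricting its
  measure, so integrals over parts of the spectrum become quadratic forms at cut vectors.\<close>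

lemma \<mu>_P: "B \<in> sets borel \<Longrightarrow> \<mu> (P B \<xi>) = density (\<mu> \<xi>) (\<lambda>l. ennreal (indicator B l))"
proof (rule measure_eqI)
  fix X assume B: "B \<in> sets borel" and "X \<in> sets (\<mu> (P B \<xi>))"
  then have X: "X \<in> sets borel" by simp
  have "ennreal (indicator B l) * indicator X l = indicator (X \<inter> B) l" for l
    by (auto simp: indicator_def)
  then have "emeasure (density (\<mu> \<xi>) (\<lambda>l. ennreal (indicator B l))) X
      = (\<integral>\<^sup>+l. indicator (X \<inter> B) l \<partial>\<mu> \<xi>)"
    using B X by (subst emeasure_density) (simp_all del: nn_integral_indicator)
  also have "\<dots> = emeasure (\<mu> \<xi>) (X \<inter> B)" using B X by (intro nn_integral_indicator) auto
  finally show "emeasure (\<mu> (P B \<xi>)) X = emeasure (density (\<mu> \<xi>) (\<lambda>l. ennreal (indicator B l))) X"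
    using B X by (simp add: emeasure_\<mu> P_Int)
qed simp

lemma integrable_P:
  fixes f :: "real \<Rightarrow> 'c::{banach, second_countable_topology}"
  assumes "B \<in> sets borel" "f \<in> borel_measurable borel"
  shows "integrable (\<mu> (P B \<xi>)) f \<longleftrightarrow> integrable (\<mu> \<xi>) (\<lambda>l. indicator B l *\<^sub>R f l)"
  unfolding \<mu>_P[OF assms(1)] using assms by (subst integrable_density) auto

lemma integral_P:
  fixes f :: "real \<Rightarrow> 'c::{banach, second_countable_topology}"
  assumes "B \<in> sets borel" "f \<in> borel_measurable borel"
  shows "(\<integral>l. f l \<partial>\<mu> (P B \<xi>)) = (\<integral>l. indicator B l *\<^sub>R f l \<partial>\<mu> \<xi>)"
  unfolding \<mu>_P[OF assms(1)] using assms by (subst integral_density) auto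

lemma integral_split:
  fixes f :: "real \<Rightarrow> 'c::{banach, second_countable_topology}"
  assumes B: "B \<in> sets borel" and f: "integrable (\<mu> \<xi>) f"
  shows "(\<integral>l. f l \<partial>\<mu> \<xi>) = (\<integral>l. f l \<partial>\<mu> (P B \<xi>)) + (\<integral>l. f l \<partial>\<mu> (P (- B) \<xi>))"
proof -
  have fm: "f \<in> borel_measurable borel" using f by (auto dest: borel_measurable_integrable)
  have "f l = indicator B l *\<^sub>R f l + indicator (- B) l *\<^sub>R f l" for l
    by (simp add: indicator_def)
  moreover have "integrable (\<mu> \<xi>) (\<lambda>l. indicator B l *\<^sub>R f l)" "integrable (\<mu> \<xi>) (\<lambda>l. indicator (- B) l *\<^sub>R f l)"
    using B f by (auto intro!: integrable_mult_indicator)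
  ultimately show ?thesis
    using B fm by (simp add: integral_P flip: Bochner_Integration.integral_add)
qed

lemma P_interval_limit: "(\<lambda>n. P {- real n..real n} \<xi>) \<longlonglongrightarrow> \<xi>"
proof -
  interpret finite_measure "\<mu> \<xi>" by (rule finite_measure_\<mu>)
  have "(\<lambda>n. measure (\<mu> \<xi>) (- {- real n..real n})) \<longlonglongrightarrow> measure (\<mu> \<xi>) (\<Inter>n. - {- real n..real n})"
    by (rule finite_Lim_measure_decseq) (auto simp: decseq_def)
  also have "(\<Inter>n. - {- real n..real n}) = {}"
  proof -
    have "\<exists>n. x \<in> {- real n..real n}" for x
      using real_arch_simple[of "\<bar>x\<bar>"] by (auto simp: abs_le_iff minus_le_iff)
    then show ?thesis by blast
  qed
  finally have "(\<lambda>n. sqrt ((norm (P (- {- real n..real n}) \<xi>))\<^sup>2)) \<longlonglongrightarrow> sqrt 0"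
    by (intro tendsto_real_sqrt) (simp add: measure_\<mu>)
  then have "(\<lambda>n. P (- {- real n..real n}) \<xi>) \<longlonglongrightarrow> 0" by (simp add: tendsto_norm_zero_iff)
  then have "(\<lambda>n. \<xi> - P (- {- real n..real n}) \<xi>) \<longlonglongrightarrow> \<xi> - 0" by (intro tendsto_intros)
  moreover have "\<xi> - P (- {- real n..real n}) \<xi> = P {- real n..real n} \<xi>" for n
    by (subst (1) P_split[of "{- real n..real n}" \<xi>]) simp_all
  ultimately show ?thesis by simp
qed

lemma P_eq_zero_iff: "B \<in> sets borel \<Longrightarrow> P B \<xi> = 0 \<longleftrightarrow> (AE l in \<mu> \<xi>. l \<notin> B)"
  by (subst AE_iff_measurable[of B]) (auto simp: emeasure_\<mu>)

end

section \<open>The modular operator without closability\<close>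

text \<open>\<open>S\<close> is treated as an antilinear relation, since the closability of \<open>x \<Omega> \<mapsto> x\<^sup>* \<Omega>\<close> rests on the
  bicommutant theorem for the represented algebra.\<close>

locale tomita_spectral = spectral_projections P
  for P :: "real set \<Rightarrow> 'b::complex_hilbert_space \<Rightarrow> 'b" +
  fixes S :: "('b \<times> 'b) set"
  assumes S_add: "(\<xi>, \<xi>') \<in> S \<Longrightarrow> (\<eta>, \<eta>') \<in> S \<Longrightarrow> (\<xi> + \<eta>, \<xi>' + \<eta>') \<in> S"
    and S_scale: "(\<xi>, \<xi>') \<in> S \<Longrightarrow> (c *\<^sub>C \<xi>, cnj c *\<^sub>C \<xi>') \<in> S"
    and spectral: "is_spectral_measure (S O antilinear_adjoint_graph S) P"
begin

text \<open>The modular operator as a relation. Nothing in this setting shows that it is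
  single-valued, so facts about it are stated for pairs.\<close>

definition A where "A = S O antilinear_adjoint_graph S"

lemma A_iff: "(\<xi>, \<eta>) \<in> A \<longleftrightarrow>
    (\<exists>\<zeta>. (\<xi>, \<zeta>) \<in> S \<and> (\<forall>\<kappa> \<kappa>'. (\<kappa>, \<kappa>') \<in> S \<longrightarrow> cinner \<kappa>' \<zeta> = cinner \<eta> \<kappa>))"
  by (fastforce simp: A_def relcomp_unfold antilinear_adjoint_graph_def)

lemma A_add: assumes "(\<xi>, \<eta>) \<in> A" "(\<xi>', \<eta>') \<in> A" shows "(\<xi> + \<xi>', \<eta> + \<eta>') \<in> A"
proof -
  obtain \<zeta> \<zeta>' where
    "(\<xi>, \<zeta>) \<in> S" "\<And>\<kappa> \<kappa>'. (\<kappa>, \<kappa>') \<in> S \<Longrightarrow> cinner \<kappa>' \<zeta> = cinner \<eta> \<kappa>"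
    "(\<xi>', \<zeta>') \<in> S" "\<And>\<kappa> \<kappa>'. (\<kappa>, \<kappa>') \<in> S \<Longrightarrow> cinner \<kappa>' \<zeta>' = cinner \<eta>' \<kappa>"
    using assms unfolding A_iff by blast
  then show ?thesis
    unfolding A_iff by (intro exI[of _ "\<zeta> + \<zeta>'"]) (simp add: S_add cinner_algebra)
qed

lemma A_scale: assumes "(\<xi>, \<eta>) \<in> A" shows "(c *\<^sub>C \<xi>, c *\<^sub>C \<eta>) \<in> A"
proof -
  obtain \<zeta> where "(\<xi>, \<zeta>) \<in> S" "\<And>\<kappa> \<kappa>'. (\<kappa>, \<kappa>') \<in> S \<Longrightarrow> cinner \<kappa>' \<zeta> = cinner \<eta> \<kappa>"
    using assms unfolding A_iff by blast
  then show ?thesis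
    unfolding A_iff by (intro exI[of _ "cnj c *\<^sub>C \<zeta>"]) (simp add: S_scale cinner_algebra)
qed

lemma A_diff: assumes "(\<xi>, \<eta>) \<in> A" "(\<xi>', \<eta>') \<in> A" shows "(\<xi> - \<xi>', \<eta> - \<eta>') \<in> A"
proof -
  have "(-1) *\<^sub>C x = - x" for x :: 'b using scaleC_of_real[of "-1" x] by simp
  then show ?thesis using A_add[OF assms(1) A_scale[OF assms(2), of "-1"]] by simp
qed

lemma Domain_A: "(\<exists>\<eta>. (\<xi>, \<eta>) \<in> A) \<longleftrightarrow> integrable (\<mu> \<xi>) (\<lambda>l. l\<^sup>2)"
  using spectral by (auto simp: is_spectral_measure_def A_def set_eq_iff Domain_iff)

lemma A_quadratic: "(\<xi>, \<eta>) \<in> A \<Longrightarrow> cinner \<xi> \<eta> = of_real (\<integral>l. l \<partial>\<mu> \<xi>)"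
  using spectral by (auto simp: is_spectral_measure_def A_def)

lemma A_integrable:
  assumes "(\<xi>, \<eta>) \<in> A" shows "integrable (\<mu> \<xi>) (\<lambda>l. l)"
proof -
  interpret finite_measure "\<mu> \<xi>" by (rule finite_measure_\<mu>)
  have i: "integrable (\<mu> \<xi>) (\<lambda>l. 1 + l\<^sup>2)" using assms Domain_A by (intro Bochner_Integration.integrable_add) auto
  have "norm l \<le> norm (1 + l\<^sup>2)" for l :: real
  proof -
    have "0 \<le> (1 - \<bar>l\<bar>)\<^sup>2" by simp
    then have "2 * \<bar>l\<bar> \<le> 1 + l\<^sup>2" by (simp add: power2_diff)
    then show ?thesis by simp
  qed
  then have "AE l in \<mu> \<xi>. norm l \<le> norm (1 + l\<^sup>2)" by simp
  then show ?thesis by (rule Bochner_Integration.integrable_bound[OF i, rotated]) simp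
qed

lemma A_bounded:
  assumes B: "B \<in> sets borel" "B \<subseteq> {- real n..real n}" obtains \<theta> where "(P B \<kappa>, \<theta>) \<in> A"
proof -
  interpret finite_measure "\<mu> \<kappa>" by (rule finite_measure_\<mu>)
  have "integrable (\<mu> \<kappa>) (\<lambda>l. indicator B l *\<^sub>R l\<^sup>2)"
  proof (rule integrable_const_bound[where B = "(real n)\<^sup>2"])
    have "norm (indicator B l *\<^sub>R l\<^sup>2) \<le> (real n)\<^sup>2" for l
    proof (cases "l \<in> B")
      case True
      then have "l \<in> {- real n..real n}" using B(2) by blast
      then have "\<bar>l\<bar> \<le> real n" by (simp add: abs_le_iff)
      then have "l\<^sup>2 \<le> (real n)\<^sup>2" using abs_le_square_iff[of l "real n"] by simp
      then show ?thesis using True by simp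
    qed simp
    then show "AE l in \<mu> \<kappa>. norm (indicator B l *\<^sub>R l\<^sup>2) \<le> (real n)\<^sup>2" by simp
  qed (use B in simp)
  then show ?thesis using Domain_A[of "P B \<kappa>"] integrable_P[OF B(1), of "\<lambda>l. l\<^sup>2" \<kappa>] that by auto
qed

text \<open>For |c| = 1 the integral of l at \<zeta> + c \<zeta>' is the sum of the two separate
  integrals, so the cross terms of the quadratic form cancel. Taking c = 1 and c = i separates
  them.\<close>

lemma A_orthogonal:
  assumes B: "B \<in> sets borel" and A: "(\<zeta>, \<theta>) \<in> A" "(\<zeta>', \<theta>') \<in> A"
    and \<zeta>: "P B \<zeta> = \<zeta>" "P B \<zeta>' = 0"
  shows "cinner \<zeta> \<theta>' = 0" "cinner \<zeta>' \<theta> = 0"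
proof -
  have B': "- B \<in> sets borel" using B by auto
  have \<zeta>B': "P (- B) \<zeta> = 0" "P (- B) \<zeta>' = \<zeta>'"
    using P_split[OF B, of \<zeta>] P_split[OF B, of \<zeta>'] \<zeta> by auto
  have "c * cinner \<zeta> \<theta>' + cnj c * cinner \<zeta>' \<theta> = 0" if c: "cmod c = 1" for c
  proof -
    have AA: "(\<zeta> + c *\<^sub>C \<zeta>', \<theta> + c *\<^sub>C \<theta>') \<in> A" using A by (intro A_add A_scale)
    have "P B (\<zeta> + c *\<^sub>C \<zeta>') = \<zeta>" "P (- B) (\<zeta> + c *\<^sub>C \<zeta>') = c *\<^sub>C \<zeta>'"
      using \<zeta> \<zeta>B' B B' by (simp_all add: P_linear)
    then have "(\<integral>l. l \<partial>\<mu> (\<zeta> + c *\<^sub>C \<zeta>')) = (\<integral>l. l \<partial>\<mu> \<zeta>) + (\<integral>l. l \<partial>\<mu> \<zeta>')"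
      using integral_split[OF B A_integrable[OF AA]] by (simp add: \<mu>_scale[OF c])
    then have "cinner (\<zeta> + c *\<^sub>C \<zeta>') (\<theta> + c *\<^sub>C \<theta>') = cinner \<zeta> \<theta> + cinner \<zeta>' \<theta>'"
      using A_quadratic[OF AA] A_quadratic[OF A(1)] A_quadratic[OF A(2)] by simp
    moreover have "c * cnj c = 1" using c complex_norm_square[of c] by simp
    then have "c * (cnj c * cinner \<zeta>' \<theta>') = cinner \<zeta>' \<theta>'" by (simp flip: mult.assoc)
    moreover have "cinner (\<zeta> + c *\<^sub>C \<zeta>') (\<theta> + c *\<^sub>C \<theta>') = cinner \<zeta> \<theta>
        + (c * cinner \<zeta> \<theta>' + cnj c * cinner \<zeta>' \<theta>) + c * (cnj c * cinner \<zeta>' \<theta>')"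
      by (simp add: cinner_algebra algebra_simps)
    ultimately show ?thesis by simp
  qed
  from this[of 1] this[of \<i>] have "cinner \<zeta> \<theta>' + cinner \<zeta>' \<theta> = 0" "\<i> * (cinner \<zeta> \<theta>' - cinner \<zeta>' \<theta>) = 0"
    by (simp_all add: algebra_simps)
  then show "cinner \<zeta> \<theta>' = 0" "cinner \<zeta>' \<theta> = 0"
    by (auto simp: add_eq_0_iff)
qed

text \<open>Cut to bounded intervals, vectors over the complement of \<open>B\<close> lie in the
  domain of \<open>A\<close>, and \<open>A_orthogonal\<close> applies to them; the cuts converge. In
  effect \<Delta> commutes with \<open>P\<close>.\<close>

lemma A_range:
  assumes B: "B \<in> sets borel" and A: "(\<zeta>, \<theta>) \<in> A" and \<zeta>: "P B \<zeta> = \<zeta>"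
  shows "cinner (P (- B) \<kappa>) \<theta> = 0"
proof -
  have B': "- B \<in> sets borel" using B by auto
  have "cinner (P {- real n..real n} (P (- B) \<kappa>)) \<theta> = 0" for n
  proof -
    define C where "C = {- real n..real n} \<inter> - B"
    have C: "C \<in> sets borel" "C \<subseteq> {- real n..real n}" using B by (auto simp: C_def)
    obtain \<theta>' where \<theta>': "(P C \<kappa>, \<theta>') \<in> A" using A_bounded[OF C] by blast
    have "P B (P C \<kappa>) = 0" using B C by (intro P_disjoint) (auto simp: C_def)
    then have "cinner (P C \<kappa>) \<theta> = 0" by (rule A_orthogonal(2)[OF B A \<theta>' \<zeta>])
    then show ?thesis using P_Int[of "{- real n..real n}" "- B" \<kappa>] B' by (simp add: C_def)
  qed
  moreover have "(\<lambda>n. cinner (P {- real n..real n} (P (- B) \<kappa>)) \<theta>) \<longlonglongrightarrow> cinner (P (- B) \<kappa>) \<theta>"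
    by (intro tendsto_intros P_interval_limit)
  ultimately show ?thesis by (simp add: LIMSEQ_const_iff)
qed

lemma A_norm:
  assumes "(\<xi>, \<eta>) \<in> A" "(\<xi>, \<zeta>) \<in> S" "\<And>\<kappa> \<kappa>'. (\<kappa>, \<kappa>') \<in> S \<Longrightarrow> cinner \<kappa>' \<zeta> = cinner \<eta> \<kappa>"
  shows "(norm \<zeta>)\<^sup>2 = (\<integral>l. l \<partial>\<mu> \<xi>)"
proof -
  have "complex_of_real ((norm \<zeta>)\<^sup>2) = cnj (cinner \<xi> \<eta>)"
    using assms(3)[OF assms(2)] by (metis cinner_self cinner_commute)
  then show ?thesis using A_quadratic[OF assms(1)] by (simp flip: of_real_power)
qed

lemma null_if_integral_zero:
  fixes h :: "real \<Rightarrow> real"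
  assumes B: "B \<in> sets borel" and h: "h \<in> borel_measurable borel" "\<And>l. l \<in> B \<Longrightarrow> 0 < h l"
    and int: "integrable (\<mu> (P B \<xi>)) h" "(\<integral>l. h l \<partial>\<mu> (P B \<xi>)) \<le> 0"
  shows "P B \<xi> = 0"
proof -
  have i: "integrable (\<mu> \<xi>) (\<lambda>l. indicator B l *\<^sub>R h l)" using int(1) integrable_P[OF B h(1)] by simp
  have nn: "AE l in \<mu> \<xi>. 0 \<le> indicator B l *\<^sub>R h l"
    using h(2) by (auto simp: indicator_def less_imp_le)
  have "(\<integral>l. indicator B l *\<^sub>R h l \<partial>\<mu> \<xi>) \<le> 0" using int(2) integral_P[OF B h(1)] by simp
  then have "(\<integral>l. indicator B l *\<^sub>R h l \<partial>\<mu> \<xi>) = 0" using integral_nonneg_AE[OF nn] by simp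
  then have "AE l in \<mu> \<xi>. indicator B l *\<^sub>R h l = 0" using integral_nonneg_eq_0_iff_AE[OF i nn] by simp
  then have "AE l in \<mu> \<xi>. l \<notin> B" by eventually_elim (use h(2) in \<open>force simp: indicator_def split: if_splits\<close>)
  then show ?thesis using P_eq_zero_iff[OF B] by blast
qed

lemma P_exhaustion:
  assumes B: "B \<in> sets borel" and null: "\<And>n. P ({- real n..real n} \<inter> B) \<xi> = 0" shows "P B \<xi> = 0"
proof -
  have "(\<lambda>n. P {- real n..real n} (P B \<xi>)) \<longlonglongrightarrow> P B \<xi>" by (rule P_interval_limit)
  then show ?thesis using null B by (simp add: P_Int LIMSEQ_const_iff)
qed

text \<open>Positivity of the spectrum is not written into \<open>is_spectral_measure\<close>; it
  comes from the form of the operator, for which the integral of l is the squared norm of an image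
  under \<open>S\<close>.\<close>

lemma P_negative: "P {..<0} \<xi> = 0"
proof (rule P_exhaustion)
  fix n
  define B where "B = {- real n..real n} \<inter> {..<0}"
  have B: "B \<in> sets borel" "B \<subseteq> {- real n..real n}" by (auto simp: B_def)
  obtain \<theta> where A: "(P B \<xi>, \<theta>) \<in> A" using A_bounded[OF B] by blast
  then obtain \<zeta> where "(P B \<xi>, \<zeta>) \<in> S" "\<And>\<kappa> \<kappa>'. (\<kappa>, \<kappa>') \<in> S \<Longrightarrow> cinner \<kappa>' \<zeta> = cinner \<theta> \<kappa>"
    unfolding A_iff by blast
  from A_norm[OF A this] have nn: "0 \<le> (\<integral>l. l \<partial>\<mu> (P B \<xi>))" by (metis zero_le_power2)
  show "P B \<xi> = 0"
  proof (rule null_if_integral_zero[OF B(1), of uminus])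
    show "integrable (\<mu> (P B \<xi>)) uminus" using A_integrable[OF A] by simp
    show "(\<integral>l. - l \<partial>\<mu> (P B \<xi>)) \<le> 0" using nn by simp
  qed (auto simp: B_def)
qed simp

lemma AE_nonneg: "AE l in \<mu> \<xi>. 0 \<le> l"
  using P_negative[of \<xi>] P_eq_zero_iff[of "{..<0}" \<xi>] by (auto simp: not_less)

text \<open>Formally b = <\<Delta>P\<xi>, \<xi>> = <S\<xi>, SP\<xi>> with |SP\<xi>|^2 = b, and
  Cauchy-Schwarz gives b <= |S\<xi>|^2. In the proof \<omega> is the image of the cut vector that
  belongs to a pair in \<open>A\<close>, while \<xi>' is any image of \<xi>.\<close>

lemma S_integral_bounded:
  assumes S: "(\<xi>, \<xi>') \<in> S" and B: "B \<in> sets borel" "B \<subseteq> {- real n..real n}"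
  shows "(\<integral>l. l \<partial>\<mu> (P B \<xi>)) \<le> (norm \<xi>')\<^sup>2"
proof -
  define b where "b = (\<integral>l. l \<partial>\<mu> (P B \<xi>))"
  obtain \<theta> where A: "(P B \<xi>, \<theta>) \<in> A" using A_bounded[OF B] by blast
  then obtain \<omega> where \<omega>: "(P B \<xi>, \<omega>) \<in> S" "\<And>\<kappa> \<kappa>'. (\<kappa>, \<kappa>') \<in> S \<Longrightarrow> cinner \<kappa>' \<omega> = cinner \<theta> \<kappa>"
    unfolding A_iff by blast
  have norm_\<omega>: "(norm \<omega>)\<^sup>2 = b" unfolding b_def by (rule A_norm[OF A \<omega>])
  have "cinner (P (- B) \<xi>) \<theta> = 0" by (rule A_range[OF B(1) A P_idem[OF B(1)]])
  then have "cinner \<theta> (P (- B) \<xi>) = 0" by (metis cinner_commute complex_cnj_zero)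
  then have "cinner \<theta> \<xi> = cinner \<theta> (P B \<xi>)"
    by (subst P_split[OF B(1), of \<xi>]) (simp add: cinner_add_right)
  also have "\<dots> = of_real b"
    using A_quadratic[OF A] by (metis b_def cinner_commute complex_cnj_complex_of_real)
  finally have "of_real b = cinner \<xi>' \<omega>" using \<omega>(2)[OF S] by simp
  then have "\<bar>b\<bar> \<le> norm \<xi>' * norm \<omega>" using cinner_cauchy_schwarz[of \<xi>' \<omega>] by (metis norm_of_real)
  moreover have "b = norm \<omega> * norm \<omega>" using norm_\<omega> by (simp add: power2_eq_square)
  ultimately have "norm \<omega> * norm \<omega> \<le> norm \<xi>' * norm \<omega>" by simp
  then have "norm \<omega> \<le> norm \<xi>'" by (cases "\<omega> = 0") auto
  then have "(norm \<omega>)\<^sup>2 \<le> (norm \<xi>')\<^sup>2" by (intro power_mono) auto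
  then show ?thesis using norm_\<omega> by (simp add: b_def)
qed

text \<open>Monotone convergence along bounded intervals. Only a bound is claimed, since \<xi> may
  have several images under \<open>S\<close>.\<close>

lemma S_integral:
  assumes S: "(\<xi>, \<xi>') \<in> S"
  shows "integrable (\<mu> \<xi>) (\<lambda>l. l)" "(\<integral>l. l \<partial>\<mu> \<xi>) \<le> (norm \<xi>')\<^sup>2"
proof -
  define B where "B n = {- real n..real n}" for n
  have B: "B n \<in> sets borel" "B n \<subseteq> {- real n..real n}" for n by (auto simp: B_def)
  define g where "g n l = indicator (B n) l *\<^sub>R l" for n and l :: real
  have gi: "integrable (\<mu> \<xi>) (g n)" for n
  proof -
    obtain \<theta> where "(P (B n) \<xi>, \<theta>) \<in> A" using A_bounded[OF B] by blast
    from A_integrable[OF this] show ?thesis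
      using integrable_P[OF B(1), of "\<lambda>l. l" n \<xi>] by (simp add: g_def[abs_def])
  qed
  have ginc: "AE l in \<mu> \<xi>. mono (\<lambda>n. g n l)"
    using AE_nonneg[of \<xi>] by eventually_elim (auto simp: mono_def g_def B_def indicator_def)
  have glim: "AE l in \<mu> \<xi>. (\<lambda>n. g n l) \<longlonglongrightarrow> l"
  proof (rule AE_I2)
    fix l :: real
    obtain k :: nat where "\<bar>l\<bar> \<le> real k" using real_arch_simple by blast
    then have "g n l = l" if "n \<ge> k" for n using that by (auto simp: g_def B_def indicator_def)
    then show "(\<lambda>n. g n l) \<longlonglongrightarrow> l" by (auto intro!: tendsto_eventually eventually_sequentiallyI[of k])
  qed
  have gb: "(\<integral>l. g n l \<partial>\<mu> \<xi>) \<le> (norm \<xi>')\<^sup>2" for n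
    using S_integral_bounded[OF S B, of n] integral_P[OF B(1), of "\<lambda>l. l" n \<xi>]
    by (simp add: g_def[abs_def])
  have "incseq (\<lambda>n. \<integral>l. g n l \<partial>\<mu> \<xi>)"
    unfolding incseq_def using ginc
    by (auto intro!: integral_mono_AE gi elim!: eventually_mono simp: mono_def)
  then obtain x where x: "(\<lambda>n. \<integral>l. g n l \<partial>\<mu> \<xi>) \<longlonglongrightarrow> x"
    using incseq_convergent[of _ "(norm \<xi>')\<^sup>2"] gb by blast
  have "x \<le> (norm \<xi>')\<^sup>2" by (rule LIMSEQ_le_const2[OF x]) (use gb in auto)
  moreover have "integrable (\<mu> \<xi>) (\<lambda>l. l)" "(\<integral>l. l \<partial>\<mu> \<xi>) = x"
    by (rule integrable_monotone_convergence[OF gi ginc glim x], simp)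
      (rule integral_monotone_convergence[OF gi ginc glim x], simp)
  ultimately show "integrable (\<mu> \<xi>) (\<lambda>l. l)" "(\<integral>l. l \<partial>\<mu> \<xi>) \<le> (norm \<xi>')\<^sup>2" by simp_all
qed

text \<open>The parts of \<Omega> over a bounded \<open>B\<close> and off it decouple, which makes
  the integral of l - 1 over \<open>B\<close> vanish. Above 1 and below 1 the integrand has a strict
  sign, so neither side carries mass.\<close>

lemma fixed_vector:
  assumes A: "(\<Omega>, \<Omega>) \<in> A" shows "P {1} \<Omega> = \<Omega>"
proof -
  have zero: "(\<integral>l. l - 1 \<partial>\<mu> (P B \<Omega>)) = 0" "integrable (\<mu> (P B \<Omega>)) (\<lambda>l. l - 1)"
    if B: "B \<in> sets borel" "B \<subseteq> {- real n..real n}" for B n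
  proof -
    interpret finite_measure "\<mu> (P B \<Omega>)" by (rule finite_measure_\<mu>)
    obtain \<theta> where \<theta>: "(P B \<Omega>, \<theta>) \<in> A" using A_bounded[OF B] by blast
    have "(\<Omega> - P B \<Omega>, \<Omega> - \<theta>) \<in> A" by (rule A_diff[OF A \<theta>])
    moreover have "P B (\<Omega> - P B \<Omega>) = 0" using B by (simp add: P_linear P_idem)
    ultimately have "cinner (P B \<Omega>) (\<Omega> - \<theta>) = 0"
      by (rule A_orthogonal(1)[OF B(1) \<theta> _ P_idem[OF B(1)]])
    then have "cinner (P B \<Omega>) \<Omega> = of_real (\<integral>l. l \<partial>\<mu> (P B \<Omega>))"
      using A_quadratic[OF \<theta>] by (simp add: cinner_diff_right)
    moreover have "cinner (P B \<Omega>) \<Omega> = of_real (measure (\<mu> (P B \<Omega>)) UNIV)"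
      using B by (simp add: P_selfadjoint cinner_P measure_\<mu>)
    ultimately have eq: "(\<integral>l. l \<partial>\<mu> (P B \<Omega>)) = measure (\<mu> (P B \<Omega>)) UNIV"
      by (simp only: of_real_eq_iff)
    show "integrable (\<mu> (P B \<Omega>)) (\<lambda>l. l - 1)" using A_integrable[OF \<theta>] by simp
    show "(\<integral>l. l - 1 \<partial>\<mu> (P B \<Omega>)) = 0" using A_integrable[OF \<theta>] eq by simp
  qed
  have "P {1<..} \<Omega> = 0"
  proof (rule P_exhaustion)
    fix n
    define B where "B = {- real n..real n} \<inter> {1<..}"
    have B: "B \<in> sets borel" "B \<subseteq> {- real n..real n}" by (auto simp: B_def)
    show "P B \<Omega> = 0"
      by (rule null_if_integral_zero[OF B(1), of "\<lambda>l. l - 1"]) (use zero[OF B] in \<open>auto simp: B_def\<close>)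
  qed simp
  moreover have "P {..<1} \<Omega> = 0"
  proof (rule P_exhaustion)
    fix n
    define B where "B = {- real n..real n} \<inter> {..<1}"
    have B: "B \<in> sets borel" "B \<subseteq> {- real n..real n}" by (auto simp: B_def)
    have "(\<integral>l. - (l - 1) \<partial>\<mu> (P B \<Omega>)) = 0" "integrable (\<mu> (P B \<Omega>)) (\<lambda>l. - (l - 1))"
      using zero[OF B] by (simp_all only: Bochner_Integration.integral_minus integrable_minus minus_zero)
    then show "P B \<Omega> = 0"
      by (intro null_if_integral_zero[OF B(1), of "\<lambda>l. - (l - 1)"]) (auto simp: B_def)
  qed simp
  moreover have "P (- {1}) \<Omega> = P {..<1} \<Omega> + P {1<..} \<Omega>"
  proof -
    have "- {1::real} = {..<1} \<union> {1<..}" by auto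
    moreover have "P ({..<1} \<union> {1<..}) \<Omega> = P {..<1} \<Omega> + P {1<..} \<Omega>" by (rule P_Un) auto
    ultimately show ?thesis by simp
  qed
  ultimately show ?thesis using P_split[of "{1}" \<Omega>] by simp
qed

text \<open>The domain condition provides some \<eta> with \<open>(\<xi>, \<eta>) \<in> A\<close>.
  Polarising the quadratic form inside the range of \<open>P {1}\<close>, and using
  \<open>A_range\<close> off it, identifies \<eta> with \<xi>.\<close>

lemma A_eigenvector:
  assumes \<xi>: "P {1} \<xi> = \<xi>" shows "(\<xi>, \<xi>) \<in> A" "(\<integral>l. l \<partial>\<mu> \<xi>) = (norm \<xi>)\<^sup>2"
proof -
  have int1: "(\<integral>l. l \<partial>\<mu> (P {1} \<kappa>)) = (norm (P {1} \<kappa>))\<^sup>2" for \<kappa>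
  proof -
    have "(\<integral>l. l \<partial>\<mu> (P {1} \<kappa>)) = (\<integral>l. indicator {1} l *\<^sub>R l \<partial>\<mu> \<kappa>)" by (rule integral_P) auto
    also have "\<dots> = (\<integral>l. indicator {1} l \<partial>\<mu> \<kappa>)"
      by (intro Bochner_Integration.integral_cong) (auto simp: indicator_def)
    also have "\<dots> = (norm (P {1} \<kappa>))\<^sup>2" by (simp add: measure_\<mu>)
    finally show ?thesis .
  qed
  then show "(\<integral>l. l \<partial>\<mu> \<xi>) = (norm \<xi>)\<^sup>2" using \<xi> by metis
  obtain \<eta> where \<eta>: "(\<xi>, \<eta>) \<in> A" using A_bounded[of "{1}" 1 \<xi>] \<xi> by auto
  have "\<eta> = \<xi>"
  proof (rule cinner_eqI)
    fix \<kappa>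
    define \<kappa>1 where "\<kappa>1 = P {1} \<kappa>"
    have \<kappa>1: "P {1} \<kappa>1 = \<kappa>1" by (simp add: \<kappa>1_def P_idem)
    obtain \<theta> where \<theta>: "(\<kappa>1, \<theta>) \<in> A" using A_bounded[of "{1}" 1 \<kappa>] by (auto simp: \<kappa>1_def)
    have quad: "cinner x y = of_real ((norm x)\<^sup>2)" if "(x, y) \<in> A" "P {1} x = x" for x y
      using A_quadratic[OF that(1)] int1[of x] that(2) by simp
    have "c * cinner \<kappa>1 \<eta> + cnj c * cinner \<xi> \<theta> = c * cinner \<kappa>1 \<xi> + cnj c * cinner \<xi> \<kappa>1" for c
    proof -
      have "(\<kappa>1 + c *\<^sub>C \<xi>, \<theta> + c *\<^sub>C \<eta>) \<in> A" by (intro A_add A_scale \<theta> \<eta>)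
      moreover have "P {1} (\<kappa>1 + c *\<^sub>C \<xi>) = \<kappa>1 + c *\<^sub>C \<xi>" by (simp add: P_linear \<kappa>1 \<xi>)
      ultimately have "cinner (\<kappa>1 + c *\<^sub>C \<xi>) (\<theta> + c *\<^sub>C \<eta>) = cinner (\<kappa>1 + c *\<^sub>C \<xi>) (\<kappa>1 + c *\<^sub>C \<xi>)"
        using quad by (simp add: cinner_self)
      moreover have "cinner \<kappa>1 \<theta> = cinner \<kappa>1 \<kappa>1" "cinner \<xi> \<eta> = cinner \<xi> \<xi>"
        using quad[OF \<theta> \<kappa>1] quad[OF \<eta> \<xi>] by (simp_all add: cinner_self)
      ultimately show ?thesis by (simp add: cinner_algebra algebra_simps)
    qed
    from this[of 1] this[of \<i>] have "cinner \<kappa>1 \<eta> + cinner \<xi> \<theta> = cinner \<kappa>1 \<xi> + cinner \<xi> \<kappa>1"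
      "\<i> * (cinner \<kappa>1 \<eta> - cinner \<xi> \<theta>) = \<i> * (cinner \<kappa>1 \<xi> - cinner \<xi> \<kappa>1)"
      by (simp_all add: algebra_simps)
    then have "(cinner \<kappa>1 \<eta> + cinner \<xi> \<theta>) + (cinner \<kappa>1 \<eta> - cinner \<xi> \<theta>)
        = (cinner \<kappa>1 \<xi> + cinner \<xi> \<kappa>1) + (cinner \<kappa>1 \<xi> - cinner \<xi> \<kappa>1)" by simp
    then have 1: "cinner \<kappa>1 \<eta> = cinner \<kappa>1 \<xi>" by simp
    have "cinner (P (- {1}) \<kappa>) \<eta> = 0" by (rule A_range[OF _ \<eta> \<xi>]) simp
    moreover have "cinner (P (- {1}) \<kappa>) \<xi> = 0"
    proof -
      have "P (- {1}) \<xi> = 0" using P_split[of "{1}" \<xi>] \<xi> by simp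
      then show ?thesis by (simp add: P_selfadjoint)
    qed
    ultimately show "cinner \<kappa> \<eta> = cinner \<kappa> \<xi>"
      using 1 by (subst (1 2) P_split[of "{1}" \<kappa>]) (simp_all add: cinner_add_left \<kappa>1_def)
  qed
  then show "(\<xi>, \<xi>) \<in> A" using \<eta> by simp
qed

text \<open>If \<open>(\<xi>, \<xi>') \<in> S\<close> with \<open>\<Delta> \<xi> = \<xi>\<close> and \<open>\<parallel>\<xi>'\<parallel> = \<parallel>\<xi>\<parallel>\<close>, then \<open>\<xi>'\<close> is orthogonal to the multivalued
  part of \<open>S\<close>, which makes up for the missing closability.\<close>

lemma S_eigenvector:
  assumes S: "(\<xi>, \<xi>') \<in> S" and \<xi>: "P {1} \<xi> = \<xi>" and norm: "norm \<xi>' = norm \<xi>"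
    and \<kappa>: "(\<kappa>, \<kappa>') \<in> S"
  shows "cinner \<kappa>' \<xi>' = cinner \<xi> \<kappa>"
proof -
  obtain \<zeta> where \<zeta>: "(\<xi>, \<zeta>) \<in> S" "\<And>\<kappa> \<kappa>'. (\<kappa>, \<kappa>') \<in> S \<Longrightarrow> cinner \<kappa>' \<zeta> = cinner \<xi> \<kappa>"
    using A_eigenvector(1)[OF \<xi>] unfolding A_iff by blast
  have n: "(norm \<zeta>)\<^sup>2 = (norm \<xi>)\<^sup>2"
    using A_norm[OF A_eigenvector(1)[OF \<xi>] \<zeta>] A_eigenvector(2)[OF \<xi>] by simp
  have "(-1) *\<^sub>C x = - x" for x :: 'b using scaleC_of_real[of "-1" x] by simp
  \<comment> \<open>Two images of \<xi> differ by an image of 0, to which \<zeta> is orthogonal; as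
    the norms agree, Pythagoras leaves no difference.\<close>
  then have "(0, \<zeta> - \<xi>') \<in> S" using S_add[OF \<zeta>(1) S_scale[OF S, of "-1"]] by simp
  from \<zeta>(2)[OF this] have "cinner \<xi>' \<zeta> = cinner \<zeta> \<zeta>" by (simp add: cinner_diff_left)
  then have "inner \<xi>' \<zeta> = inner \<zeta> \<zeta>" by (metis Re_cinner)
  moreover have "(norm (\<zeta> - \<xi>'))\<^sup>2 = (norm \<zeta>)\<^sup>2 - 2 * inner \<xi>' \<zeta> + (norm \<xi>')\<^sup>2"
    by (simp add: power2_norm_eq_inner inner_diff_left inner_diff_right inner_commute)
  ultimately have "(norm (\<zeta> - \<xi>'))\<^sup>2 = 0"
    using n norm by (simp only: power2_norm_eq_inner[symmetric])
  then have "\<zeta> = \<xi>'" by simp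
  then show ?thesis using \<zeta>(2)[OF \<kappa>] by simp
qed

end

section \<open>Imaginary powers of the modular operator\<close>

locale imaginary_powers = tomita_spectral P S
  for P :: "real set \<Rightarrow> 'b::complex_hilbert_space \<Rightarrow> 'b" and S :: "('b \<times> 'b) set" +
  fixes u :: "real \<Rightarrow> 'b \<Rightarrow> 'b"
  assumes u: "is_spectral_integral P (\<lambda>l. complex_of_real l powr (\<i> * complex_of_real s)) (u s)"
begin

definition pw where "pw s l = complex_of_real l powr (\<i> * complex_of_real s)"

lemma pw_measurable [measurable, simp]: "pw s \<in> borel_measurable borel"
proof -
  \<comment> \<open>\<open>powr\<close> is 0 at base 0, and the logarithm picks up \<i> times pi at
    negative base; measurability on the whole line needs both cases spelled out.\<close>
  have "pw s = (\<lambda>l. if l = 0 then 0 else exp (\<i> * of_real s *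
      (of_real (ln \<bar>l\<bar>) + (if l < 0 then of_real pi * \<i> else 0))))"
    by (auto simp: pw_def powr_def Ln_of_real')
  then show ?thesis by simp
qed

lemma pw_pos: "0 < l \<Longrightarrow> pw s l = iexp (s * ln l)"
  by (simp add: pw_def powr_def Ln_of_real mult.assoc)

lemma norm_pw_le: "0 \<le> l \<Longrightarrow> norm (pw s l) \<le> 1"
  by (cases "l = 0") (auto simp: pw_pos, simp add: pw_def)

lemma pw_integrable: "integrable (\<mu> \<xi>) (pw s)"
proof -
  interpret finite_measure "\<mu> \<xi>" by (rule finite_measure_\<mu>)
  show ?thesis
    by (rule integrable_const_bound[where B = 1])
      (use AE_nonneg[of \<xi>] in \<open>auto elim!: eventually_mono intro: norm_pw_le\<close>)
qed

lemma u_form: "cinner \<xi> (u s \<xi>) = (\<integral>l. pw s l \<partial>\<mu> \<xi>)" and u_clinear: "bounded_clinear (u s)"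
  using u[of s] by (simp_all add: is_spectral_integral_def pw_def)

lemma u_adj: "adj (u s) = u (- s)"
proof (rule quadratic_form_determines[OF bounded_clinear_adj[OF u_clinear] u_clinear])
  fix \<xi>
  have "cinner \<xi> (adj (u s) \<xi>) = cnj (\<integral>l. pw s l \<partial>\<mu> \<xi>)"
    by (metis cinner_adj_left cinner_commute u_clinear u_form)
  also have "\<dots> = (\<integral>l. cnj (pw s l) \<partial>\<mu> \<xi>)" by (rule Bochner_Integration.integral_cnj[symmetric])
  also have "\<dots> = (\<integral>l. pw (- s) l \<partial>\<mu> \<xi>)"
  proof (rule integral_cong_AE)
    have "cnj (pw s l) = pw (- s) l" if "0 \<le> l" for l
      using that by (cases "l = 0") (auto simp: pw_pos exp_cnj, simp add: pw_def)
    then show "AE l in \<mu> \<xi>. cnj (pw s l) = pw (- s) l"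
      using AE_nonneg[of \<xi>] by (auto elim: eventually_mono)
    have "cnj \<in> borel_measurable borel"
      by (intro borel_measurable_continuous_onI continuous_intros)
    from measurable_compose[OF pw_measurable this]
    show "(\<lambda>l. cnj (pw s l)) \<in> borel_measurable (\<mu> \<xi>)" by simp
  qed simp
  finally show "cinner \<xi> (adj (u s) \<xi>) = cinner \<xi> (u (- s) \<xi>)" by (simp add: u_form)
qed

text \<open>\<open>u s\<close> is known by its quadratic form only. The operator \<open>w\<close>,
  equal to the identity over {1} and to a compression of \<open>u s\<close> elsewhere, has the same
  form and hence is \<open>u s\<close>.\<close>

lemma u_fixed: assumes "P {1} \<xi> = \<xi>" shows "u s \<xi> = \<xi>"
proof -
  have one: "(\<integral>l. pw s l \<partial>\<mu> (P {1} \<kappa>)) = cinner \<kappa> (P {1} \<kappa>)" for \<kappa>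
  proof -
    have "(\<integral>l. pw s l \<partial>\<mu> (P {1} \<kappa>)) = (\<integral>l. indicator {1} l *\<^sub>R pw s l \<partial>\<mu> \<kappa>)"
      by (rule integral_P) auto
    also have "\<dots> = (\<integral>l. complex_of_real (indicator {1} l) \<partial>\<mu> \<kappa>)"
      by (intro Bochner_Integration.integral_cong) (auto simp: indicator_def pw_pos)
    also have "\<dots> = of_real ((norm (P {1} \<kappa>))\<^sup>2)" by (simp add: measure_\<mu>)
    finally show ?thesis by (simp add: cinner_P)
  qed
  have P: "bounded_clinear (P B)" if "B \<in> sets borel" for B using that by (rule P_clinear)
  define w where "w \<kappa> = P {1} \<kappa> + P (- {1}) (u s (P (- {1}) \<kappa>))" for \<kappa>
  have uw: "u s = w"
  proof (rule quadratic_form_determines[OF u_clinear])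
    have "bounded_clinear (\<lambda>\<kappa>. (P (- {1}) \<circ> (u s \<circ> P (- {1}))) \<kappa>)"
      by (intro bounded_clinear_comp P u_clinear) auto
    then show "bounded_clinear w"
      unfolding w_def by (intro bounded_clinear_add P) (auto simp: o_def)
    fix \<kappa>
    have "cinner \<kappa> (u s \<kappa>) = (\<integral>l. pw s l \<partial>\<mu> (P {1} \<kappa>)) + (\<integral>l. pw s l \<partial>\<mu> (P (- {1}) \<kappa>))"
      unfolding u_form by (rule integral_split[OF _ pw_integrable]) simp
    also have "\<dots> = cinner \<kappa> (P {1} \<kappa>) + cinner (P (- {1}) \<kappa>) (u s (P (- {1}) \<kappa>))"
      by (simp add: one u_form)
    also have "\<dots> = cinner \<kappa> (w \<kappa>)" by (simp add: w_def P_selfadjoint cinner_add_right)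
    finally show "cinner \<kappa> (u s \<kappa>) = cinner \<kappa> (w \<kappa>)" .
  qed
  have "P (- {1}) \<xi> = 0" using P_split[of "{1}" \<xi>] assms by simp
  moreover have "u s 0 = 0"
    using u_clinear[of s] linear_0[OF bounded_linear.linear] by (auto simp: bounded_clinear_def)
  ultimately have "w \<xi> = \<xi>" using assms by (simp add: w_def P_linear)
  then show ?thesis by (simp only: uw)
qed

text \<open>As \<open>0 powr 0 = 0\<close>, the power with exponent 0 is the projection off the
  kernel of \<Delta> rather than the identity. Surjectivity of \<open>\<sigma> 0\<close> on
  \<open>N\<close> will place the vectors of \<open>N\<close> in its range.\<close>

lemma u_zero: "u 0 = P (- {0})"
proof (rule quadratic_form_determines[OF u_clinear P_clinear])
  fix \<xi>
  have "cinner \<xi> (u 0 \<xi>) = (\<integral>l. complex_of_real (indicator (- {0}) l) \<partial>\<mu> \<xi>)"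
    unfolding u_form by (intro Bochner_Integration.integral_cong) (auto simp: indicator_def pw_def)
  also have "\<dots> = of_real ((norm (P (- {0}) \<xi>))\<^sup>2)" by (simp add: measure_\<mu>)
  finally show "cinner \<xi> (u 0 \<xi>) = cinner \<xi> (P (- {0}) \<xi>)" by (simp add: cinner_P)
qed simp

text \<open>\<open>form\<close> relates the characteristic functions on the logarithmic scale,
  \<open>norm\<close> makes both masses and both integral bounds equal to |\<xi>|^2, and
  \<open>zero\<close> makes the logarithm available almost everywhere.\<close>

lemma fixed_if_symmetric:
  assumes S: "(\<xi>, \<xi>') \<in> S" "(\<xi>', \<xi>) \<in> S" and norm: "norm \<xi>' = norm \<xi>"
    and zero: "P {0} \<xi> = 0" "P {0} \<xi>' = 0"
    and form: "\<And>s. cinner \<xi>' (u s \<xi>') = cnj (cinner \<xi> (u s \<xi>))"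
  shows "P {1} \<xi> = \<xi>"
proof -
  have pos: "AE l in \<mu> \<eta>. 0 < l" if "P {0} \<eta> = 0" for \<eta>
  proof -
    have "AE l in \<mu> \<eta>. l \<notin> {0}" using that P_eq_zero_iff[of "{0}" \<eta>] by simp
    then show ?thesis using AE_nonneg[of \<eta>] by eventually_elim auto
  qed
  have pw: "(\<integral>l. iexp (s * ln l) \<partial>\<mu> \<eta>) = cinner \<eta> (u s \<eta>)" if "P {0} \<eta> = 0" for \<eta> s
    unfolding u_form
  proof (rule integral_cong_AE)
    show "AE l in \<mu> \<eta>. iexp (s * ln l) = pw s l"
      using pos[OF that] by eventually_elim (simp add: pw_pos)
  qed auto
  have "AE l in \<mu> \<xi>. l = 1"
  proof (rule concentrated_at_one[where \<nu>' = "\<mu> \<xi>'" and m = "(norm \<xi>)\<^sup>2"])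
    show "(\<integral>l. iexp (s * ln l) \<partial>\<mu> \<xi>') = cnj (\<integral>l. iexp (s * ln l) \<partial>\<mu> \<xi>)" for s
      unfolding pw[OF zero(1)] pw[OF zero(2)] by (rule form)
    show "(\<integral>l. l \<partial>\<mu> \<xi>) \<le> (norm \<xi>)\<^sup>2" using S_integral(2)[OF S(1)] norm by simp
  qed (use S_integral[OF S(1)] S_integral[OF S(2)] norm pos zero
      in \<open>auto simp: finite_measure_\<mu> measure_\<mu>\<close>)
  then have "AE l in \<mu> \<xi>. l \<notin> - {1}" by simp
  then have "P (- {1}) \<xi> = 0" using P_eq_zero_iff[of "- {1}" \<xi>] by simp
  then show ?thesis using P_split[of "{1}" \<xi>] by simp
qed

end

section \<open>Invariant abelian subalgebras lie in the centralizer\<close>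

lemma adj_add:
  "bounded_clinear x \<Longrightarrow> bounded_clinear y \<Longrightarrow> adj (\<lambda>\<xi>. x \<xi> + y \<xi>) = (\<lambda>\<xi>. adj x \<xi> + adj y \<xi>)"
  by (rule adj_eqI) (auto simp: bounded_clinear_add cinner_algebra cinner_adj_left)

lemma adj_scaleC: "bounded_clinear x \<Longrightarrow> adj (\<lambda>\<xi>. c *\<^sub>C x \<xi>) = (\<lambda>\<xi>. cnj c *\<^sub>C adj x \<xi>)"
  by (rule adj_eqI) (auto simp: bounded_clinear_scaleC cinner_algebra cinner_adj_left)

lemma adj_adj: "bounded_clinear x \<Longrightarrow> adj (adj x) = x"
  by (rule adj_eqI) (auto simp: bounded_clinear_adj, metis cinner_adj_left cinner_commute)

lemma closure_add_mem:
  fixes T :: "'a::real_normed_vector set"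
  assumes "\<And>x y. x \<in> T \<Longrightarrow> y \<in> T \<Longrightarrow> x + y \<in> T" "p \<in> closure T" "q \<in> closure T"
  shows "p + q \<in> closure T"
proof -
  obtain x y where x: "\<forall>n. x n \<in> T" "x \<longlonglongrightarrow> p" and y: "\<forall>n. y n \<in> T" "y \<longlonglongrightarrow> q"
    using assms(2,3) by (auto simp: closure_sequential)
  then show ?thesis
    unfolding closure_sequential using assms(1) tendsto_add[OF x(2) y(2)]
    by (intro exI[of _ "\<lambda>n. x n + y n"]) auto
qed

theorem modular_group_central:
  fixes M N :: "('a::complex_hilbert_space \<Rightarrow> 'a) set"
    and \<pi> :: "('a \<Rightarrow> 'a) \<Rightarrow> ('b::complex_hilbert_space \<Rightarrow> 'b)"
  assumes M: "star_subalgebra M" "is_unit_of M e"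
    and N: "star_subalgebra N" "N \<subseteq> M" "abelian N"
    and modular: "is_modular_group M \<psi> \<pi> \<Omega> \<sigma>" and inv: "\<And>s. \<sigma> s ` N = N"
    and a: "a \<in> N" and x: "x \<in> M"
  shows "\<psi> (a \<circ> x) = \<psi> (x \<circ> a)"
proof -
  obtain u where gns: "gns_representation M \<psi> \<pi> \<Omega>"
    and u: "is_imaginary_powers (modular_operator_graph M \<pi> \<Omega>) u"
    and \<sigma>: "\<And>s x. x \<in> M \<Longrightarrow> \<pi> (\<sigma> s x) = u s \<circ> \<pi> x \<circ> u (- s)"
    using modular unfolding is_modular_group_def by blast
  define S where "S = tomita_graph M \<pi> \<Omega>"
  obtain P where P: "is_spectral_measure (S O antilinear_adjoint_graph S) P"
    and uP: "\<And>s. is_spectral_integral P (\<lambda>l. complex_of_real l powr (\<i> * complex_of_real s)) (u s)"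
    using u unfolding is_imaginary_powers_def modular_operator_graph_def S_def by blast
  have Mb: "bounded_clinear x" and \<pi>b: "bounded_clinear (\<pi> x)" and Madj: "adj x \<in> M"
    and \<pi>adj: "\<pi> (adj x) = adj (\<pi> x)" if "x \<in> M" for x
    using M(1) gns that by (auto simp: star_subalgebra_def gns_representation_def)
  have Madd: "(\<lambda>\<xi>. x \<xi> + y \<xi>) \<in> M" and \<pi>add: "\<pi> (\<lambda>\<xi>. x \<xi> + y \<xi>) = (\<lambda>\<xi>. \<pi> x \<xi> + \<pi> y \<xi>)"
    and \<pi>mult: "\<pi> (x \<circ> y) = \<pi> x \<circ> \<pi> y" and Mmult: "x \<circ> y \<in> M" if "x \<in> M" "y \<in> M" for x y
    using M(1) gns that by (auto simp: star_subalgebra_def gns_representation_def)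
  have Mscale: "(\<lambda>\<xi>. c *\<^sub>C x \<xi>) \<in> M" and \<pi>scale: "\<pi> (\<lambda>\<xi>. c *\<^sub>C x \<xi>) = (\<lambda>\<xi>. c *\<^sub>C \<pi> x \<xi>)" if "x \<in> M" for x c
    using M(1) gns that by (auto simp: star_subalgebra_def gns_representation_def)
  have \<psi>: "\<psi> x = cinner \<Omega> (\<pi> x \<Omega>)" if "x \<in> M" for x
    using gns that by (auto simp: gns_representation_def)
  have dense: "closure ((\<lambda>x. \<pi> x \<Omega>) ` M) = UNIV"
    using gns by (auto simp: gns_representation_def)
  have Nadj: "adj x \<in> N" if "x \<in> N" for x using N(1) that by (auto simp: star_subalgebra_def)
  define T where "T = (\<lambda>x. (\<pi> x \<Omega>, \<pi> (adj x) \<Omega>)) ` M"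
  have ST: "S = closure T" by (simp add: S_def T_def tomita_graph_def)
  have inS: "(\<pi> x \<Omega>, \<pi> (adj x) \<Omega>) \<in> S" if "x \<in> M" for x
  proof -
    have "(\<pi> x \<Omega>, \<pi> (adj x) \<Omega>) \<in> T" unfolding T_def using that by (rule imageI)
    then show ?thesis unfolding ST by (rule closure_subset[THEN subsetD])
  qed
  interpret imaginary_powers P S u
  proof
    show "projection_valued_measure P" using P by (simp add: is_spectral_measure_def)
    have Tadd: "p + q \<in> T" if pq: "p \<in> T" "q \<in> T" for p q
    proof -
      obtain x y where xy: "x \<in> M" "y \<in> M" "p = (\<pi> x \<Omega>, \<pi> (adj x) \<Omega>)" "q = (\<pi> y \<Omega>, \<pi> (adj y) \<Omega>)"
        using pq by (auto simp: T_def)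
      have "p + q = (\<pi> (\<lambda>\<xi>. x \<xi> + y \<xi>) \<Omega>, \<pi> (adj (\<lambda>\<xi>. x \<xi> + y \<xi>)) \<Omega>)"
        using xy(1,2) by (simp add: xy(3,4) \<pi>add adj_add Mb Madj)
      then show ?thesis unfolding T_def using Madd[OF xy(1,2)] by blast
    qed
    show "(\<xi> + \<eta>, \<xi>' + \<eta>') \<in> S" if "(\<xi>, \<xi>') \<in> S" "(\<eta>, \<eta>') \<in> S" for \<xi> \<xi>' \<eta> \<eta>'
      using closure_add_mem[of T, OF Tadd] that by (force simp: ST)
    show "(c *\<^sub>C \<xi>, cnj c *\<^sub>C \<xi>') \<in> S" if \<xi>S: "(\<xi>, \<xi>') \<in> S" for \<xi> \<xi>' c
    proof -
      obtain p where p: "\<forall>n. p n \<in> T" "p \<longlonglongrightarrow> (\<xi>, \<xi>')" using \<xi>S by (auto simp: ST closure_sequential)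
      have "(c *\<^sub>C fst (p n), cnj c *\<^sub>C snd (p n)) \<in> T" for n
      proof -
        obtain x where x: "x \<in> M" "p n = (\<pi> x \<Omega>, \<pi> (adj x) \<Omega>)" using p(1) by (force simp: T_def)
        have "(c *\<^sub>C fst (p n), cnj c *\<^sub>C snd (p n)) = (\<pi> (\<lambda>\<xi>. c *\<^sub>C x \<xi>) \<Omega>, \<pi> (adj (\<lambda>\<xi>. c *\<^sub>C x \<xi>)) \<Omega>)"
          using x(1) by (simp add: x(2) \<pi>scale adj_scaleC Mb Madj)
        then show ?thesis unfolding T_def using Mscale[OF x(1)] by blast
      qed
      moreover have "(\<lambda>n. (c *\<^sub>C fst (p n), cnj c *\<^sub>C snd (p n))) \<longlonglongrightarrow> (c *\<^sub>C \<xi>, cnj c *\<^sub>C \<xi>')"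
        using tendsto_fst[OF p(2)] tendsto_snd[OF p(2)] by (intro tendsto_intros) auto
      ultimately show ?thesis
        unfolding ST closure_sequential
        by (intro exI[of _ "\<lambda>n. (c *\<^sub>C fst (p n), cnj c *\<^sub>C snd (p n))"]) simp
    qed
  qed (fact P uP)+
  have eM: "e \<in> M" and e: "e \<circ> x = x" if "x \<in> M" for x
    using M(2) that by (auto simp: is_unit_of_def)
  have eM: "e \<in> M" using M(2) by (simp add: is_unit_of_def)
  \<comment> \<open>That the unit is represented by the identity is forced by the density of the
    vectors \<open>\<pi> x \<Omega>\<close>, on which \<open>\<pi> e\<close> acts trivially.\<close>
  have \<pi>e: "\<pi> e = id"
  proof
    fix \<xi>
    obtain p where p: "\<forall>n. p n \<in> (\<lambda>x. \<pi> x \<Omega>) ` M" "p \<longlonglongrightarrow> \<xi>"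
      using dense by (metis UNIV_I closure_sequential)
    have "\<pi> e (p n) = p n" for n
    proof -
      obtain x where x: "x \<in> M" "p n = \<pi> x \<Omega>" using p(1) by blast
      have "\<pi> e (\<pi> x \<Omega>) = \<pi> (e \<circ> x) \<Omega>" by (simp add: \<pi>mult[OF eM x(1)])
      then show ?thesis by (simp add: e[OF x(1)] x(2))
    qed
    moreover have "(\<lambda>n. \<pi> e (p n)) \<longlonglongrightarrow> \<pi> e \<xi>"
      using \<pi>b[OF eM] p(2) by (auto simp: bounded_clinear_def intro: bounded_linear.tendsto)
    ultimately have "p \<longlonglongrightarrow> \<pi> e \<xi>" by simp
    then have "\<pi> e \<xi> = \<xi>" using p(2) by (rule LIMSEQ_unique)
    then show "\<pi> e \<xi> = id \<xi>" by simp
  qed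
  have "adj id = (id :: 'b \<Rightarrow> 'b)"
    by (rule adj_eqI) (auto simp: bounded_clinear_id id_def)
  then have \<Omega>S: "(\<Omega>, \<Omega>) \<in> S" using inS[OF eM] by (simp add: \<pi>adj[OF eM] \<pi>e)
  have "cinner \<kappa>' \<Omega> = cinner \<Omega> \<kappa>" if \<kappa>: "(\<kappa>, \<kappa>') \<in> S" for \<kappa> \<kappa>'
  proof -
    obtain p where p: "\<forall>n. p n \<in> T" "p \<longlonglongrightarrow> (\<kappa>, \<kappa>')" using \<kappa> by (auto simp: ST closure_sequential)
    have "cinner (snd (p n)) \<Omega> = cinner \<Omega> (fst (p n))" for n
    proof -
      obtain x where x: "x \<in> M" "p n = (\<pi> x \<Omega>, \<pi> (adj x) \<Omega>)" using p(1) by (force simp: T_def)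
      then show ?thesis by (simp add: \<pi>adj cinner_adj_left[OF \<pi>b])
    qed
    moreover have "(\<lambda>n. cinner (snd (p n)) \<Omega>) \<longlonglongrightarrow> cinner \<kappa>' \<Omega>"
      using tendsto_cinner[OF tendsto_snd[OF p(2)] tendsto_const] by simp
    ultimately have "(\<lambda>n. cinner \<Omega> (fst (p n))) \<longlonglongrightarrow> cinner \<kappa>' \<Omega>" by simp
    moreover have "(\<lambda>n. cinner \<Omega> (fst (p n))) \<longlonglongrightarrow> cinner \<Omega> \<kappa>"
      using tendsto_cinner[OF tendsto_const tendsto_fst[OF p(2)]] by simp
    ultimately show ?thesis by (rule LIMSEQ_unique)
  qed
  \<comment> \<open>\<Omega> is its own image under \<open>S\<close> and under the antilinear
    adjoint of \<open>S\<close>, so \<Delta> fixes it, and then every \<open>u s\<close>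
    does.\<close>
  then have "(\<Omega>, \<Omega>) \<in> A" unfolding A_iff using \<Omega>S by blast
  then have u\<Omega>: "u s \<Omega> = \<Omega>" for s by (intro u_fixed fixed_vector)
  have \<sigma>N: "\<sigma> s b \<in> N" if "b \<in> N" for s b using inv that by blast
  have u\<sigma>: "u s (\<pi> b \<Omega>) = \<pi> (\<sigma> s b) \<Omega>" if "b \<in> M" for b s
    using \<sigma>[OF that, of s] u\<Omega> by simp
  \<comment> \<open>\<open>is_modular_group\<close> does not say that \<sigma> respects adjoints. On
    the vector \<Omega> this is recovered from \<open>adj (u s) = u (- s)\<close> and the invariance
    of \<Omega>.\<close>
  have u\<sigma>adj: "u s (\<pi> (adj b) \<Omega>) = \<pi> (adj (\<sigma> s b)) \<Omega>" if "b \<in> N" for b s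
  proof (rule cinner_eqI)
    fix \<kappa>
    have bM: "b \<in> M" "\<sigma> s b \<in> M" using that \<sigma>N N(2) by auto
    have "cinner (\<pi> (adj (\<sigma> s b)) \<Omega>) \<kappa> = cinner \<Omega> (u s (\<pi> b (u (- s) \<kappa>)))"
    proof -
      have "cinner (\<pi> (adj (\<sigma> s b)) \<Omega>) \<kappa> = cinner \<Omega> (\<pi> (\<sigma> s b) \<kappa>)"
        unfolding \<pi>adj[OF bM(2)] by (rule cinner_adj_left[OF \<pi>b[OF bM(2)]])
      also have "\<pi> (\<sigma> s b) \<kappa> = u s (\<pi> b (u (- s) \<kappa>))" by (simp add: \<sigma>[OF bM(1)])
      finally show ?thesis .
    qed
    also have "\<dots> = cinner (u (- s) \<Omega>) (\<pi> b (u (- s) \<kappa>))"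
      by (simp add: cinner_adj_left[OF u_clinear] flip: u_adj)
    also have "\<dots> = cinner (\<pi> (adj b) \<Omega>) (u (- s) \<kappa>)"
      by (simp add: u\<Omega> \<pi>adj[OF bM(1)] cinner_adj_left[OF \<pi>b[OF bM(1)]])
    also have "\<dots> = cinner (u s (\<pi> (adj b) \<Omega>)) \<kappa>"
      using cinner_adj_left[OF u_clinear, of "- s" "\<pi> (adj b) \<Omega>" \<kappa>] by (simp add: u_adj)
    finally show "cinner \<kappa> (u s (\<pi> (adj b) \<Omega>)) = cinner \<kappa> (\<pi> (adj (\<sigma> s b)) \<Omega>)"
      by (metis cinner_commute)
  qed
  have \<psi>2: "cinner (\<pi> (adj x) \<Omega>) (\<pi> y \<Omega>) = \<psi> (x \<circ> y)" if "x \<in> M" "y \<in> M" for x y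
    using that by (simp add: \<psi> Mmult \<pi>mult \<pi>adj cinner_adj_left[OF \<pi>b])
  \<comment> \<open>Every element of \<open>N\<close> is of the form \<open>\<sigma> 0 c\<close>, so
    its vector lies in the range of \<open>u 0\<close> and has no spectral mass at 0.\<close>
  have zero: "P {0} (\<pi> b \<Omega>) = 0" if b: "b \<in> N" for b
  proof -
    obtain c where c: "c \<in> N" "b = \<sigma> 0 c" using inv[of 0] b by blast
    then have "\<pi> b \<Omega> = u 0 (\<pi> c \<Omega>)" using u\<sigma>[of c 0] N(2) by auto
    then show ?thesis using P_disjoint[of "{0}" "- {0}"] by (simp add: u_zero)
  qed
  \<comment> \<open>With the adjoint as starting point, \<open>\<pi> a \<Omega>\<close> becomes the
    image under \<open>S\<close>, and the eigenvector identity compares \<psi>(x a) with \<psi>(a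
    x).\<close>
  define b where "b = adj a"
  have b: "b \<in> N" "b \<in> M" "adj b = a" "a \<in> M" using a Nadj N(2) adj_adj Mb by (auto simp: b_def)
  have comm: "y \<circ> z = z \<circ> y" if "y \<in> N" "z \<in> N" for y z using N(3) that by (simp add: abelian_def)
  define \<xi> where "\<xi> = \<pi> b \<Omega>"
  define \<xi>' where "\<xi>' = \<pi> (adj b) \<Omega>"
  have SS: "(\<xi>, \<xi>') \<in> S" "(\<xi>', \<xi>) \<in> S"
    using inS[OF b(2)] inS[OF b(4)] by (simp_all add: \<xi>_def \<xi>'_def b(3)) (simp add: b_def)
  have norm: "norm \<xi>' = norm \<xi>"
  proof -
    have "cinner \<xi>' \<xi>' = cinner \<xi> \<xi>"
      using \<psi>2[OF b(2,4)] \<psi>2[OF b(4,2)] comm[OF a b(1)] by (simp add: \<xi>_def \<xi>'_def b(3)) (simp add: b_def)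
    then have "(norm \<xi>')\<^sup>2 = (norm \<xi>)\<^sup>2" by (simp only: cinner_self of_real_eq_iff)
    then show ?thesis by simp
  qed
  have "P {1} \<xi> = \<xi>"
  proof (rule fixed_if_symmetric[OF SS norm])
    show "P {0} \<xi> = 0" "P {0} \<xi>' = 0" using zero[OF b(1)] zero[OF a] by (simp_all add: \<xi>_def \<xi>'_def b(3))
    fix s
    define c where "c = \<sigma> s b"
    have c: "c \<in> N" "adj c \<in> N" "c \<in> M" "adj c \<in> M" using \<sigma>N[OF b(1)] Nadj N(2) by (auto simp: c_def)
    have "cinner \<xi>' (u s \<xi>') = \<psi> (b \<circ> adj c)"
      using \<psi>2[OF b(2) c(4)] u\<sigma>adj[OF b(1), of s] by (simp add: \<xi>'_def c_def)
    also have "\<dots> = \<psi> (adj c \<circ> b)" using comm[OF b(1) c(2)] by simp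
    also have "\<dots> = cinner (u s \<xi>) \<xi>"
      using \<psi>2[OF c(4) b(2)] u\<sigma>[OF b(2), of s] adj_adj[OF Mb[OF c(3)]] by (simp add: \<xi>_def c_def)
    finally show "cinner \<xi>' (u s \<xi>') = cnj (cinner \<xi> (u s \<xi>))" by (metis cinner_commute)
  qed
  from S_eigenvector[OF SS(1) this norm inS[OF x]]
  have "cinner (\<pi> (adj x) \<Omega>) (\<pi> a \<Omega>) = cinner (\<pi> (adj a) \<Omega>) (\<pi> x \<Omega>)"
    by (simp add: \<xi>_def \<xi>'_def b(3)) (simp add: b_def)
  then show ?thesis using \<psi>2[OF x b(4)] \<psi>2[OF b(4) x] by simp
qed

section \<open>Reduction to the support projection\<close>

locale support_projection = normal_op_state M e \<psi>
  for M :: "'a::complex_hilbert_space bop set" and e \<psi> +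
  fixes p :: "'a bop"
  assumes closed: "(\<And>n. X n \<in> M) \<Longrightarrow> slim X r \<Longrightarrow> r \<in> M"
    and p: "p \<in> M" "star p = p" "p * p = p" "\<psi> p = 1"
    and p_least: "q \<in> M \<Longrightarrow> star q = q \<Longrightarrow> q * q = q \<Longrightarrow> \<psi> q = 1 \<Longrightarrow> p \<le> q"
begin

definition R where "R = {x \<in> M. p * x = x \<and> x * p = x}"

lemma RM: "x \<in> R \<Longrightarrow> x \<in> M"
  by (simp add: R_def)

lemma R_star: "x \<in> R \<Longrightarrow> star x \<in> R"
  unfolding R_def using star p(2) by (auto simp flip: star_simps(7)) (metis p(2) star_simps(7))+

sublocale R: op_state R p \<psi>
proof
  show "x * y \<in> R" if "x \<in> R" "y \<in> R" for x y
    using that by (auto simp: R_def mult mult.assoc) (metis mult.assoc)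
  show "p \<in> R" using p by (simp add: R_def)
  show "star x \<in> R" if "x \<in> R" for x using that by (rule R_star)
qed (use p(4) in \<open>auto simp: R_def zero add csc distrib_left distrib_right csc_simps fadd fcsc fpos\<close>)

text \<open>The powers \<open>(p - x)\<^sup>n\<close> decrease to the projection onto the kernel of \<open>x\<close> inside \<open>p\<close>.\<close>

lemma R_faithful_unit:
  assumes x: "x \<in> R" "0 \<le> x" "x \<le> 1" "\<psi> x = 0" shows "x = 0"
proof -
  define y where "y = p - x"
  \<comment> \<open>The exponent starts at 1: the zeroth power would be \<open>1\<close>, which in
    general is outside \<open>R\<close>.\<close>
  define z where "z n = y ^ Suc n" for n
  have sx: "star x = x" by (rule bop_pos_star[OF x(2)])
  have yR: "y \<in> R" unfolding y_def using x(1) by (intro R.diff R.unit)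
  have "x \<le> 1 *\<^sub>R p" using x by (intro R.le_unit) auto
  then have y0: "0 \<le> y" by (simp add: y_def)
  have "p - x \<le> p - 0" using x(2) by (intro diff_left_mono)
  then have y1: "y \<le> 1" using order_trans[OF _ R.unit_le_one] by (simp add: y_def)
  have zR: "z n \<in> R" for n by (induction n) (auto simp: z_def yR R.mult)
  have z01: "0 \<le> z n" "z n \<le> 1" for n
    unfolding z_def using bop_unit_power[OF y0 y1, of "Suc n"] by auto
  have z_Suc: "z (Suc n) = y * z n" for n by (simp add: z_def)
  have zdec: "z (Suc n) \<le> z n" for n
    unfolding z_Suc using bop_unit_mult(2)[OF y0 y1 z01] by (simp add: z_def power_commutes mult.assoc)
  obtain q where q: "slim z q" "0 \<le> q" "\<And>n. q \<le> z n"
    by (rule decseq_slim[of z, OF zdec z01]) (rule that; assumption)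
  have qM: "q \<in> M" using closed[OF RM[OF zR] q(1)] .
  have "slim (\<lambda>n. y * z n) q" using slim_shift[OF q(1), of 1] by (simp add: z_def)
  then have yq: "y * q = q" using slim_unique[OF slim_mult_left[OF q(1)]] by blast
  have zq: "z n * q = q" for n by (induction n) (simp_all add: z_def yq mult.assoc)
  have "q * q = q" using slim_unique[OF slim_mult_right[OF q(1), of q]] slim_const[of q] by (simp add: zq)
  moreover have sq: "star q = q" by (rule bop_pos_star[OF q(2)])
  \<comment> \<open>\<psi>(x^2) = 0, so by Cauchy-Schwarz \<psi> vanishes on products starting with
    \<open>x\<close>; passing from \<open>z n\<close> to \<open>z (Suc n)\<close> subtracts such a
    product.\<close>
  moreover have "\<psi> q = 1"
  proof -
    have xM: "x \<in> M" by (rule RM[OF x(1)])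
    have "Re (\<psi> (x * x)) \<le> Re (\<psi> x)" using xM bop_square_le_self[OF x(2,3)] by (intro fmono mult)
    then have xx: "Re (\<psi> (x * x)) = 0"
      using x(4) fpos_Re[OF mult[OF xM xM] bop_square_pos[OF sx]] by simp
    have "\<psi> (x * w) = 0" if "w \<in> M" for w
      using fcauchy_schwarz[OF that xM] xx by (simp add: sx)
    then have "\<psi> (z (Suc n)) = \<psi> (z n)" for n
    proof -
      have "z (Suc n) = z n - x * z n"
        using zR[of n] unfolding z_Suc by (simp add: y_def left_diff_distrib R_def)
      then show ?thesis using \<open>\<And>w. w \<in> M \<Longrightarrow> \<psi> (x * w) = 0\<close> RM[OF zR] xM by (simp add: fdiff mult)
    qed
    moreover have "\<psi> (z 0) = 1" using xM p x(4) by (simp add: z_def y_def fdiff)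
    ultimately have "\<psi> (z n) = 1" for n by (induction n) auto
    moreover have "(\<lambda>n. Re (\<psi> (z n))) \<longlonglongrightarrow> Re (\<psi> q)"
      by (rule normal_decseq[OF RM[OF zR] bop_pos_star[OF z01(1)] zdec q(1) qM])
    ultimately have "Re (\<psi> q) = 1" by (simp add: LIMSEQ_const_iff)
    then show ?thesis using fselfadjoint[OF qM sq] by (simp add: complex_eq_iff)
  qed
  ultimately have "p \<le> q" using qM by (intro p_least)
  also have "q \<le> p - x" using q(3)[of 0] by (simp add: z_def y_def)
  finally have "x \<le> 0" by simp
  then show ?thesis using x(2) by (rule antisym)
qed

lemma R_faithful:
  assumes x: "x \<in> R" "0 \<le> x" "\<psi> x = 0" shows "x = 0"
proof -
  obtain c where c: "0 < c" "x \<le> c *\<^sub>R 1"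
    using selfadjoint_bounded[OF bop_pos_star[OF x(2)]] by blast
  have "inverse c *\<^sub>R x = 0"
  proof (rule R_faithful_unit)
    show "inverse c *\<^sub>R x \<le> 1"
      using scaleR_left_mono[OF c(2), of "inverse c"] c(1) by simp
  qed (use x c RM in \<open>auto simp: scaleR_nonneg_nonneg R.scaleR fscaleR\<close>)
  then show ?thesis using c(1) by simp
qed

lemma R_closed:
  assumes "\<And>n. X n \<in> R" "slim X r" shows "r \<in> R"
proof -
  have "r \<in> M" using closed[OF RM[OF assms(1)] assms(2)] .
  moreover have X: "slim X (p * r)" "slim X (r * p)"
    using slim_mult_left[OF assms(2), of p] slim_mult_right[OF assms(2), of p] assms(1)
    by (simp_all add: R_def)
  moreover have "p * r = r" "r * p = r"
    using slim_unique[OF X(1) assms(2)] slim_unique[OF X(2) assms(2)] by blast+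
  ultimately show ?thesis by (simp add: R_def)
qed

text \<open>Directedness builds \<open>c\<close> recursively: it starts at \<open>d\<close>, and
  each next term dominates the previous one and \<open>a n\<close>. The limit lies above
  \<open>d\<close> and attains the value \<open>s\<close>, so that limits for different
  \<open>d\<close> can be compared.\<close>

lemma increasing_sequence_limit:
  assumes D: "D \<subseteq> {x\<in>R. star x = x}" "upward_directed D" and x: "x \<in> R" "star x = x" "\<forall>d\<in>D. d \<le> x"
    and a: "\<And>n. a n \<in> D" "(\<lambda>n. Re (\<psi> (a n))) \<longlonglongrightarrow> s" and s: "\<forall>d\<in>D. Re (\<psi> d) \<le> s"
    and d: "d \<in> D"
  obtains c y where "\<And>n. c n \<in> D" "slim c y" "y \<in> R" "star y = y" "d \<le> y" "y \<le> x" "Re (\<psi> y) = s"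
    "(\<lambda>n. Re (\<psi> (c n))) \<longlonglongrightarrow> s" "\<And>z. slim a z \<Longrightarrow> z \<le> y"
proof -
  have DR: "u \<in> R" "star u = u" if "u \<in> D" for u using D(1) that by auto
  have "\<exists>c. \<forall>n. (c n \<in> D \<and> (n = 0 \<longrightarrow> c n = d)) \<and> (c n \<le> c (Suc n) \<and> a n \<le> c (Suc n))"
  proof (rule dependent_nat_choice)
    show "\<exists>x. x \<in> D \<and> (0 = (0::nat) \<longrightarrow> x = d)" using d by blast
    show "\<exists>y. (y \<in> D \<and> (Suc n = 0 \<longrightarrow> y = d)) \<and> x \<le> y \<and> a n \<le> y"
      if "x \<in> D \<and> (n = 0 \<longrightarrow> x = d)" for x n
      using D(2) that a(1)[of n] unfolding upward_directed_def by auto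
  qed
  then obtain c where c: "\<And>n. c n \<in> D" "c 0 = d" "\<And>n. c n \<le> c (Suc n)" "\<And>n. a n \<le> c (Suc n)"
    by blast
  have cR: "c n \<in> R" "star (c n) = c n" "c n \<in> M" for n using DR[OF c(1)] RM by auto
  obtain k where k: "0 < k" "x - c 0 \<le> k *\<^sub>R 1"
    using selfadjoint_bounded[of "x - c 0"] x(2) cR(2) by auto
  \<comment> \<open>Decreasing and rescaled into the unit interval, as \<open>decseq_slim\<close>
    requires.\<close>
  define y where "y n = inverse k *\<^sub>R (x - c n)" for n
  have cinc: "c 0 \<le> c n" for n by (induction n) (use c(3) order_trans in blast)+
  have "slim y r \<Longrightarrow> slim c (x - k *\<^sub>R r)" for r
    using slim_diff[OF slim_const[of x] slim_scaleR[of y r k]] k(1) by (simp add: y_def)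
  moreover obtain r where "slim y r"
  proof (rule decseq_slim[of y])
    show "y (Suc n) \<le> y n" for n
      unfolding y_def using c(3) k(1) by (intro scaleR_left_mono diff_left_mono) auto
    show "0 \<le> y n" for n unfolding y_def using bspec[OF x(3) c(1)] k(1) by (intro scaleR_nonneg_nonneg) auto
    have "x - c n \<le> k *\<^sub>R 1" for n using order_trans[OF diff_left_mono[OF cinc] k(2)] .
    then have "y n \<le> inverse k *\<^sub>R k *\<^sub>R 1" for n
      unfolding y_def using k(1) by (intro scaleR_left_mono) auto
    then show "y n \<le> 1" for n using k(1) by simp
  qed blast
  ultimately obtain w where w: "slim c w" by blast
  have wR: "w \<in> R" by (rule R_closed[OF cR(1) w])
  have mono: "c m \<le> c n" if "m \<le> n" for m n using lift_Suc_mono_le[of c, OF c(3) that] .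
  have cw: "c n \<le> w" for n
    by (rule slim_mono[OF slim_const slim_shift[OF w, of n]]) (rule mono, simp)
  have wx: "w \<le> x" by (rule slim_mono[OF w slim_const]) (rule bspec[OF x(3) c(1)])
  have sw: "star w = w" using bop_le_star[OF wx] x(2) by blast
  have "(\<lambda>n. Re (\<psi> (- c n))) \<longlonglongrightarrow> Re (\<psi> (- w))"
  proof (rule normal_decseq)
    show "slim (\<lambda>n. - c n) (- w)" using slim_diff[OF slim_const w, of 0] by simp
  qed (use cR wR RM c(3) in \<open>auto intro: minus\<close>)
  then have "(\<lambda>n. - Re (\<psi> (c n))) \<longlonglongrightarrow> - Re (\<psi> w)" using cR(3) RM[OF wR] by (simp add: fminus)
  then have lim: "(\<lambda>n. Re (\<psi> (c n))) \<longlonglongrightarrow> Re (\<psi> w)" by (simp add: tendsto_minus_cancel_left)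
  have "Re (\<psi> w) \<le> s" by (rule LIMSEQ_le_const2[OF lim]) (use s c(1) in auto)
  moreover have "s \<le> Re (\<psi> w)"
  proof (rule LIMSEQ_le_const2[OF a(2)])
    have "Re (\<psi> (a n)) \<le> Re (\<psi> w)" for n
      using order_trans[OF c(4) cw] RM[OF DR(1)[OF a(1)]] RM[OF wR] by (intro fmono)
    then show "\<exists>N. \<forall>n\<ge>N. Re (\<psi> (a n)) \<le> Re (\<psi> w)" by blast
  qed
  ultimately have ws: "Re (\<psi> w) = s" by simp
  have az: "z \<le> w" if "slim a z" for z
    by (rule slim_mono[OF that slim_shift[OF w, of 1]]) (use c(4) in simp)
  have "d \<le> w" using cw[of 0] c(2) by simp
  from that[OF c(1) w wR sw this wx ws lim[unfolded ws] az] show ?thesis .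
qed

text \<open>A supremum in \<open>R\<close> need not be a supremum in \<open>M\<close> a priori. By faithfulness on \<open>R\<close> it is the limit
  of any increasing sequence along which \<open>\<psi>\<close> approaches its supremum, and such limits
  are suprema in \<open>M\<close>.\<close>

sublocale R: normal_op_state R p \<psi>
proof
  fix D x assume D: "D \<subseteq> {x\<in>R. star x = x}" "upward_directed D" and lub: "is_lub_in R D x"
  have x: "x \<in> R" "star x = x" "\<forall>d\<in>D. d \<le> x" using lub by (auto simp: is_lub_in_def)
  have DR: "u \<in> R" "star u = u" if "u \<in> D" for u using D(1) that by auto
  define s where "s = (SUP d\<in>D. Re (\<psi> d))"
  have D0: "D \<noteq> {}" using D(2) by (simp add: upward_directed_def)
  then obtain d0 where d0: "d0 \<in> D" by blast
  have bdd: "bdd_above ((\<lambda>d. Re (\<psi> d)) ` D)"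
    by (rule bdd_aboveI2[of _ _ "Re (\<psi> x)"]) (use x DR RM in \<open>auto intro: fmono\<close>)
  have s: "\<forall>d\<in>D. Re (\<psi> d) \<le> s"
    unfolding s_def using cSUP_upper[OF _ bdd] by blast
  have "\<exists>d\<in>D. s - inverse (real (Suc n)) < Re (\<psi> d)" for n
  proof -
    have "s - inverse (real (Suc n)) < (SUP d\<in>D. Re (\<psi> d))" by (simp add: s_def)
    then show ?thesis using less_cSUP_iff[OF D0 bdd] by blast
  qed
  then obtain a where a: "\<And>n. a n \<in> D" "\<And>n. s - inverse (real (Suc n)) < Re (\<psi> (a n))" by metis
  have alim: "(\<lambda>n. Re (\<psi> (a n))) \<longlonglongrightarrow> s"
  proof (rule tendsto_sandwich[where h = "\<lambda>_. s"])
    have "(\<lambda>n. s - inverse (real (Suc n))) \<longlonglongrightarrow> s - 0"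
      by (intro tendsto_intros LIMSEQ_inverse_real_of_nat)
    then show "(\<lambda>n. s - inverse (real (Suc n))) \<longlonglongrightarrow> s" by simp
  qed (use a s in \<open>auto intro!: always_eventually less_imp_le\<close>)
  obtain c y where c: "\<And>n. c n \<in> D" "slim c y" "(\<lambda>n. Re (\<psi> (c n))) \<longlonglongrightarrow> s"
    and y: "y \<in> R" "star y = y" "y \<le> x" "Re (\<psi> y) = s"
    by (rule increasing_sequence_limit[OF D x a(1) alim s d0]) (rule that; assumption)
  \<comment> \<open>\<open>y\<close> was built without regard to this \<open>d\<close>. A second
    sequence, starting at \<open>d\<close> and dominating the first, has a limit above
    \<open>y\<close> with the same value, and faithfulness makes the two limits equal.\<close>
  have "d \<le> y" if d: "d \<in> D" for d
  proof -
    obtain w where w: "w \<in> R" "star w = w" "d \<le> w" "Re (\<psi> w) = s" and "\<And>z. slim c z \<Longrightarrow> z \<le> w"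
      by (rule increasing_sequence_limit[OF D x c(1,3) s d]) (rule that; assumption)
    then have yw: "y \<le> w" using c(2) by blast
    have "w - y = 0"
    proof (rule R_faithful)
      have "Im (\<psi> w) = 0" "Im (\<psi> y) = 0" using w y RM by (auto intro: fselfadjoint)
      then show "\<psi> (w - y) = 0"
        using w(4) y(4) RM[OF w(1)] RM[OF y(1)] by (simp add: fdiff complex_eq_iff)
    qed (use w y yw in \<open>auto intro: R.diff\<close>)
    then show ?thesis using w(3) by simp
  qed
  then have "x \<le> y" using lub y(1,2) by (auto simp: is_lub_in_def)
  then have "x = y" using y(3) by (intro antisym)
  then show "Re (\<psi> x) = (SUP d\<in>D. Re (\<psi> d))" using y(4) by (simp add: s_def)
qed

end

section \<open>Transfer to operators as functions\<close>

definition bops :: "('a::complex_hilbert_space \<Rightarrow> 'a) set \<Rightarrow> 'a bop set"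
  where "bops M = {X. app X \<in> M}"

lemma bops_iff [simp]: "X \<in> bops M \<longleftrightarrow> app X \<in> M"
  by (simp add: bops_def)

lemma app_Bop: "star_subalgebra M \<Longrightarrow> x \<in> M \<Longrightarrow> app (Bop x) = x"
  by (rule Bop_inverse) (auto simp: star_subalgebra_def)

lemma positive_op_app: "positive_op (app X) \<longleftrightarrow> 0 \<le> X"
  by (simp add: less_eq_bop.rep_eq op_le_def)

lemma op_unit_eq: "is_unit_of M e \<Longrightarrow> op_unit M = e"
  unfolding op_unit_def by (rule the_equality, assumption) (metis is_unit_of_def)

lemma op_algebra_bops:
  assumes M: "star_subalgebra M" "is_unit_of M e" shows "op_algebra (bops M) (Bop e)"
proof -
  have e: "app (Bop e) = e" using app_Bop[OF M(1)] M(2) by (simp add: is_unit_of_def)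
  show ?thesis
  proof
    show "Bop e * X = X" "X * Bop e = X" if "X \<in> bops M" for X
      using M(2) that by (auto simp: is_unit_of_def times_bop.rep_eq e simp flip: app_inject)
  qed (use M e in \<open>auto simp: star_subalgebra_def is_unit_of_def zero_bop.rep_eq plus_bop.rep_eq
      csc.rep_eq times_bop.rep_eq star.rep_eq\<close>)
qed

lemma op_state_bops:
  assumes M: "star_subalgebra M" "is_unit_of M e" and \<psi>: "state M \<psi>"
  shows "op_state (bops M) (Bop e) (\<lambda>X. \<psi> (app X))"
proof -
  interpret op_algebra "bops M" "Bop e" by (rule op_algebra_bops[OF M])
  have e: "app (Bop e) = e" using app_Bop[OF M(1)] M(2) by (simp add: is_unit_of_def)
  show ?thesis
    by standard (use \<psi> e op_unit_eq[OF M(2)] in \<open>auto simp: state_def plus_bop.rep_eq csc.rep_eq positive_op_app\<close>)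
qed

lemma is_lub_in_bops:
  assumes M: "star_subalgebra M"
  shows "is_lub_in (bops M) D X \<longleftrightarrow> is_op_lub M (app ` D) (app X)"
proof -
  have sa: "app Y \<in> sa_part M \<longleftrightarrow> Y \<in> bops M \<and> star Y = Y" for Y
    by (simp add: sa_part_def flip: app_inject star.rep_eq)
  have "y \<in> sa_part M \<longleftrightarrow> (\<exists>Y. y = app Y \<and> Y \<in> bops M \<and> star Y = Y)" for y
    using app_Bop[OF M, of y] sa by (metis (no_types, lifting) mem_Collect_eq sa_part_def)
  then show ?thesis
    unfolding is_lub_in_def is_op_lub_def less_eq_bop.rep_eq using sa by auto
qed

lemma normal_op_state_bops:
  assumes M: "star_subalgebra M" "is_unit_of M e" and \<psi>: "state M \<psi>" "normal_functional M \<psi>"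
  shows "normal_op_state (bops M) (Bop e) (\<lambda>X. \<psi> (app X))"
proof -
  interpret op_state "bops M" "Bop e" "\<lambda>X. \<psi> (app X)" by (rule op_state_bops[OF M \<psi>(1)])
  show ?thesis
  proof
    fix D X assume D: "D \<subseteq> {X \<in> bops M. star X = X}" "upward_directed D" and X: "is_lub_in (bops M) D X"
    have "app ` D \<subseteq> sa_part M" using D(1) by (auto simp: sa_part_def simp flip: star.rep_eq)
    moreover have "op_directed (app ` D)"
      using D(2) by (simp add: upward_directed_def op_directed_def less_eq_bop.rep_eq)
    moreover have "is_op_lub M (app ` D) (app X)" using X is_lub_in_bops[OF M(1)] by blast
    ultimately have "Re (\<psi> (app X)) = (SUP d\<in>app ` D. Re (\<psi> d))"
      using \<psi>(2) unfolding normal_functional_def by blast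
    then show "Re (\<psi> (app X)) = (SUP d\<in>D. Re (\<psi> (app d)))" by (simp add: image_image)
  qed
qed

text \<open>The topology is pulled back from the product topology on matrix coefficients, and strong
  convergence makes each coefficient converge.\<close>

lemma closedin_weak_operator_topology_slim:
  assumes N: "closedin weak_operator_topology N" and X: "\<And>n. app (X n) \<in> N" "slim X r"
  shows "app r \<in> N"
proof (rule ccontr)
  assume r: "app r \<notin> N"
  define F :: "('a \<Rightarrow> 'a) \<Rightarrow> 'a \<times> 'a \<Rightarrow> complex" where "F x = (\<lambda>(\<xi>, \<eta>). cinner \<xi> (x \<eta>))" for x
  have W: "weak_operator_topology = pullback_topology (Collect bounded_clinear) F euclidean"
    by (simp add: weak_operator_topology_def F_def[abs_def])
  have top: "topspace (weak_operator_topology :: ('a \<Rightarrow> 'a) topology) = Collect bounded_clinear"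
    by (simp add: W topspace_pullback_topology)
  have "openin weak_operator_topology (topspace weak_operator_topology - N)"
    using N by (simp add: closedin_def)
  then obtain U where U: "open U" "Collect bounded_clinear - N = F -` U \<inter> Collect bounded_clinear"
    unfolding top by (auto simp: W openin_pullback_topology)
  have "F (app r) \<in> U" using r U(2) bounded_clinear_app[of r] by blast
  moreover have "(\<lambda>n. F (app (X n))) \<longlonglongrightarrow> F (app r)"
  proof -
    have "(\<lambda>n. F (app (X n)) z) \<longlonglongrightarrow> F (app r) z" for z
      using X(2) by (cases z) (auto simp: F_def slim_def intro: tendsto_intros)
    then have "limitin (product_topology (\<lambda>_. euclidean) UNIV) (\<lambda>n. F (app (X n))) (F (app r)) sequentially"
      by (subst limitin_componentwise) auto
    then show ?thesis by (simp add: euclidean_product_topology)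
  qed
  ultimately have "\<forall>\<^sub>F n in sequentially. F (app (X n)) \<in> U" using U(1) by (intro topological_tendstoD)
  then obtain n where "F (app (X n)) \<in> U" by (auto simp: eventually_sequentially)
  then show False using U(2) X(1)[of n] bounded_clinear_app[of "X n"] by blast
qed

lemma
  assumes "bounded_clinear x" "bounded_clinear y"
  shows Bop_add: "Bop (\<lambda>\<xi>. x \<xi> + y \<xi>) = Bop x + Bop y" and Bop_comp: "Bop (x \<circ> y) = Bop x * Bop y"
  using assms by (auto intro!: bop_eqI simp: Bop_inverse bounded_clinear_add bounded_clinear_comp)

lemma Bop_scaleC: "bounded_clinear x \<Longrightarrow> Bop (\<lambda>\<xi>. c *\<^sub>C x \<xi>) = csc c (Bop x)"
  by (rule bop_eqI) (simp add: Bop_inverse bounded_clinear_scaleC)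

lemma onorm_app_le_iff: "0 \<le> c \<Longrightarrow> onorm (app X) \<le> c \<longleftrightarrow> (\<forall>\<xi>. norm (app X \<xi>) \<le> c * norm \<xi>)"
  using onorm[OF bounded_linear_app[of X]] onorm_bound[of c "app X"]
  by (meson mult_right_mono norm_ge_zero order_trans)

text \<open>The corner is defined as an image; the closure properties are read off from membership
  in \<open>M\<close> together with absorption of \<open>p\<close> on both sides.\<close>

lemma corner_star_subalgebra:
  assumes M: "star_subalgebra M" and p: "p \<in> M" "is_projection p"
  shows "bops (corner p M) = {X \<in> bops M. Bop p * X = X \<and> X * Bop p = X}"
    and "star_subalgebra (corner p M)" "is_unit_of (corner p M) p"
proof -
  define Q where "Q = Bop p"
  have Q: "app Q = p" by (simp add: Q_def app_Bop[OF M p(1)])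
  have Qp: "star Q = Q" "Q * Q = Q"
    using p(2) by (simp_all add: is_projection_def Q times_bop.rep_eq star.rep_eq flip: app_inject)
  have iff: "x \<in> corner p M \<longleftrightarrow> (\<exists>X. x = app X \<and> app X \<in> M \<and> Q * X = X \<and> X * Q = X)" for x
  proof
    assume "x \<in> corner p M"
    then obtain y where y: "y \<in> M" "x = p \<circ> y \<circ> p" by (auto simp: corner_def)
    have "x = app (Q * Bop y * Q)" using app_Bop[OF M y(1)] y(2) by (simp add: times_bop.rep_eq Q)
    moreover have "x \<in> M" using M p(1) y unfolding star_subalgebra_def by blast
    ultimately show "\<exists>X. x = app X \<and> app X \<in> M \<and> Q * X = X \<and> X * Q = X"
      by (intro exI[of _ "Q * Bop y * Q"]) (simp add: mult.assoc Qp, simp flip: mult.assoc add: Qp)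
  next
    assume "\<exists>X. x = app X \<and> app X \<in> M \<and> Q * X = X \<and> X * Q = X"
    then obtain X where X: "x = app X" "app X \<in> M" "Q * X = X" "X * Q = X" by blast
    have "app X = p \<circ> app X \<circ> p" using X(3,4) by (metis Q times_bop.rep_eq)
    then show "x \<in> corner p M" using X unfolding corner_def by blast
  qed
  then show bops: "bops (corner p M) = {X \<in> bops M. Bop p * X = X \<and> X * Bop p = X}"
    by (auto simp: Q_def[symmetric] app_inject)
  have mem: "x \<in> corner p M \<longleftrightarrow> x \<in> M \<and> p \<circ> x = x \<and> x \<circ> p = x" for x
  proof
    assume "x \<in> corner p M"
    then show "x \<in> M \<and> p \<circ> x = x \<and> x \<circ> p = x" unfolding iff by (metis Q times_bop.rep_eq)
  next
    assume "x \<in> M \<and> p \<circ> x = x \<and> x \<circ> p = x"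
    then have "x \<in> M" "x = p \<circ> x \<circ> p" by auto
    then show "x \<in> corner p M" unfolding corner_def by blast
  qed
  show "is_unit_of (corner p M) p"
    using p by (auto simp: is_unit_of_def mem is_projection_def)
  show "star_subalgebra (corner p M)"
    unfolding star_subalgebra_def
  proof (intro conjI ballI allI)
    show "corner p M \<subseteq> Collect bounded_clinear" using M mem by (auto simp: star_subalgebra_def)
    have pb: "bounded_clinear p" using p(2) by (simp add: is_projection_def)
    then have p_lin: "p (\<xi> + \<eta>) = p \<xi> + p \<eta>" "p (c *\<^sub>C \<xi>) = c *\<^sub>C p \<xi>" "p 0 = 0" for \<xi> \<eta> c
      using app_linear[of Q] by (simp_all add: Q)
    show "(\<lambda>\<xi>. 0) \<in> corner p M" using M p_lin by (auto simp: mem star_subalgebra_def o_def)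
    fix x assume x: "x \<in> corner p M"
    show "(\<lambda>\<xi>. c *\<^sub>C x \<xi>) \<in> corner p M" for c
      using M x p_lin by (auto simp: mem star_subalgebra_def o_def fun_eq_iff)
    show "adj x \<in> corner p M"
    proof -
      obtain X where X: "x = app X" "app X \<in> M" "Q * X = X" "X * Q = X" using x iff by blast
      have "Q * star X = star X" "star X * Q = star X"
        using X(3,4) Qp(1) by (metis star_simps(7))+
      moreover have "adj x = app (star X)" by (simp add: X(1) star.rep_eq)
      moreover have "adj x \<in> M" using M X(1,2) by (auto simp: star_subalgebra_def)
      ultimately show ?thesis unfolding iff by metis
    qed
    fix y assume y: "y \<in> corner p M"
    show "(\<lambda>\<xi>. x \<xi> + y \<xi>) \<in> corner p M"
      using M x y p_lin by (auto simp: mem star_subalgebra_def o_def fun_eq_iff)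
    show "x \<circ> y \<in> corner p M"
      using M x y by (auto simp: mem star_subalgebra_def o_def fun_eq_iff)
  qed
qed

lemma corner_normal_state:
  assumes M: "von_neumann_algebra M" and \<psi>: "normal_state M \<psi>" and p: "is_support_projection M \<psi> p"
  shows "state (corner p M) \<psi>" "normal_functional (corner p M) \<psi>" "faithful_on (corner p M) \<psi>"
proof -
  obtain e where Ms: "star_subalgebra M" "is_unit_of M e" and closed: "closedin weak_operator_topology M"
    using M by (auto simp: von_neumann_algebra_def)
  have s: "state M \<psi>" "normal_functional M \<psi>" using \<psi> by (auto simp: normal_state_def)
  have pM: "p \<in> M" "is_projection p" "\<psi> p = 1" using p by (auto simp: is_support_projection_def)
  note C = corner_star_subalgebra[OF Ms(1) pM(1,2)]
  have Bp: "app (Bop p) = p" by (rule app_Bop[OF Ms(1) pM(1)])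
  interpret M: normal_op_state "bops M" "Bop e" "\<lambda>X. \<psi> (app X)"
    by (rule normal_op_state_bops[OF Ms s])
  interpret support_projection "bops M" "Bop e" "\<lambda>X. \<psi> (app X)" "Bop p"
  proof
    show "r \<in> bops M" if "\<And>n. X n \<in> bops M" "slim X r" for X r
      using closedin_weak_operator_topology_slim[OF closed, of X r] that by simp
    show "Bop p \<in> bops M" "\<psi> (app (Bop p)) = 1" using pM by (simp_all add: Bp)
    show "star (Bop p) = Bop p" "Bop p * Bop p = Bop p"
      using pM(2) by (simp_all add: is_projection_def Bp times_bop.rep_eq star.rep_eq flip: app_inject)
    show "Bop p \<le> q" if "q \<in> bops M" "star q = q" "q * q = q" "\<psi> (app q) = 1" for q
    proof -
      have "is_projection (app q)"
        using that by (simp add: is_projection_def bounded_clinear_app flip: times_bop.rep_eq star.rep_eq)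
      then have "op_le p (app q)" using p that by (simp add: is_support_projection_def)
      then show ?thesis by (simp add: less_eq_bop.rep_eq Bp)
    qed
  qed
  have R: "R = bops (corner p M)" by (simp add: R_def C(1))
  have cM: "corner p M \<subseteq> M"
  proof
    fix x assume x: "x \<in> corner p M"
    have ax: "app (Bop x) = x" by (rule app_Bop[OF C(2) x])
    have "Bop x \<in> bops (corner p M)" using x by (simp add: ax)
    then have "Bop x \<in> bops M" unfolding C(1) by (simp only: mem_Collect_eq)
    then show "x \<in> M" by (simp add: ax)
  qed
  show state: "state (corner p M) \<psi>"
    using s(1) cM op_unit_eq[OF C(3)] pM(3) unfolding state_def by (simp add: subset_iff)
  show "faithful_on (corner p M) \<psi>"
    unfolding faithful_on_def
  proof (intro ballI impI)
    fix x assume x: "x \<in> corner p M" "positive_op x \<and> \<psi> x = 0"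
    have ax: "app (Bop x) = x" by (rule app_Bop[OF C(2) x(1)])
    then have "Bop x = 0" using x R positive_op_app[of "Bop x"] by (intro R_faithful) auto
    then show "x = (\<lambda>\<xi>. 0)" using ax by (simp add: zero_bop.rep_eq)
  qed
  show "normal_functional (corner p M) \<psi>"
    unfolding normal_functional_def
  proof (intro allI impI)
    fix D x assume D: "D \<subseteq> sa_part (corner p M) \<and> op_directed D \<and> is_op_lub (corner p M) D x"
    have DM: "app (Bop d) = d" if "d \<in> D" for d
      using D that app_Bop[OF C(2)] by (auto simp: sa_part_def)
    have xM: "app (Bop x) = x" using D app_Bop[OF C(2)] by (auto simp: is_op_lub_def sa_part_def)
    have img: "app ` Bop ` D = D" using DM by (force simp: image_image)
    have "Bop ` D \<subseteq> {X \<in> R. star X = X}"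
      using D DM by (auto simp: R sa_part_def star.rep_eq simp flip: app_inject)
    moreover have "upward_directed (Bop ` D)"
      using D DM by (simp add: upward_directed_def op_directed_def less_eq_bop.rep_eq)
    moreover have "is_lub_in R (Bop ` D) (Bop x)"
      unfolding R is_lub_in_bops[OF C(2)] img xM using D by blast
    ultimately have "Re (\<psi> (app (Bop x))) = (SUP d\<in>Bop ` D. Re (\<psi> (app d)))"
      by (rule R.normal)
    also have "\<dots> = (SUP d\<in>D. Re (\<psi> d))"
      using DM by (simp add: image_image cong: image_cong)
    finally show "Re (\<psi> x) = (SUP d\<in>D. Re (\<psi> d))" by (simp add: xM)
  qed
qed

lemma expectation_exists_unique:
  fixes M N :: "('a::complex_hilbert_space \<Rightarrow> 'a) set"
  assumes M: "star_subalgebra M" "is_unit_of M e"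
    and N: "von_neumann_subalgebra N M" "abelian N"
    and \<psi>: "state M \<psi>" "normal_functional M \<psi>" "faithful_on M \<psi>"
    and central: "\<And>a x. a \<in> N \<Longrightarrow> x \<in> M \<Longrightarrow> \<psi> (a \<circ> x) = \<psi> (x \<circ> a)"
  shows "\<exists>!E. E \<in> extensional M \<and> normal_preserving_expectation M N \<psi> E"
    and "normal_preserving_expectation M N \<psi> E \<Longrightarrow>
       E (op_unit M) = op_unit M \<and> completely_positive_on M E \<and> (\<forall>X\<in>M. E (E X) = E X) \<and>
       (\<forall>a\<in>N. \<forall>b\<in>N. \<forall>X\<in>M. E (a \<circ> X \<circ> b) = a \<circ> E X \<circ> b)"
proof -
  have Ns: "star_subalgebra N" and Nclosed: "closedin weak_operator_topology N" and NsubM: "N \<subseteq> M"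
    and eN: "e \<in> N"
    using N(1) op_unit_eq[OF M(2)] by (auto simp: von_neumann_subalgebra_def von_neumann_algebra_def)
  have unitN: "is_unit_of N e" using M(2) NsubM eN by (auto simp: is_unit_of_def)
  have app_M: "app (Bop x) = x" if "x \<in> M" for x by (rule app_Bop[OF M(1) that])
  have Mb: "bounded_clinear x" if "x \<in> M" for x using M(1) that by (auto simp: star_subalgebra_def)
  have Mcl: "(\<lambda>\<xi>. x \<xi> + y \<xi>) \<in> M" "x \<circ> y \<in> M" if "x \<in> M" "y \<in> M" for x y
    using M(1) that by (auto simp: star_subalgebra_def)
  have Mscale: "(\<lambda>\<xi>. c *\<^sub>C x \<xi>) \<in> M" if "x \<in> M" for x c
    using M(1) that by (auto simp: star_subalgebra_def)
  interpret M: normal_op_state "bops M" "Bop e" "\<lambda>X. \<psi> (app X)"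
    by (rule normal_op_state_bops[OF M \<psi>(1,2)])
  interpret N: op_algebra "bops N" "Bop e" by (rule op_algebra_bops[OF Ns unitN])
  interpret central_subalgebra "bops M" "Bop e" "\<lambda>X. \<psi> (app X)" "bops N"
  proof
    show "bops N \<subseteq> bops M" using NsubM by auto
    show "a * b = b * a" if "a \<in> bops N" "b \<in> bops N" for a b
      using N(2) that by (simp add: abelian_def times_bop.rep_eq flip: app_inject)
    show "r \<in> bops N" if "\<And>n. X n \<in> bops N" "slim X r" for X r
      using closedin_weak_operator_topology_slim[OF Nclosed, of X r] that by simp
    show "x = 0" if "x \<in> bops M" "0 \<le> x" "\<psi> (app x) = 0" for x
      using \<psi>(3) that by (simp add: faithful_on_def positive_op_app zero_bop.rep_eq flip: app_inject)
    show "\<psi> (app (a * x)) = \<psi> (app (x * a))" if "a \<in> bops N" "x \<in> bops M" for a x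
      using central that by (simp add: times_bop.rep_eq)
  qed
  \<comment> \<open>Restricted because uniqueness is claimed among extensional maps: an expectation
    is unconstrained off \<open>M\<close>.\<close>
  define E0 where "E0 = restrict (\<lambda>x. app (cond (Bop x))) M"
  have E0: "E0 x = app (cond (Bop x))" if "x \<in> M" for x using that by (simp add: E0_def)
  have BM: "Bop x \<in> bops M" if "x \<in> M" for x using app_M[OF that] that by simp
  have E0N: "E0 x \<in> N" if "x \<in> M" for x using cond_in[OF BM[OF that]] E0[OF that] by simp
  have bound: "norm (E0 x \<xi>) \<le> onorm x * norm \<xi>" if x: "x \<in> M" for x \<xi>
  proof -
    have b: "bounded_linear x" using Mb[OF x] by (simp add: bounded_clinear_def)
    have "norm (app (Bop x) \<eta>) \<le> onorm x * norm \<eta>" for \<eta> using onorm[OF b] app_M[OF x] by simp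
    then have "star (Bop x) * Bop x \<le> (onorm x)\<^sup>2 *\<^sub>R 1" by (rule star_mult_le_if_norm_app_le)
    then have "star (cond (Bop x)) * cond (Bop x) \<le> (onorm x)\<^sup>2 *\<^sub>R 1"
      by (rule cond_norm[OF BM[OF x]]) simp
    then show ?thesis
      unfolding E0[OF x] by (rule norm_app_le) (rule onorm_pos_le[OF b])
  qed
  have e: "e \<in> M" using eN NsubM by blast
  have E0_id: "E0 a = a" if "a \<in> N" for a
    using cond_id[of "Bop a"] app_M[of a] E0[of a] that NsubM by auto
  \<comment> \<open>The constant 1 in the map norm is attained at the unit, provided the unit is
    nonzero; \<psi>(e) = 1 ensures this.\<close>
  have e_pos: "0 < onorm e"
  proof -
    have b: "bounded_linear e" using Mb[OF e] by (simp add: bounded_clinear_def)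
    have "e \<noteq> (\<lambda>\<xi>. 0)"
      using M.fzero M.funit app_M[OF e] by (auto simp: zero_bop.rep_eq)
    then show ?thesis using onorm_pos_lt[OF b] by auto
  qed
  have exp: "normal_preserving_expectation M N \<psi> E0"
    unfolding normal_preserving_expectation_def conditional_expectation_def
  proof (intro conjI ballI)
    show "linear_map_on M E0"
      unfolding linear_map_on_def using Mcl Mscale
      by (auto simp: E0 Bop_add Bop_scaleC Mb cond_add cond_csc BM app_M plus_bop.rep_eq csc.rep_eq)
    show "has_map_norm M E0 1"
      unfolding has_map_norm_def
    proof (intro conjI ballI allI impI)
      show "onorm (E0 x) \<le> 1 * onorm x" if "x \<in> M" for x
        
        using onorm_bound[of "onorm x" "E0 x"] bound[OF that] onorm_pos_le[of x] Mb[OF that]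
        by (simp add: bounded_clinear_def)
      fix L :: real assume "\<forall>x\<in>M. onorm (E0 x) \<le> L * onorm x"
      then have "onorm e \<le> L * onorm e" using E0_id[OF eN] e by force
      then show "1 \<le> L" using e_pos by simp
    qed simp
    show "normal_map M N E0"
      unfolding normal_map_def
    proof (intro allI impI)
      fix D x assume D: "D \<subseteq> sa_part M \<and> op_directed D \<and> is_op_lub M D x"
      have DM: "app (Bop d) = d" "d \<in> M" if "d \<in> D" for d
        using D that app_M by (auto simp: sa_part_def)
      have xM: "x \<in> M" "app (Bop x) = x" using D app_M by (auto simp: is_op_lub_def sa_part_def)
      have img: "app ` Bop ` D = D" using DM by (force simp: image_image)
      have "is_lub_in (bops N) (cond ` Bop ` D) (cond (Bop x))"
      proof (rule cond_normal)
        show "Bop ` D \<subseteq> {X \<in> bops M. star X = X}"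
          using D DM by (auto simp: sa_part_def star.rep_eq simp flip: app_inject)
        show "upward_directed (Bop ` D)"
          using D DM by (simp add: upward_directed_def op_directed_def less_eq_bop.rep_eq)
        show "is_lub_in (bops M) (Bop ` D) (Bop x)"
          unfolding is_lub_in_bops[OF M(1)] img xM(2) using D by blast
      qed
      then have "is_op_lub N (app ` cond ` Bop ` D) (app (cond (Bop x)))"
        unfolding is_lub_in_bops[OF Ns] .
      moreover have "app ` cond ` Bop ` D = E0 ` D"
        using E0[OF DM(2)] by (simp add: image_image cong: image_cong)
      ultimately show "is_op_lub N (E0 ` D) (E0 x)" by (simp add: E0[OF xM(1)])
    qed
    show "\<psi> (E0 x) = \<psi> x" if "x \<in> M" for x
      using f_cond[OF BM[OF that]] by (simp add: E0 app_M that)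
  qed (use E0N E0_id in auto)
  have unique: "E x = app (cond (Bop x))"
    if E: "normal_preserving_expectation M N \<psi> E" and x: "x \<in> M" for E x
  proof -
    have lin: "linear_map_on M E" and EN: "\<And>x. x \<in> M \<Longrightarrow> E x \<in> N" and Eid: "\<And>a. a \<in> N \<Longrightarrow> E a = a"
      and En: "\<And>x. x \<in> M \<Longrightarrow> onorm (E x) \<le> onorm x" and E\<psi>: "\<And>x. x \<in> M \<Longrightarrow> \<psi> (E x) = \<psi> x"
      using E by (auto simp: normal_preserving_expectation_def conditional_expectation_def has_map_norm_def)
    have appE: "app (Bop (E x)) = E x" if "x \<in> M" for x using EN[OF that] NsubM app_M by blast
    have Eb: "bounded_clinear (E x)" if "x \<in> M" for x using EN[OF that] NsubM Mb by blast
    interpret expectation "bops M" "Bop e" "\<lambda>X. \<psi> (app X)" "bops N" "\<lambda>X. Bop (E (app X))"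
    proof
      fix X Y assume X: "X \<in> bops M"
      show "Bop (E (app (X + Y))) = Bop (E (app X)) + Bop (E (app Y))" if "Y \<in> bops M"
        using lin X that by (simp add: linear_map_on_def plus_bop.rep_eq Bop_add Eb)
      show "Bop (E (app (csc c X))) = csc c (Bop (E (app X)))" for c
        using lin X by (simp add: linear_map_on_def csc.rep_eq Bop_scaleC Eb)
      show "Bop (E (app X)) \<in> bops N" "\<psi> (app (Bop (E (app X)))) = \<psi> (app X)"
        using X EN E\<psi> appE by simp_all
      show "norm (app (Bop (E (app X))) \<xi>) \<le> r * norm \<xi>"
        if "0 \<le> r" "\<And>\<xi>. norm (app X \<xi>) \<le> r * norm \<xi>" for r \<xi>
        using that En[of "app X"] X onorm_app_le_iff[OF that(1), of X]
          onorm_app_le_iff[OF that(1), of "Bop (E (app X))"] appE[of "app X"] by force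
    next
      show "Bop (E (app A)) = A" if "A \<in> bops N" for A using that by (simp add: Eid app_inverse)
    qed
    show ?thesis using F_eq_cond[OF BM[OF x]] appE[OF x] by (simp add: app_M[OF x])
  qed
  show "\<exists>!E. E \<in> extensional M \<and> normal_preserving_expectation M N \<psi> E"
  proof (rule ex1I[of _ E0])
    show "E0 \<in> extensional M \<and> normal_preserving_expectation M N \<psi> E0"
      using exp by (simp add: E0_def)
    fix E assume "E \<in> extensional M \<and> normal_preserving_expectation M N \<psi> E"
    then show "E = E0" using unique E0 by (intro extensionalityI[of _ M]) (auto simp: E0_def)
  qed
  assume E: "normal_preserving_expectation M N \<psi> E"
  note Econd = unique[OF E]
  have EN: "E x \<in> N" "E x \<in> M" if "x \<in> M" for x
    using E that NsubM by (auto simp: normal_preserving_expectation_def conditional_expectation_def)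
  have Eid: "E a = a" if "a \<in> N" for a
    using E that by (auto simp: normal_preserving_expectation_def conditional_expectation_def)
  have "completely_positive_on M E"
    unfolding completely_positive_on_def
  proof (intro allI impI)
    fix n X assume X: "(\<forall>i<n. \<forall>j<n. X i j \<in> M) \<and> positive_op_matrix n X"
    define Y where "Y i j = Bop (X i j)" for i j
    have Y: "app (Y i j) = X i j" "Y i j \<in> bops M" if "i < n" "j < n" for i j
      using X that app_M by (simp_all add: Y_def)
    have pos: "positive_matrix n Y"
      using X Y by (simp add: positive_matrix_def positive_op_matrix_def)
    have "positive_matrix n (\<lambda>i j. cond (Y i j))"
      by (intro cond_completely_positive Y(2) pos)
    moreover have "E (X i j) = app (cond (Y i j))" if "i < n" "j < n" for i j
      using Econd[of "X i j"] X that by (simp add: Y_def)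
    ultimately show "positive_op_matrix n (\<lambda>i j. E (X i j))"
      by (simp add: positive_matrix_def positive_op_matrix_def)
  qed
  moreover have "E (a \<circ> X \<circ> b) = a \<circ> E X \<circ> b" if "a \<in> N" "b \<in> N" "X \<in> M" for a b X
  proof -
    have ab: "a \<in> M" "b \<in> M" using that NsubM by auto
    have "Bop (a \<circ> X \<circ> b) = Bop a * Bop X * Bop b"
      using ab that(3) by (simp add: Bop_comp Mb bounded_clinear_comp)
    then have "E (a \<circ> X \<circ> b) = app (Bop a * cond (Bop X) * Bop b)"
      using Econd[of "a \<circ> X \<circ> b"] cond_bimodule[of "Bop a" "Bop b" "Bop X"] ab that
      by (simp add: Mcl app_M)
    then show ?thesis by (simp add: times_bop.rep_eq app_M ab Econd[OF that(3)])
  qed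
  ultimately show "E (op_unit M) = op_unit M \<and> completely_positive_on M E \<and> (\<forall>X\<in>M. E (E X) = E X) \<and>
       (\<forall>a\<in>N. \<forall>b\<in>N. \<forall>X\<in>M. E (a \<circ> X \<circ> b) = a \<circ> E X \<circ> b)"
    using Eid EN eN op_unit_eq[OF M(2)] by simp
qed

theorem corollary5p5:
  fixes M Mr :: "('a::complex_hilbert_space \<Rightarrow> 'a) set"
    and N Nr :: "real \<Rightarrow> ('a \<Rightarrow> 'a) set"
    and T :: real
    and \<psi> :: "('a \<Rightarrow> 'a) \<Rightarrow> complex"
    and p :: "'a \<Rightarrow> 'a"
    and \<pi> :: "('a \<Rightarrow> 'a) \<Rightarrow> ('b::complex_hilbert_space \<Rightarrow> 'b)"
    and \<Omega> :: 'b
    and \<sigma> :: "real \<Rightarrow> ('a \<Rightarrow> 'a) \<Rightarrow> ('a \<Rightarrow> 'a)"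
  assumes "von_neumann_algebra M"
    and "\<forall>t\<in>{0..T}. von_neumann_subalgebra (N t) M \<and> abelian (N t)"
    and "mono_on {0..T} N"
    and "normal_state M \<psi>"
    and "faithful_on M \<psi> \<and> Mr = M \<and> Nr = N \<or>
         \<not> faithful_on M \<psi> \<and> is_support_projection M \<psi> p \<and>
           Mr = corner p M \<and> Nr = (\<lambda>t. corner p (N t)) \<and>
           (\<forall>t\<in>{0..T}. von_neumann_subalgebra (Nr t) Mr \<and> abelian (Nr t))"
    and "is_modular_group Mr \<psi> \<pi> \<Omega> \<sigma>"
    and "modularly_compatible T Nr \<sigma>"
  shows "\<forall>t\<in>{0..T}.
    (\<exists>!E. E \<in> extensional Mr \<and> normal_preserving_expectation Mr (Nr t) \<psi> E) \<and>
    (\<forall>E. normal_preserving_expectation Mr (Nr t) \<psi> E \<longrightarrow>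
       E (op_unit Mr) = op_unit Mr \<and>
       completely_positive_on Mr E \<and>
       (\<forall>X\<in>Mr. E (E X) = E X) \<and>
       (\<forall>a\<in>Nr t. \<forall>b\<in>Nr t. \<forall>X\<in>Mr. E (a \<circ> X \<circ> b) = a \<circ> E X \<circ> b))"
proof
  fix t assume t: "t \<in> {0..T}"
  obtain e0 where M: "star_subalgebra M" "is_unit_of M e0"
    using assms(1) by (auto simp: von_neumann_algebra_def)
  \<comment> \<open>Both cases reduce to the same data: an algebra with a unit and a faithful normal
    state.\<close>
  have "\<exists>e. star_subalgebra Mr \<and> is_unit_of Mr e \<and> state Mr \<psi> \<and> normal_functional Mr \<psi> \<and> faithful_on Mr \<psi>"
    using assms(5)
  proof
    assume "faithful_on M \<psi> \<and> Mr = M \<and> Nr = N"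
    then show ?thesis using M assms(4) by (auto simp: normal_state_def)
  next
    assume A: "\<not> faithful_on M \<psi> \<and> is_support_projection M \<psi> p \<and> Mr = corner p M \<and>
      Nr = (\<lambda>t. corner p (N t)) \<and> (\<forall>t\<in>{0..T}. von_neumann_subalgebra (Nr t) Mr \<and> abelian (Nr t))"
    then have "p \<in> M" "is_projection p" by (auto simp: is_support_projection_def)
    then show ?thesis
      using corner_star_subalgebra(2,3)[OF M(1)] corner_normal_state[OF assms(1,4)] A by blast
  qed
  then obtain e where Mr: "star_subalgebra Mr" "is_unit_of Mr e"
    and \<psi>: "state Mr \<psi>" "normal_functional Mr \<psi>" "faithful_on Mr \<psi>"
    by blast
  have Nr: "von_neumann_subalgebra (Nr t) Mr" "abelian (Nr t)"
    using assms(2,5) t by auto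
  then have Nr': "star_subalgebra (Nr t)" "Nr t \<subseteq> Mr"
    by (auto simp: von_neumann_subalgebra_def von_neumann_algebra_def)
  have "\<sigma> s ` Nr t = Nr t" for s using assms(7) t by (simp add: modularly_compatible_def)
  then have central: "\<psi> (a \<circ> x) = \<psi> (x \<circ> a)" if "a \<in> Nr t" "x \<in> Mr" for a x
    using modular_group_central[OF Mr Nr' Nr(2) assms(6)] that by blast
  show "(\<exists>!E. E \<in> extensional Mr \<and> normal_preserving_expectation Mr (Nr t) \<psi> E) \<and>
    (\<forall>E. normal_preserving_expectation Mr (Nr t) \<psi> E \<longrightarrow>
       E (op_unit Mr) = op_unit Mr \<and>
       completely_positive_on Mr E \<and>
       (\<forall>X\<in>Mr. E (E X) = E X) \<and>
       (\<forall>a\<in>Nr t. \<forall>b\<in>Nr t. \<forall>X\<in>Mr. E (a \<circ> X \<circ> b) = a \<circ> E X \<circ> b))"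
    using expectation_exists_unique[OF Mr Nr \<psi> central] by blast
qed

end
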